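(* Let $f:[0,1]\to[0,\infty)$ be continuous and non-decreasing with $f(u)>0$ for $u\in(0,1]$, and for each $n$ let $w_i=f(i/n)$, $i=1,\dots,n$, and $\mathcal{P}=\{\mathbf{x}\in\mathbb{R}^n:\sum_i w_i|x_i|\le1\}$. Let $0<\delta<\tau<1$, and for $n$ with $k=\delta n$, $l=\tau n$ integers let $G_0^l$ be the face of $\mathcal{P}$ with vertices $\frac{1}{w_1}e_1,\dots,\frac{1}{w_l}e_l$ and $F_0^k\subset G_0^l$ the face with vertices $\frac{1}{w_1}e_1,\dots,\frac1{w_k}e_k$. With $\bar\psi_{int}(\delta,\tau)$ and $\bar\psi_{ext}(\tau)$ as defined in the context, for every $\epsilon>0$ there are integers $n_0(\epsilon),n_1(\epsilon)$ such that $n^{-1}\log\beta(F_0^k,G_0^l)<\bar\psi_{int}(\delta,\tau)+\epsilon$ for all $n>n_0(\epsilon)$, and $n^{-1}\log\gamma(G_0^l,\mathcal{P})<\bar\psi_{ext}(\tau)+\epsilon$ for all $n>n_1(\epsilon)$.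
   Context: Internal angle: for faces $F\subseteq G$ of a polytope, take $\mathbf{x}$ in the relative interior of $F$, let $C=\{t(\mathbf{g}-\mathbf{x}):\mathbf{g}\in G,t\ge0\}$ and $V$ the linear span of $G-\mathbf{x}$; $\beta(F,G)$ is the fraction of the volume of the unit ball of $V$ covered by $C$ ($\beta(F,F)=1$). External angle: for a face $G$ of $\mathcal{P}$ and $\mathbf{x}$ in its relative interior, the normal cone $N=\{\mathbf{v}:\langle \mathbf{v},\mathbf{z}-\mathbf{x}\rangle\le0\ \forall \mathbf{z}\in\mathcal{P}\}$; $\gamma(G,\mathcal{P})$ is the fraction of the volume of the unit ball of the linear span of $N$ covered by $N$. Let $\Phi$ be the standard normal distribution function, $\lambda(s)=\frac{s^2}{2}+\log(2\Phi(s))$, $\operatorname{erf}(x)=\frac{2}{\sqrt\pi}\int_0^xe^{-t^2}dt$. Define $c_0=\int_\delta^\tau f(u)du$, $c_1=\int_0^\delta f^2(u)du$, $\lambda_0(s)=\frac1{c_0}\int_\delta^\tau\lambda(sf(u))du$, $\lambda_0^*(y)=\sup_{s\in\mathbb{R}}(sy-\lambda_0(s))$, $\eta(y)=\frac{c_0^2}{2c_1}y^2+c_0\lambda_0^*(y)$ and $\bar\psi_{int}(\delta,\tau)=-(\tau-\delta)\log2-\inf_{y\in\mathbb{R}}\eta(y)$. Define $c_2=\int_0^\tau f^2(u)du$, $\zeta(x)=c_2x^2-\int_\tau^1\log\operatorname{erf}(xf(u))du$ and $\bar\psi_{ext}(\tau)=-\inf_{x>0}\zeta(x)$. *)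

theory Defs
  imports "HOL-Analysis.Analysis" "HOL-Probability.Probability"
begin

definition Rn :: "nat \<Rightarrow> (nat \<Rightarrow> real) set" where
  "Rn n = {x. \<forall>i\<ge>n. x i = 0}"

definition ipn :: "nat \<Rightarrow> (nat \<Rightarrow> real) \<Rightarrow> (nat \<Rightarrow> real) \<Rightarrow> real" where
  "ipn n x y = (\<Sum>i<n. x i * y i)"

definition normn :: "nat \<Rightarrow> (nat \<Rightarrow> real) \<Rightarrow> real" where
  "normn n x = sqrt (ipn n x x)"

definition lin_span :: "(nat \<Rightarrow> real) set \<Rightarrow> (nat \<Rightarrow> real) set" where
  "lin_span S = {v. \<exists>T c. finite T \<and> T \<subseteq> S \<and> v = (\<lambda>i. \<Sum>s\<in>T. c s * s i)}"

definition aff_hull :: "(nat \<Rightarrow> real) set \<Rightarrow> (nat \<Rightarrow> real) set" where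
  "aff_hull S = {v. \<exists>T c. finite T \<and> T \<noteq> {} \<and> T \<subseteq> S \<and> sum c T = 1
                     \<and> v = (\<lambda>i. \<Sum>s\<in>T. c s * s i)}"

definition conv_hull :: "(nat \<Rightarrow> real) set \<Rightarrow> (nat \<Rightarrow> real) set" where
  "conv_hull S = {v. \<exists>T c. finite T \<and> T \<noteq> {} \<and> T \<subseteq> S \<and> (\<forall>s\<in>T. c s \<ge> 0)
                     \<and> sum c T = 1 \<and> v = (\<lambda>i. \<Sum>s\<in>T. c s * s i)}"

definition relint :: "nat \<Rightarrow> (nat \<Rightarrow> real) set \<Rightarrow> (nat \<Rightarrow> real) set" where
  "relint n S = {x\<in>S. \<exists>e>0. \<forall>y\<in>aff_hull S. normn n (\<lambda>i. y i - x i) < e \<longrightarrow> y \<in> S}"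

definition onb :: "nat \<Rightarrow> (nat \<Rightarrow> real) set \<Rightarrow> nat \<Rightarrow> (nat \<Rightarrow> nat \<Rightarrow> real) \<Rightarrow> bool" where
  "onb n V d b \<longleftrightarrow> (\<forall>j<d. b j \<in> Rn n)
     \<and> (\<forall>j<d. \<forall>j'<d. ipn n (b j) (b j') = (if j = j' then 1 else 0))
     \<and> V = {(\<lambda>i. \<Sum>j<d. y j * b j i) | y. True}"

text \<open>The d-dimensional volume in V is transported to R^d = PiM {..<d} lborel via the
  isometry y |-> sum_j y_j b_j.  The ratio does not depend on the chosen basis.\<close>

definition ball_frac :: "nat \<Rightarrow> (nat \<Rightarrow> real) set \<Rightarrow> (nat \<Rightarrow> real) set \<Rightarrow> real" where
  "ball_frac n C V = (let (d, b) = (SOME (d, b). onb n V d b) in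
      measure (PiM {..<d} (\<lambda>_. lborel :: real measure))
        {y \<in> PiE {..<d} (\<lambda>_. UNIV). (\<lambda>i. \<Sum>j<d. y j * b j i) \<in> C \<and> (\<Sum>j<d. (y j)\<^sup>2) \<le> 1}
      / measure (PiM {..<d} (\<lambda>_. lborel :: real measure))
        {y \<in> PiE {..<d} (\<lambda>_. UNIV :: real set). (\<Sum>j<d. (y j)\<^sup>2) \<le> 1})"

definition int_angle :: "nat \<Rightarrow> (nat \<Rightarrow> real) set \<Rightarrow> (nat \<Rightarrow> real) set \<Rightarrow> real" where
  "int_angle n F G = (let x = (SOME x. x \<in> relint n F) in
     ball_frac n {(\<lambda>i. t * (g i - x i)) | t g. g \<in> G \<and> t \<ge> 0}
                 (lin_span {(\<lambda>i. g i - x i) | g. g \<in> G}))"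

definition normal_cone :: "nat \<Rightarrow> (nat \<Rightarrow> real) set \<Rightarrow> (nat \<Rightarrow> real) \<Rightarrow> (nat \<Rightarrow> real) set" where
  "normal_cone n P x = {v \<in> Rn n. \<forall>z\<in>P. ipn n v (\<lambda>i. z i - x i) \<le> 0}"

definition ext_angle :: "nat \<Rightarrow> (nat \<Rightarrow> real) set \<Rightarrow> (nat \<Rightarrow> real) set \<Rightarrow> real" where
  "ext_angle n G P = (let x = (SOME x. x \<in> relint n G) in
     ball_frac n (normal_cone n P x) (lin_span (normal_cone n P x)))"

text \<open>Coordinates are indexed 0..n-1; coordinate i corresponds to index i+1 of the paper,
  so the weight is w_(i+1) = f((i+1)/n).\<close>

definition wt :: "(real \<Rightarrow> real) \<Rightarrow> nat \<Rightarrow> nat \<Rightarrow> real" where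
  "wt f n i = f (real (Suc i) / real n)"

definition wpoly :: "(real \<Rightarrow> real) \<Rightarrow> nat \<Rightarrow> (nat \<Rightarrow> real) set" where
  "wpoly f n = {x \<in> Rn n. (\<Sum>i<n. wt f n i * \<bar>x i\<bar>) \<le> 1}"

definition wface :: "(real \<Rightarrow> real) \<Rightarrow> nat \<Rightarrow> nat \<Rightarrow> (nat \<Rightarrow> real) set" where
  "wface f n m = conv_hull {(\<lambda>j. if j = i then 1 / wt f n i else 0) | i. i < m}"

definition Phi :: "real \<Rightarrow> real" where
  "Phi s = (LBINT t:{..s}. std_normal_density t)"

definition lam :: "real \<Rightarrow> real" where
  "lam s = s\<^sup>2 / 2 + ln (2 * Phi s)"

definition erf :: "real \<Rightarrow> real" where
  "erf x = 2 / sqrt pi * (LBINT t=0..x. exp (- t\<^sup>2))"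

definition psi_int :: "(real \<Rightarrow> real) \<Rightarrow> real \<Rightarrow> real \<Rightarrow> ereal" where
  "psi_int f \<delta> \<tau> = (let
      c0 = (LBINT u=\<delta>..\<tau>. f u);
      c1 = (LBINT u=0..\<delta>. (f u)\<^sup>2);
      lam0 = (\<lambda>s. (1 / c0) * (LBINT u=\<delta>..\<tau>. lam (s * f u)));
      lam0_star = (\<lambda>y. (SUP s. ereal (s * y - lam0 s)) :: ereal);
      eta = (\<lambda>y. ereal (c0\<^sup>2 / (2 * c1) * y\<^sup>2) + ereal c0 * lam0_star y)
    in ereal (- (\<tau> - \<delta>) * ln 2) - (INF y. eta y))"

definition psi_ext :: "(real \<Rightarrow> real) \<Rightarrow> real \<Rightarrow> real" where
  "psi_ext f \<tau> = (let
      c2 = (LBINT u=0..\<tau>. (f u)\<^sup>2);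
      zeta = (\<lambda>x. c2 * x\<^sup>2 - (LBINT u=\<tau>..1. ln (erf (x * f u))))
    in - (INF x\<in>{0<..}. zeta x))"

end

theory Submission
  imports Defs
begin

text \<open>A cone covers the same fraction of the unit ball as of the standard Gaussian measure.
  Projecting its linear span onto suitable coordinates turns each cone into an orthant (internal
  angle) or into \<open>{(t, z). \<bar>z\<^sub>i\<bar> \<le> t w\<^sub>i}\<close> (external angle), so each angle is a quotient of two explicit
  integrals. For the internal angle the denominator is only polynomially small in \<open>n\<close>, and the
  Chernoff bound \<open>- U\<^sup>2 / (2 w\<^sup>2) \<le> s U + s\<^sup>2 w\<^sup>2 / 2\<close> factorises the numerator into moment generating
  functions of \<open>\<bar>g\<bar>\<close>. The best \<open>s\<close> minimises \<open>c\<^sub>1 s\<^sup>2 / 2 + c\<^sub>0 \<lambda>\<^sub>0(s)\<close>, and Fenchel duality bounds this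
  minimum by \<open>- inf \<eta>\<close>. The external angle is a one-dimensional integral of \<open>exp (- n \<zeta>\<^sub>n(x))\<close>, treated
  by Laplace's method. Since \<open>f\<close> is monotone, all Riemann sums compare with the integrals up to
  boundary terms.\<close>

section \<open>Cones, the unit ball and Gaussian integrals\<close>

text \<open>\<open>ball_frac\<close> refers to an orthonormal basis picked by \<open>SOME\<close>,
  so each span needs an explicit basis and a transfer to coordinates that is far from isometric. Its
  Jacobian never appears: the cone and its whole span acquire the same factor. For the internal
  angle the linear equation of the span eliminates coordinate \<open>k - 1\<close>. Its weight w
  equals \<open>f \<delta>\<close> for every admissible n, and its square supplies the term U^2 /
  w^2, where U is the weighted sum of the other coordinates. For the external angle the first l
  coordinates collapse to one ray parameter. Two points shape the asymptotics. The optimal s is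
  nonpositive, so \<open>lam (s * f u)\<close> decreases in u and its Riemann sum has no boundary
  term. In the external exponent \<open>ln (erf (x * f u))\<close> is unbounded near x = 0, and
  nothing integrable is left once \<open>exp (- n * m)\<close>, with m the infimum of \<zeta>, is
  pulled out. Hence small x are treated separately, and a 1/n share of the exponent is kept as a
  Gaussian factor.\<close>

abbreviation lebn :: "nat set \<Rightarrow> (nat \<Rightarrow> real) measure" where
  "lebn I \<equiv> Pi\<^sub>M I (\<lambda>_. lborel)"

interpretation lborel_product: product_sigma_finite "\<lambda>_::nat. lborel :: real measure"
  by standard

text \<open>Translations and homotheties act coordinatewise, so Fubini reduces them to the
  one-dimensional affine substitution, each coordinate contributing one factor
  \<open>\<bar>c\<bar>\<close>. \<open>c = 1\<close> gives translation invariance,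
  \<open>t = 0\<close> the scaling of cones.\<close>

lemma nn_integral_lebn_affine:
  fixes c :: real
  assumes "finite I" "c \<noteq> 0" "g \<in> borel_measurable (lebn I)"
  shows "(\<integral>\<^sup>+y. g y \<partial>lebn I) = ennreal (\<bar>c\<bar> ^ card I) * (\<integral>\<^sup>+y. g (\<lambda>i\<in>I. t i + c * y i) \<partial>lebn I)"
  using assms(1,3)
proof (induction I arbitrary: g rule: finite_induct)
  case empty
  then show ?case by (simp add: PiM_empty nn_integral_count_space_finite)
next
  case (insert j I)
  note [measurable] = insert.prems
  have m1[measurable]: "(\<lambda>x. g (x(j := t j + c * y))) \<in> borel_measurable (lebn I)" for y
    by measurable
  have m2: "(\<lambda>y. g (\<lambda>i\<in>insert j I. t i + c * y i)) \<in> borel_measurable (lebn (insert j I))"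
    by measurable
  have m3: "(\<lambda>x. \<integral>\<^sup>+ y. g (x(j := t j + c * y)) \<partial>lborel) \<in> borel_measurable (lebn I)"
    by measurable
  have "(\<integral>\<^sup>+y. g y \<partial>lebn (insert j I)) = (\<integral>\<^sup>+ x. (\<integral>\<^sup>+ y. g (x(j := y)) \<partial>lborel) \<partial>lebn I)"
    by (rule lborel_product.product_nn_integral_insert[OF insert.hyps insert.prems])
  also have "\<dots> = (\<integral>\<^sup>+ x. ennreal \<bar>c\<bar> * (\<integral>\<^sup>+ y. g (x(j := t j + c * y)) \<partial>lborel) \<partial>lebn I)"
  proof (rule nn_integral_cong)
    fix x assume [measurable]: "x \<in> space (lebn I)"
    show "(\<integral>\<^sup>+ y. g (x(j := y)) \<partial>lborel) = ennreal \<bar>c\<bar> * (\<integral>\<^sup>+ y. g (x(j := t j + c * y)) \<partial>lborel)"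
      by (rule nn_integral_real_affine) (use assms in \<open>measurable\<close>)
  qed
  also have "\<dots> = ennreal \<bar>c\<bar> * (\<integral>\<^sup>+ x. (\<integral>\<^sup>+ y. g (x(j := t j + c * y)) \<partial>lborel) \<partial>lebn I)"
    using m3 by (rule nn_integral_cmult)
  also have "\<dots> = ennreal \<bar>c\<bar> * (ennreal (\<bar>c\<bar> ^ card I) *
      (\<integral>\<^sup>+ x. (\<integral>\<^sup>+ y. g ((\<lambda>i\<in>I. t i + c * x i)(j := t j + c * y)) \<partial>lborel) \<partial>lebn I))"
    by (rule arg_cong[OF insert.IH[OF m3]])
  also have "(\<integral>\<^sup>+ x. (\<integral>\<^sup>+ y. g ((\<lambda>i\<in>I. t i + c * x i)(j := t j + c * y)) \<partial>lborel) \<partial>lebn I)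
     = (\<integral>\<^sup>+ x. (\<integral>\<^sup>+ y. g (\<lambda>i\<in>insert j I. t i + c * (x(j := y)) i) \<partial>lborel) \<partial>lebn I)"
    using insert.hyps by (intro nn_integral_cong arg_cong[where f=g]) auto
  also have "\<dots> = (\<integral>\<^sup>+y. g (\<lambda>i\<in>insert j I. t i + c * y i) \<partial>lebn (insert j I))"
    by (rule lborel_product.product_nn_integral_insert[OF insert.hyps m2, symmetric])
  finally show ?case
    by (simp only: card_insert_disjoint[OF insert.hyps] power_Suc ennreal_mult abs_ge_zero zero_le_power mult.assoc)
qed

text \<open>Instead of a change of variables formula: any two nonzero translation invariant integrals are
  proportional, and symmetry in \<open>G\<close> and \<open>H\<close> eliminates the factor.\<close>

lemma nn_integral_linear_onto_ratio:
  fixes L :: "(nat \<Rightarrow> real) \<Rightarrow> nat \<Rightarrow> real"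
  assumes fin: "finite I" "finite J"
    and L[measurable]: "L \<in> measurable (lebn J) (lebn I)"
    and onto: "\<And>z. z \<in> space (lebn I) \<Longrightarrow>
        \<exists>a. \<forall>x\<in>space (lebn J). L (\<lambda>j\<in>J. a j + x j) = (\<lambda>i\<in>I. z i + L x i)"
    and G[measurable]: "G \<in> borel_measurable (lebn I)"
    and H[measurable]: "H \<in> borel_measurable (lebn I)"
  shows "(\<integral>\<^sup>+x. G (L x) \<partial>lebn J) * (\<integral>\<^sup>+z. H z \<partial>lebn I)
       = (\<integral>\<^sup>+x. H (\<lambda>i\<in>I. - L x i) \<partial>lebn J) * (\<integral>\<^sup>+z. G z \<partial>lebn I)"
proof -
  interpret J: sigma_finite_measure "lebn J" by (rule lborel_product.sigma_finite[OF fin(2)])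
  interpret I: sigma_finite_measure "lebn I" by (rule lborel_product.sigma_finite[OF fin(1)])
  interpret pair_sigma_finite "lebn J" "lebn I" ..
  have trans: "(\<integral>\<^sup>+y. g y \<partial>lebn K) = (\<integral>\<^sup>+y. g (\<lambda>i\<in>K. t i + y i) \<partial>lebn K)"
    if "finite K" "g \<in> borel_measurable (lebn K)" for g t K
    using nn_integral_lebn_affine[OF that(1) _ that(2), of 1 t] by simp
  have L1: "(\<lambda>p. L (fst p) i) \<in> borel_measurable (lebn J \<Otimes>\<^sub>M lebn I)"
    and L2: "(\<lambda>p. snd p i) \<in> borel_measurable (lebn J \<Otimes>\<^sub>M lebn I)" if "i \<in> I" for i
    using measurable_compose[OF measurable_fst measurable_compose[OF L measurable_component_singleton[OF that]]]
      measurable_compose[OF measurable_snd measurable_component_singleton[OF that, where M="\<lambda>_. lborel"]] by simp_all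
  have L3: "(\<lambda>p. \<lambda>i\<in>I. - L (fst p) i + snd p i) \<in> measurable (lebn J \<Otimes>\<^sub>M lebn I) (lebn I)"
    "(\<lambda>p. \<lambda>i\<in>I. snd p i + L (fst p) i) \<in> measurable (lebn J \<Otimes>\<^sub>M lebn I) (lebn I)"
    "(\<lambda>p. \<lambda>i\<in>I. - L (fst p) i) \<in> measurable (lebn J \<Otimes>\<^sub>M lebn I) (lebn I)"
    by (rule measurable_restrict; use L1 L2 in simp)+
  have GH: "(\<lambda>(x, z). G (L x) * H (\<lambda>i\<in>I. - L x i + z i)) \<in> borel_measurable (lebn J \<Otimes>\<^sub>M lebn I)"
    "(\<lambda>(x, z). G (\<lambda>i\<in>I. z i + L x i) * H (\<lambda>i\<in>I. - L x i)) \<in> borel_measurable (lebn J \<Otimes>\<^sub>M lebn I)"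
    unfolding split_beta' using measurable_compose[OF L3(1) H] measurable_compose[OF L3(2) G]
      measurable_compose[OF L3(3) H] by measurable
  have "(\<integral>\<^sup>+x. G (L x) \<partial>lebn J) * (\<integral>\<^sup>+z. H z \<partial>lebn I)
      = (\<integral>\<^sup>+x. G (L x) * (\<integral>\<^sup>+z. H z \<partial>lebn I) \<partial>lebn J)"
    by (simp add: nn_integral_multc)
  \<comment> \<open>For fixed \<open>x\<close> the integral of \<open>H\<close> is unchanged by the
    translation by \<open>- L x\<close>.\<close>
  also have "\<dots> = (\<integral>\<^sup>+x. (\<integral>\<^sup>+z. G (L x) * H (\<lambda>i\<in>I. - L x i + z i) \<partial>lebn I) \<partial>lebn J)"
  proof (rule nn_integral_cong)
    fix x assume x[measurable]: "x \<in> space (lebn J)"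
    have m: "(\<lambda>z. H (\<lambda>i\<in>I. - L x i + z i)) \<in> borel_measurable (lebn I)"
      by measurable
    show "G (L x) * (\<integral>\<^sup>+z. H z \<partial>lebn I) = (\<integral>\<^sup>+z. G (L x) * H (\<lambda>i\<in>I. - L x i + z i) \<partial>lebn I)"
      by (subst nn_integral_cmult[OF m]) (use trans[OF fin(1) H, of "\<lambda>i. - L x i"] in simp)
  qed
  also have "\<dots> = (\<integral>\<^sup>+z. (\<integral>\<^sup>+x. G (L x) * H (\<lambda>i\<in>I. - L x i + z i) \<partial>lebn J) \<partial>lebn I)"
    by (rule Fubini'[OF GH(1), symmetric])
  also have "\<dots> = (\<integral>\<^sup>+z. (\<integral>\<^sup>+x. G (\<lambda>i\<in>I. z i + L x i) * H (\<lambda>i\<in>I. - L x i) \<partial>lebn J) \<partial>lebn I)"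
  proof (rule nn_integral_cong)
    fix z assume z[measurable]: "z \<in> space (lebn I)"
    \<comment> \<open>A shift by a preimage \<open>a\<close> of \<open>z\<close> turns
      \<open>L x\<close> into \<open>z + L x\<close>, while the argument of \<open>H\<close> becomes
      \<open>- L x\<close>: all dependence on \<open>z\<close> moves into \<open>G\<close>.\<close>
    obtain a where a: "\<forall>x\<in>space (lebn J). L (\<lambda>j\<in>J. a j + x j) = (\<lambda>i\<in>I. z i + L x i)"
      using onto[OF z] by blast
    have "(\<lambda>x. \<lambda>i\<in>I. - L x i + z i) \<in> measurable (lebn J) (lebn I)"
    proof (rule measurable_restrict)
      fix i assume "i \<in> I"
      then have "(\<lambda>x. L x i) \<in> borel_measurable (lebn J)"
        using measurable_compose[OF L measurable_component_singleton[where M="\<lambda>_. lborel"]] by simp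
      then show "(\<lambda>x. - L x i + z i) \<in> measurable (lebn J) lborel" by simp
    qed
    from measurable_compose[OF this H]
    have m: "(\<lambda>x. G (L x) * H (\<lambda>i\<in>I. - L x i + z i)) \<in> borel_measurable (lebn J)"
      by measurable
    have "(\<integral>\<^sup>+x. G (L x) * H (\<lambda>i\<in>I. - L x i + z i) \<partial>lebn J)
       = (\<integral>\<^sup>+x. G (L (\<lambda>j\<in>J. a j + x j)) * H (\<lambda>i\<in>I. - L (\<lambda>j\<in>J. a j + x j) i + z i) \<partial>lebn J)"
      by (rule trans[OF fin(2) m])
    also have "\<dots> = (\<integral>\<^sup>+x. G (\<lambda>i\<in>I. z i + L x i) * H (\<lambda>i\<in>I. - L x i) \<partial>lebn J)"
      using a by (intro nn_integral_cong arg_cong2[where f="(*)"] arg_cong[where f=G] arg_cong[where f=H])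
        (auto simp: restrict_def)
    finally show "(\<integral>\<^sup>+x. G (L x) * H (\<lambda>i\<in>I. - L x i + z i) \<partial>lebn J)
       = (\<integral>\<^sup>+x. G (\<lambda>i\<in>I. z i + L x i) * H (\<lambda>i\<in>I. - L x i) \<partial>lebn J)" .
  qed
  also have "\<dots> = (\<integral>\<^sup>+x. (\<integral>\<^sup>+z. G (\<lambda>i\<in>I. z i + L x i) * H (\<lambda>i\<in>I. - L x i) \<partial>lebn I) \<partial>lebn J)"
    by (rule Fubini'[OF GH(2)])
  also have "\<dots> = (\<integral>\<^sup>+x. H (\<lambda>i\<in>I. - L x i) * (\<integral>\<^sup>+z. G z \<partial>lebn I) \<partial>lebn J)"
  proof (rule nn_integral_cong)
    fix x assume x[measurable]: "x \<in> space (lebn J)"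
    have m: "(\<lambda>z. G (\<lambda>i\<in>I. z i + L x i)) \<in> borel_measurable (lebn I)"
      by measurable
    show "(\<integral>\<^sup>+z. G (\<lambda>i\<in>I. z i + L x i) * H (\<lambda>i\<in>I. - L x i) \<partial>lebn I)
        = H (\<lambda>i\<in>I. - L x i) * (\<integral>\<^sup>+z. G z \<partial>lebn I)"
      by (subst nn_integral_multc[OF m]) (use trans[OF fin(1) G, of "L x"] in \<open>simp add: add.commute mult.commute\<close>)
  qed
  also have "\<dots> = (\<integral>\<^sup>+x. H (\<lambda>i\<in>I. - L x i) \<partial>lebn J) * (\<integral>\<^sup>+z. G z \<partial>lebn I)"
  proof (rule nn_integral_multc)
    have "(\<lambda>x. \<lambda>i\<in>I. - L x i) \<in> measurable (lebn J) (lebn I)"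
    proof (rule measurable_restrict)
      fix i assume "i \<in> I"
      then have "(\<lambda>x. L x i) \<in> borel_measurable (lebn J)"
        using measurable_compose[OF L measurable_component_singleton[where M="\<lambda>_. lborel"]] by simp
      then show "(\<lambda>x. - L x i) \<in> measurable (lebn J) lborel" by simp
    qed
    from measurable_compose[OF this H]
    show "(\<lambda>x. H (\<lambda>i\<in>I. - L x i)) \<in> borel_measurable (lebn J)" .
  qed
  finally show ?thesis .
qed

text \<open>Layer-cake formula: with \<open>a\<close> the squared norm of a vector, it writes the
  Gaussian weight as a mixture of indicators of balls of radius \<open>sqrt s\<close>.\<close>

lemma nn_integral_exp_half_atLeast:
  "(\<integral>\<^sup>+s. ennreal (exp (- s / 2) / 2) * indicator {a::real..} s \<partial>lborel) = ennreal (exp (- a / 2))"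
proof -
  have "(\<integral>\<^sup>+s. ennreal (exp (- s / 2) / 2) * indicator {a::real..} s \<partial>lborel) = ennreal (0 - (- exp (- a / 2)))"
  proof (rule nn_integral_FTC_atLeast)
    show "((\<lambda>s::real. - exp (- s / 2)) \<longlongrightarrow> 0) at_top" by real_asymp
  qed (auto intro!: derivative_eq_intros)
  then show ?thesis by simp
qed

text \<open>The Gaussian weight is a mixture of indicators of balls, and a cone meets the ball of
  radius \<open>sqrt s\<close> in a scaled copy of its part in the unit ball. The remaining integral
  over \<open>s\<close> depends only on the dimension, hence cancels when a cone is compared with
  the whole space.\<close>

lemma nn_integral_gaussian_cone:
  fixes A :: "(nat \<Rightarrow> real) set"
  assumes I[simp]: "finite I" and A[measurable]: "A \<in> sets (lebn I)"
    and cone: "\<And>y c. y \<in> A \<Longrightarrow> c > 0 \<Longrightarrow> (\<lambda>i\<in>I. c * y i) \<in> A"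
  shows "(\<integral>\<^sup>+y. ennreal (exp (- (\<Sum>i\<in>I. (y i)\<^sup>2) / 2)) * indicator A y \<partial>lebn I)
    = emeasure (lebn I) (A \<inter> {y\<in>space (lebn I). (\<Sum>i\<in>I. (y i)\<^sup>2) \<le> 1})
      * (\<integral>\<^sup>+s. ennreal (exp (- s / 2) / 2 * sqrt s ^ card I) * indicator {0..} s \<partial>lborel)"
proof -
  let ?q = "\<lambda>y::nat \<Rightarrow> real. \<Sum>i\<in>I. (y i)\<^sup>2"
  interpret I: sigma_finite_measure "lebn I" by (rule lborel_product.sigma_finite[OF I])
  interpret pair_sigma_finite "lebn I" lborel ..
  have [measurable]: "?q \<in> borel_measurable (lebn I)" by measurable
  have q0: "?q y \<ge> 0" for y by (simp add: sum_nonneg)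
  let ?B = "{y\<in>space (lebn I). ?q y \<le> 1}"
  let ?w = "\<lambda>s::real. ennreal (exp (- s / 2) / 2)"
  have meas: "(\<lambda>(y, s). ?w s * indicator {?q y..} s * indicator A y) \<in> borel_measurable (lebn I \<Otimes>\<^sub>M lborel)"
  proof -
    have [measurable]: "(\<lambda>p. ?q (fst p)) \<in> borel_measurable (lebn I \<Otimes>\<^sub>M (lborel :: real measure))"
      "(\<lambda>p. indicator A (fst p) :: ennreal) \<in> borel_measurable (lebn I \<Otimes>\<^sub>M (lborel :: real measure))"
      by (rule measurable_compose[OF measurable_fst]; measurable)+
    have "(\<lambda>p. ?w (snd p) * (if ?q (fst p) \<le> snd p then 1 else 0) * indicator A (fst p))
        \<in> borel_measurable (lebn I \<Otimes>\<^sub>M lborel)"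
      by measurable
    then show ?thesis by (simp add: split_beta' indicator_def of_bool_def)
  qed
  have m: "(\<lambda>y. indicator {?q y..} s * indicator A y :: ennreal) \<in> borel_measurable (lebn I)" for s
  proof -
    have "(\<lambda>y. indicator {..s} (?q y) * indicator A y :: ennreal) \<in> borel_measurable (lebn I)"
      by measurable
    then show ?thesis by (simp add: indicator_def)
  qed
  have inner: "(\<integral>\<^sup>+y. indicator {?q y..} s * indicator A y \<partial>lebn I)
      = ennreal (sqrt s ^ card I) * emeasure (lebn I) (A \<inter> ?B)" if "s > 0" for s
  proof -
    \<comment> \<open>Scaling by \<open>sqrt s\<close> carries the unit ball onto the ball of
      squared radius \<open>s\<close>. The cone property is applied to the factors
      \<open>sqrt s\<close> and \<open>1 / sqrt s\<close>, one for each direction.\<close>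
    have eq: "indicator {?q (\<lambda>i\<in>I. 0 + sqrt s * y i)..} s * indicator A (\<lambda>i\<in>I. 0 + sqrt s * y i)
        = (indicator (A \<inter> ?B) y :: ennreal)" if y: "y \<in> space (lebn I)" for y
    proof -
      have "?q (\<lambda>i\<in>I. 0 + sqrt s * y i) = s * ?q y"
        using \<open>s > 0\<close> by (simp add: power_mult_distrib sum_distrib_left)
      then have 1: "?q (\<lambda>i\<in>I. 0 + sqrt s * y i) \<le> s \<longleftrightarrow> ?q y \<le> 1"
        using \<open>s > 0\<close> by simp
      have "(\<lambda>i\<in>I. 1 / sqrt s * (\<lambda>i\<in>I. 0 + sqrt s * y i) i) = y"
        using y \<open>s > 0\<close> by (auto simp: space_PiM PiE_def extensional_def)
      then have "(\<lambda>i\<in>I. 0 + sqrt s * y i) \<in> A \<longleftrightarrow> y \<in> A"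
        using cone[of y "sqrt s"] cone[of "\<lambda>i\<in>I. 0 + sqrt s * y i" "1 / sqrt s"] \<open>s > 0\<close> by auto
      with 1 y show ?thesis by (auto simp: indicator_def)
    qed
    have "(\<integral>\<^sup>+y. indicator {?q y..} s * indicator A y \<partial>lebn I) = ennreal (\<bar>sqrt s\<bar> ^ card I) *
        (\<integral>\<^sup>+y. indicator {?q (\<lambda>i\<in>I. 0 + sqrt s * y i)..} s * indicator A (\<lambda>i\<in>I. 0 + sqrt s * y i) \<partial>lebn I)"
      using nn_integral_lebn_affine[OF I _ m[of s], where c="sqrt s" and t="\<lambda>_. 0"] \<open>s > 0\<close> by simp
    also have "(\<integral>\<^sup>+y. indicator {?q (\<lambda>i\<in>I. 0 + sqrt s * y i)..} s * indicator A (\<lambda>i\<in>I. 0 + sqrt s * y i) \<partial>lebn I)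
       = (\<integral>\<^sup>+y. indicator (A \<inter> ?B) y \<partial>lebn I)"
      by (rule nn_integral_cong) (rule eq)
    also have "\<dots> = emeasure (lebn I) (A \<inter> ?B)"
      by (rule nn_integral_indicator) measurable
    finally show ?thesis using \<open>s > 0\<close> by simp
  qed
  have "(\<integral>\<^sup>+y. ennreal (exp (- ?q y / 2)) * indicator A y \<partial>lebn I)
      = (\<integral>\<^sup>+y. (\<integral>\<^sup>+s. ?w s * indicator {?q y..} s * indicator A y \<partial>lborel) \<partial>lebn I)"
    by (intro nn_integral_cong, subst nn_integral_multc) (measurable, simp only: nn_integral_exp_half_atLeast)
  also have "\<dots> = (\<integral>\<^sup>+s. (\<integral>\<^sup>+y. ?w s * indicator {?q y..} s * indicator A y \<partial>lebn I) \<partial>lborel)"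
    by (rule Fubini'[OF meas, symmetric])
  also have "\<dots> = (\<integral>\<^sup>+s. ennreal (exp (- s / 2) / 2 * sqrt s ^ card I) * indicator {0..} s
        * emeasure (lebn I) (A \<inter> ?B) \<partial>lborel)"
  proof (rule nn_integral_cong_AE)
    \<comment> \<open>\<open>s = 0\<close> admits no rescaling but is a null set; for
      \<open>s < 0\<close> no \<open>y\<close> contributes.\<close>
    have "AE s::real in lborel. s \<noteq> 0" by (rule AE_lborel_singleton)
    then show "AE s in lborel. (\<integral>\<^sup>+y. ?w s * indicator {?q y..} s * indicator A y \<partial>lebn I)
       = ennreal (exp (- s / 2) / 2 * sqrt s ^ card I) * indicator {0..} s * emeasure (lebn I) (A \<inter> ?B)"
    proof eventually_elim
      case (elim s)
      show ?case
      proof (cases "s > 0")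
        case True
        have "ennreal (exp (- s / 2) / 2 * sqrt s ^ card I) = ?w s * ennreal (sqrt s ^ card I)"
          using True by (intro ennreal_mult) auto
        with True show ?thesis
          using inner[OF True] nn_integral_cmult[OF m[of s], of "?w s"]
          by (simp add: mult.assoc)
      next
        case False
        with elim have "s < 0" by simp
        then have "indicator {?q y..} s = (0::ennreal)" for y
          using q0[of y] by (auto simp: indicator_def)
        then show ?thesis using \<open>s < 0\<close> by simp
      qed
    qed
  qed
  also have "\<dots> = (\<integral>\<^sup>+s. ennreal (exp (- s / 2) / 2 * sqrt s ^ card I) * indicator {0..} s \<partial>lborel)
     * emeasure (lebn I) (A \<inter> ?B)"
    by (rule nn_integral_multc) measurable
  finally show ?thesis by (simp add: mult.commute)
qed

lemma nn_integral_exp_gaussian: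
  assumes "s > 0"
  shows "(\<integral>\<^sup>+x. ennreal (exp (- x\<^sup>2 / (2 * s\<^sup>2))) \<partial>lborel) = ennreal (sqrt (2 * pi) * s)"
proof -
  have "exp (- x\<^sup>2 / (2 * s\<^sup>2)) = sqrt (2 * pi) * s * normal_density 0 s x" for x
    using assms by (simp add: normal_density_def real_sqrt_mult)
  then have "(\<integral>\<^sup>+x. ennreal (exp (- x\<^sup>2 / (2 * s\<^sup>2))) \<partial>lborel)
      = (\<integral>\<^sup>+x. ennreal (sqrt (2 * pi) * s) * ennreal (normal_density 0 s x) \<partial>lborel)"
    using assms by (simp add: ennreal_mult)
  also have "\<dots> = ennreal (sqrt (2 * pi) * s) * (\<integral>\<^sup>+x. ennreal (normal_density 0 s x) \<partial>lborel)"
    by (rule nn_integral_cmult) measurable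
  also have "(\<integral>\<^sup>+x. ennreal (normal_density 0 s x) \<partial>lborel) = 1"
    using assms by (simp add: nn_integral_eq_integral integrable_normal_density integral_normal_density)
  finally show ?thesis by simp
qed

lemma nn_integral_lebn_gaussian:
  assumes "finite I"
  shows "(\<integral>\<^sup>+y. ennreal (exp (- (\<Sum>i\<in>I. (y i)\<^sup>2) / 2)) \<partial>lebn I) = ennreal (sqrt (2 * pi) ^ card I)"
proof -
  have "(\<integral>\<^sup>+y. ennreal (exp (- (\<Sum>i\<in>I. (y i)\<^sup>2) / 2)) \<partial>lebn I)
     = (\<integral>\<^sup>+y. (\<Prod>i\<in>I. ennreal (exp (- (y i)\<^sup>2 / 2))) \<partial>lebn I)"
    using assms by (intro nn_integral_cong) (simp add: prod_ennreal exp_sum[symmetric] sum_negf sum_divide_distrib)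
  also have "\<dots> = (\<Prod>i\<in>I. (\<integral>\<^sup>+x. ennreal (exp (- x\<^sup>2 / 2)) \<partial>lborel))"
    using assms by (intro lborel_product.product_nn_integral_prod) auto
  also have "\<dots> = ennreal (sqrt (2 * pi) ^ card I)"
    using nn_integral_exp_gaussian[of 1] by (simp add: ennreal_power)
  finally show ?thesis .
qed

text \<open>\<open>Q\<close> describes the cone and \<open>\<kappa> * H\<close> the Gaussian weight
  on \<open>V\<close>, both read off the coordinates in \<open>I\<close>. The map from an
  orthonormal basis of \<open>V\<close> to these coordinates has some constant Jacobian; taking
  \<open>H\<close> itself as the reference function in the proportionality of invariant integrals
  makes it drop out of the quotient.\<close>

lemma ball_frac_coordinates:
  fixes H :: "(nat \<Rightarrow> real) \<Rightarrow> real"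
  assumes ex: "\<exists>d b. onb n V d b" and I[simp]: "finite I"
    and onto: "\<And>z. \<exists>v\<in>V. \<forall>i\<in>I. v i = z i"
    and C: "\<And>v. v \<in> V \<Longrightarrow> v \<in> C \<longleftrightarrow> Q (restrict v I)"
    and cone: "\<And>c z. c > 0 \<Longrightarrow> Q z \<Longrightarrow> Q (\<lambda>i\<in>I. c * z i)"
    and Q[measurable]: "Measurable.pred (lebn I) Q"
    and H[measurable]: "H \<in> borel_measurable (lebn I)" and \<kappa>: "\<kappa> > 0"
    and norm: "\<And>v. v \<in> V \<Longrightarrow> exp (- (\<Sum>i<n. (v i)\<^sup>2) / 2) = \<kappa> * H (restrict v I)"
  shows "ennreal (ball_frac n C V) * (\<integral>\<^sup>+z. ennreal (H z) \<partial>lebn I)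
       = (\<integral>\<^sup>+z. ennreal (H z) * indicator {z. Q z} z \<partial>lebn I)"
proof -
  \<comment> \<open>Whatever pair \<open>SOME\<close> selects, the argument uses only that it is an
    orthonormal basis of \<open>V\<close>.\<close>
  obtain d b where db: "(d, b) = (SOME (d, b). onb n V d b)" by (metis surj_pair)
  have onb: "onb n V d b"
  proof -
    have "case (SOME (d, b). onb n V d b) of (d, b) \<Rightarrow> onb n V d b"
      using ex by (intro someI_ex[of "\<lambda>p. case p of (d, b) \<Rightarrow> onb n V d b"]) auto
    then show ?thesis by (simp add: db[symmetric])
  qed
  let ?M = "lebn {..<d}"
  define S where "S y = (\<lambda>i. \<Sum>j<d. y j * b j i)" for y :: "nat \<Rightarrow> real"
  define L where "L y = restrict (S y) I" for y
  have SV: "S y \<in> V" for y using onb by (auto simp: onb_def S_def)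
  have surjS: "\<exists>y. v = S y" if "v \<in> V" for v using onb that by (auto simp: onb_def S_def)
  have nS: "(\<Sum>i<n. (S y i)\<^sup>2) = (\<Sum>j<d. (y j)\<^sup>2)" for y
  proof -
    have "(\<Sum>i<n. (S y i)\<^sup>2) = (\<Sum>i<n. \<Sum>j<d. \<Sum>j'<d. y j * y j' * (b j i * b j' i))"
      by (simp add: S_def power2_eq_square sum_product mult_ac)
    also have "\<dots> = (\<Sum>j<d. \<Sum>j'<d. y j * y j' * ipn n (b j) (b j'))"
      unfolding ipn_def sum_distrib_left
      by (subst sum.swap, rule sum.cong[OF refl], subst sum.swap) simp
    also have "\<dots> = (\<Sum>j<d. \<Sum>j'<d. if j = j' then y j * y j' else 0)"
      using onb by (intro sum.cong refl) (auto simp: onb_def)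
    also have "\<dots> = (\<Sum>j<d. (y j)\<^sup>2)"
      by (simp add: power2_eq_square)
    finally show ?thesis .
  qed
  define E where "E y = exp (- (\<Sum>j<d. (y j)\<^sup>2) / 2)" for y :: "nat \<Rightarrow> real"
  have EH: "E y = \<kappa> * H (L y)" for y
    using norm[OF SV[of y]] by (simp add: nS L_def E_def)
  \<comment> \<open>Evenness of the Gaussian weight undoes the sign in the proportionality lemma,
    whose second integrand is evaluated at \<open>- L x\<close>.\<close>
  have H': "H (\<lambda>i\<in>I. - L y i) = H (L y)" for y
  proof -
    have "(\<lambda>i\<in>I. - L y i) = L (\<lambda>j. - y j)"
      by (auto simp: L_def S_def sum_negf)
    then show ?thesis using EH[of y] EH[of "\<lambda>j. - y j"] \<kappa> by (simp add: E_def)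
  qed
  have Hpos: "H (L y) > 0" for y
    using EH[of y] \<kappa> by (metis E_def exp_gt_zero zero_less_mult_pos)
  have Lm[measurable]: "L \<in> measurable ?M (lebn I)"
    unfolding L_def S_def by (rule measurable_restrict) measurable
  have [measurable]: "E \<in> borel_measurable ?M" unfolding E_def by measurable
  let ?G = "\<lambda>z. ennreal (H z) * indicator {z. Q z} z"
  have Gm: "?G \<in> borel_measurable (lebn I)" unfolding indicator_def by measurable
  have haar: "(\<integral>\<^sup>+x. ?G (L x) \<partial>?M) * (\<integral>\<^sup>+z. ennreal (H z) \<partial>lebn I)
      = (\<integral>\<^sup>+x. ennreal (H (\<lambda>i\<in>I. - L x i)) \<partial>?M) * (\<integral>\<^sup>+z. ?G z \<partial>lebn I)"
  proof (rule nn_integral_linear_onto_ratio[OF _ _ Lm _ Gm])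
    fix z assume "z \<in> space (lebn I)"
    obtain v where v: "v \<in> V" "\<forall>i\<in>I. v i = z i" using onto by blast
    obtain a where "v = S a" using surjS v(1) by blast
    then show "\<exists>a. \<forall>x\<in>space ?M. L (\<lambda>j\<in>{..<d}. a j + x j) = (\<lambda>i\<in>I. z i + L x i)"
      using v(2) by (intro exI[of _ a] ballI) (auto simp: L_def S_def sum.distrib algebra_simps)
  qed auto
  define A where "A = {y \<in> space ?M. Q (L y)}"
  have Am[measurable]: "A \<in> sets ?M" unfolding A_def by measurable
  have Acone: "(\<lambda>i\<in>{..<d}. c * y i) \<in> A" if "y \<in> A" "c > 0" for y c
  proof -
    have "L (\<lambda>i\<in>{..<d}. c * y i) = (\<lambda>i\<in>I. c * L y i)"
      by (auto simp: L_def S_def sum_distrib_left mult.assoc)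
    then show ?thesis using that cone[of c "L y"] by (auto simp: A_def space_PiM)
  qed
  let ?B = "{y \<in> space ?M. (\<Sum>j<d. (y j)\<^sup>2) \<le> 1}"
  let ?K = "\<integral>\<^sup>+s. ennreal (exp (- s / 2) / 2 * sqrt s ^ d) * indicator {0..} s \<partial>lborel"
  have gA: "(\<integral>\<^sup>+y. ennreal (E y) * indicator A y \<partial>?M) = emeasure ?M (A \<inter> ?B) * ?K"
    using nn_integral_gaussian_cone[OF _ Am Acone] by (simp add: E_def)
  \<comment> \<open>Taking the whole space as the cone expresses the radial constant
    \<open>?K\<close> through the total Gaussian mass, so that \<open>?K\<close> is never
    evaluated.\<close>
  have "(\<integral>\<^sup>+y. ennreal (E y) * indicator (space ?M) y \<partial>?M) = emeasure ?M (space ?M \<inter> ?B) * ?K"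
    unfolding E_def
    by (subst nn_integral_gaussian_cone) (auto simp: space_PiM)
  also have "space ?M \<inter> ?B = ?B" by auto
  also have "(\<integral>\<^sup>+y. ennreal (E y) * indicator (space ?M) y \<partial>?M) = ennreal (sqrt (2 * pi) ^ d)"
    using nn_integral_lebn_gaussian[of "{..<d}"]
    by (simp add: E_def cong: nn_integral_cong)
  finally have BK: "emeasure ?M ?B * ?K = ennreal (sqrt (2 * pi) ^ d)" ..
  have EL: "(\<integral>\<^sup>+y. ennreal (E y) \<partial>?M) = ennreal (sqrt (2 * pi) ^ d)"
    using nn_integral_lebn_gaussian[of "{..<d}"] by (simp add: E_def)
  \<comment> \<open>The explicit volume of the unit ball shows that the denominator of
    \<open>ball_frac\<close> is finite and nonzero.\<close>
  have B: "emeasure ?M ?B = ennreal (unit_ball_vol (real d))"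
  proof -
    have "{f. sqrt (\<Sum>i<d. (f i)\<^sup>2) \<le> 1} \<inter> space ?M = ?B" by auto
    then show ?thesis using emeasure_cball_aux[of "{..<d}" 1] by simp
  qed
  have AB: "emeasure ?M (A \<inter> ?B) \<le> emeasure ?M ?B" by (rule emeasure_mono) auto
  then have ABfin: "emeasure ?M (A \<inter> ?B) \<noteq> \<infinity>" unfolding B by (auto simp: top_unique)
  have bf: "ball_frac n C V = measure ?M (A \<inter> ?B) / measure ?M ?B"
  proof -
    have "{y \<in> PiE {..<d} (\<lambda>_. UNIV). (\<lambda>i. \<Sum>j<d. y j * b j i) \<in> C \<and> (\<Sum>j<d. (y j)\<^sup>2) \<le> 1} = A \<inter> ?B"
      using C[OF SV] by (auto simp: A_def L_def S_def space_PiM)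
    moreover have "{y \<in> PiE {..<d} (\<lambda>_. UNIV :: real set). (\<Sum>j<d. (y j)\<^sup>2) \<le> 1} = ?B"
      by (auto simp: space_PiM)
    ultimately show ?thesis by (simp add: ball_frac_def db[symmetric])
  qed
  have v0: "unit_ball_vol (real d) > 0" "unit_ball_vol (real d) \<noteq> 0"
    using unit_ball_vol_pos[of "real d"] by linarith+
  have bfB: "ennreal (ball_frac n C V) * emeasure ?M ?B = emeasure ?M (A \<inter> ?B)"
  proof -
    have "measure ?M ?B = unit_ball_vol (real d)" using B by (simp add: measure_def)
    then have "ennreal (ball_frac n C V) * emeasure ?M ?B = ennreal (measure ?M (A \<inter> ?B))"
      unfolding bf B using v0 by (simp add: ennreal_mult[symmetric])
    then show ?thesis using ABfin by (simp add: emeasure_eq_ennreal_measure)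
  qed
  have e: "(\<integral>\<^sup>+y. ennreal (E y) \<partial>?M) = ennreal \<kappa> * (\<integral>\<^sup>+x. ennreal (H (\<lambda>i\<in>I. - L x i)) \<partial>?M)"
    unfolding H' EH using \<kappa> Hpos by (subst nn_integral_cmult[symmetric]) (auto simp: ennreal_mult less_imp_le)
  have eA: "(\<integral>\<^sup>+y. ennreal (E y) * indicator A y \<partial>?M) = ennreal \<kappa> * (\<integral>\<^sup>+x. ?G (L x) \<partial>?M)"
  proof -
    have "(\<lambda>x. ?G (L x)) \<in> borel_measurable ?M" using Gm by measurable
    then have "ennreal \<kappa> * (\<integral>\<^sup>+x. ?G (L x) \<partial>?M) = (\<integral>\<^sup>+x. ennreal \<kappa> * ?G (L x) \<partial>?M)"
      by (simp add: nn_integral_cmult)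
    also have "\<dots> = (\<integral>\<^sup>+y. ennreal (E y) * indicator A y \<partial>?M)"
      using \<kappa> by (intro nn_integral_cong)
        (auto simp: EH A_def indicator_def ennreal_mult less_imp_le[OF Hpos])
    finally show ?thesis ..
  qed
  \<comment> \<open>The identity is proved after multiplication by the total mass \<open>?e\<close>,
    which is finite and nonzero and therefore cancels in \<open>ennreal\<close>.\<close>
  let ?e = "ennreal (sqrt (2 * pi) ^ d)"
  have "?e * (ennreal (ball_frac n C V) * (\<integral>\<^sup>+z. ennreal (H z) \<partial>lebn I))
     = ennreal (ball_frac n C V) * emeasure ?M ?B * ?K * (\<integral>\<^sup>+z. ennreal (H z) \<partial>lebn I)"
    unfolding BK[symmetric] by (simp only: mult_ac)
  also have "\<dots> = (\<integral>\<^sup>+y. ennreal (E y) * indicator A y \<partial>?M) * (\<integral>\<^sup>+z. ennreal (H z) \<partial>lebn I)"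
    unfolding bfB gA ..
  also have "\<dots> = ennreal \<kappa> * ((\<integral>\<^sup>+x. ?G (L x) \<partial>?M) * (\<integral>\<^sup>+z. ennreal (H z) \<partial>lebn I))"
    unfolding eA by (simp only: mult.assoc)
  also have "\<dots> = ?e * (\<integral>\<^sup>+z. ?G z \<partial>lebn I)"
    unfolding haar EL[symmetric] e by (simp only: mult.assoc)
  finally show ?thesis
    by (subst (asm) ennreal_mult_cancel_left) (auto simp: not_le)
qed

section \<open>Faces, tangent cones and normal cones\<close>

text \<open>The hulls are defined through finite sets of vectors. Merging the coefficients of equal
  vectors allows indexed families with repetitions.\<close>

lemma sum_group_image:
  fixes c :: "'i \<Rightarrow> real" and s :: "'i \<Rightarrow> nat \<Rightarrow> real"
  assumes "finite I"
  shows "(\<Sum>i\<in>I. c i * s i j) = (\<Sum>t\<in>s ` I. sum c {i. i \<in> I \<and> s i = t} * t j)"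
proof -
  have "(\<Sum>i\<in>I. c i * s i j) = (\<Sum>t\<in>s ` I. \<Sum>i\<in>{i. i \<in> I \<and> s i = t}. c i * s i j)"
    by (rule sum.image_gen[OF assms])
  also have "\<dots> = (\<Sum>t\<in>s ` I. sum c {i. i \<in> I \<and> s i = t} * t j)"
    unfolding sum_distrib_right by (intro sum.cong refl) simp
  finally show ?thesis .
qed

lemma conv_hull_indexed:
  assumes "finite I" "I \<noteq> {}" "\<And>i. i \<in> I \<Longrightarrow> s i \<in> S" "\<And>i. i \<in> I \<Longrightarrow> c i \<ge> 0" "sum c I = 1"
  shows "(\<lambda>j. \<Sum>i\<in>I. c i * s i j) \<in> conv_hull S"
proof -
  let ?c = "\<lambda>t. sum c {i. i \<in> I \<and> s i = t}"
  have "sum ?c (s ` I) = 1"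
    using sum.image_gen[OF assms(1), of c s] assms(5) by simp
  moreover have "(\<lambda>j. \<Sum>i\<in>I. c i * s i j) = (\<lambda>j. \<Sum>t\<in>s ` I. ?c t * t j)"
    by (rule ext) (rule sum_group_image[OF assms(1)])
  moreover have "\<forall>t\<in>s ` I. ?c t \<ge> 0" using assms(4) by (auto intro: sum_nonneg)
  ultimately show ?thesis using assms(1-3) unfolding conv_hull_def
    by (intro CollectI exI[of _ "s ` I"] exI[of _ ?c]) auto
qed

lemma lin_span_indexed:
  assumes "finite I" "\<And>i. i \<in> I \<Longrightarrow> s i \<in> S"
  shows "(\<lambda>j. \<Sum>i\<in>I. c i * s i j) \<in> lin_span S"
proof -
  let ?c = "\<lambda>t. sum c {i. i \<in> I \<and> s i = t}"
  have "(\<lambda>j. \<Sum>i\<in>I. c i * s i j) = (\<lambda>j. \<Sum>t\<in>s ` I. ?c t * t j)"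
    by (rule ext) (rule sum_group_image[OF assms(1)])
  then show ?thesis using assms unfolding lin_span_def
    by (intro CollectI exI[of _ "s ` I"] exI[of _ ?c]) auto
qed

text \<open>The barycentric coordinates of a point with respect to the vertices e_i / w_i are the
  products w_i x_i.\<close>

lemma wface_iff:
  assumes w: "\<And>i. i < m \<Longrightarrow> wt f n i > 0" and "m > 0"
  shows "x \<in> wface f n m \<longleftrightarrow>
    (\<forall>i\<ge>m. x i = 0) \<and> (\<forall>i<m. x i \<ge> 0) \<and> (\<Sum>i<m. wt f n i * x i) = 1"
proof
  assume "x \<in> wface f n m"
  then obtain T c where T: "finite T" "T \<subseteq> {(\<lambda>j. if j = i then 1 / wt f n i else 0) | i. i < m}"
    "\<forall>s\<in>T. c s \<ge> 0" "sum c T = 1" and x: "x = (\<lambda>i. \<Sum>s\<in>T. c s * s i)"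
    unfolding wface_def conv_hull_def by blast
  have s: "s i \<ge> 0" "(\<Sum>i<m. wt f n i * s i) = 1" "i \<ge> m \<Longrightarrow> s i = 0" if "s \<in> T" for s i
  proof -
    from that T(2) obtain i0 where i0: "s = (\<lambda>j. if j = i0 then 1 / wt f n i0 else 0)" "i0 < m" by blast
    show "s i \<ge> 0" "i \<ge> m \<Longrightarrow> s i = 0" using i0 w[OF i0(2)] by auto
    have "(\<Sum>i<m. wt f n i * s i) = (\<Sum>i<m. if i = i0 then 1 else 0)"
      using i0 w[OF i0(2)] by (intro sum.cong) auto
    then show "(\<Sum>i<m. wt f n i * s i) = 1" using i0(2) by simp
  qed
  have "(\<Sum>i<m. wt f n i * x i) = (\<Sum>s\<in>T. c s * (\<Sum>i<m. wt f n i * s i))"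
    unfolding x sum_distrib_left by (subst sum.swap) (simp add: mult_ac)
  also have "\<dots> = 1" using s(2) T(4) by simp
  finally show "(\<forall>i\<ge>m. x i = 0) \<and> (\<forall>i<m. x i \<ge> 0) \<and> (\<Sum>i<m. wt f n i * x i) = 1"
    using s(1,3) T(3) by (auto simp: x intro!: sum_nonneg sum.neutral)
next
  assume x: "(\<forall>i\<ge>m. x i = 0) \<and> (\<forall>i<m. x i \<ge> 0) \<and> (\<Sum>i<m. wt f n i * x i) = 1"
  have "x = (\<lambda>j. \<Sum>i<m. (wt f n i * x i) * (if j = i then 1 / wt f n i else 0))"
  proof
    fix j
    have "(\<Sum>i<m. (wt f n i * x i) * (if j = i then 1 / wt f n i else 0)) = (\<Sum>i<m. if j = i then x i else 0)"
      by (intro sum.cong refl) (use w in \<open>auto simp: less_imp_neq[THEN not_sym]\<close>)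
    also have "\<dots> = x j" using x by auto
    finally show "x j = (\<Sum>i<m. (wt f n i * x i) * (if j = i then 1 / wt f n i else 0))" ..
  qed
  moreover have "\<dots> \<in> wface f n m"
    unfolding wface_def using x w \<open>m > 0\<close>
    by (intro conv_hull_indexed[where s="\<lambda>i j. if j = i then 1 / wt f n i else 0"])
      (auto simp: less_imp_le)
  ultimately show "x \<in> wface f n m" by simp
qed

lemma wface_vertex:
  assumes "\<And>i. i < m \<Longrightarrow> wt f n i > 0" "i < m"
  shows "(\<lambda>j. if j = i then 1 / wt f n i else 0) \<in> wface f n m"
proof -
  let ?e = "\<lambda>i j. if j = i then 1 / wt f n i else 0"
  have "(\<lambda>j. \<Sum>i\<in>{i}. 1 * ?e i j) \<in> wface f n m"
    unfolding wface_def using assms(2) by (intro conv_hull_indexed[where s="?e"]) auto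
  then show ?thesis by simp
qed

section \<open>Relative interiors of the coordinate faces\<close>

lemma abs_component_le_normn:
  assumes "i < n"
  shows "\<bar>v i\<bar> \<le> normn n v"
proof -
  have "(v i)\<^sup>2 \<le> (\<Sum>i<n. v i * v i)"
    unfolding power2_eq_square using assms by (intro member_le_sum) auto
  then show ?thesis unfolding normn_def ipn_def by (intro real_le_rsqrt) simp
qed

lemma aff_hull_wface:
  assumes w: "\<And>i. i < m \<Longrightarrow> wt f n i > 0" and "m > 0" and y: "y \<in> aff_hull (wface f n m)"
  shows "\<forall>i\<ge>m. y i = 0" "(\<Sum>i<m. wt f n i * y i) = 1"
proof -
  from y obtain T c where T: "finite T" "T \<subseteq> wface f n m" "sum c T = 1"
    and y: "y = (\<lambda>i. \<Sum>s\<in>T. c s * s i)"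
    unfolding aff_hull_def by blast
  have s: "(\<Sum>i<m. wt f n i * s i) = 1" "\<forall>i\<ge>m. s i = 0" if "s \<in> T" for s
    using T(2) that wface_iff[OF w \<open>m > 0\<close>, of s] by auto
  show "\<forall>i\<ge>m. y i = 0" using s(2) by (auto simp: y intro!: sum.neutral)
  have "(\<Sum>i<m. wt f n i * y i) = (\<Sum>s\<in>T. c s * (\<Sum>i<m. wt f n i * s i))"
    unfolding y sum_distrib_left by (subst sum.swap) (simp add: mult_ac)
  also have "\<dots> = 1" using s(1) T(3) by simp
  finally show "(\<Sum>i<m. wt f n i * y i) = 1" .
qed

lemma relint_wface_nonempty:
  assumes w: "\<And>i. i < m \<Longrightarrow> wt f n i > 0" and m: "m > 0" "m \<le> n"
  shows "\<exists>x. x \<in> relint n (wface f n m)"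
proof -
  \<comment> \<open>The barycentre: all barycentric coordinates w_i x_i equal 1 / m.\<close>
  define x where "x i = (if i < m then 1 / (real m * wt f n i) else 0)" for i
  have xpos: "x i > 0" if "i < m" for i using that w m by (simp add: x_def)
  have "(\<Sum>i<m. wt f n i * x i) = (\<Sum>i<m. 1 / real m)"
    by (intro sum.cong refl) (use w in \<open>auto simp: x_def less_imp_neq[THEN not_sym]\<close>)
  then have sx: "(\<Sum>i<m. wt f n i * x i) = 1" using m by simp
  have xF: "x \<in> wface f n m"
    using wface_iff[OF w m(1), of x] sx xpos by (auto simp: x_def less_imp_le)
  \<comment> \<open>Inside the affine hull only the signs of the coordinates can fail, and none
    changes within a distance below the smallest coordinate of \<open>x\<close>.\<close>
  define e where "e = Min (x ` {..<m})"
  have e: "e > 0" unfolding e_def using m xpos by (subst Min_gr_iff) auto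
  have "y \<in> wface f n m" if y: "y \<in> aff_hull (wface f n m)" "normn n (\<lambda>i. y i - x i) < e" for y
  proof -
    have "y i \<ge> 0" if "i < m" for i
    proof -
      have "\<bar>y i - x i\<bar> \<le> normn n (\<lambda>i. y i - x i)"
        using abs_component_le_normn[of i n "\<lambda>i. y i - x i"] that m by simp
      also have "\<dots> < e" by (rule y)
      also have "e \<le> x i" unfolding e_def using that by (intro Min_le) auto
      finally show ?thesis by linarith
    qed
    then show ?thesis using wface_iff[OF w m(1), of y] aff_hull_wface[OF w m(1) y(1)] by auto
  qed
  then show ?thesis using xF e unfolding relint_def by blast
qed

text \<open>If coordinate i vanished, moving from \<open>x\<close> away from the vertex on axis i
  would stay in the affine hull and make that coordinate negative at arbitrarily small
  distance.\<close>

lemma relint_wface_pos: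
  assumes w: "\<And>i. i < m \<Longrightarrow> wt f n i > 0" and m: "m > 0" "m \<le> n"
    and x: "x \<in> relint n (wface f n m)" and i: "i < m"
  shows "x i > 0"
proof (rule ccontr)
  assume "\<not> x i > 0"
  from x obtain e where xF: "x \<in> wface f n m" and e: "e > 0"
    and yF: "\<And>y. y \<in> aff_hull (wface f n m) \<Longrightarrow> normn n (\<lambda>i. y i - x i) < e \<Longrightarrow> y \<in> wface f n m"
    unfolding relint_def by blast
  have "x i = 0" using xF wface_iff[OF w m(1), of x] i \<open>\<not> x i > 0\<close> by force
  define z where "z = (\<lambda>j. if j = i then 1 / wt f n i else 0)"
  have zF: "z \<in> wface f n m" unfolding z_def by (rule wface_vertex[OF w i])
  have "x \<noteq> z" using \<open>x i = 0\<close> w[OF i] by (auto simp: z_def fun_eq_iff)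
  define N where "N = normn n (\<lambda>i. x i - z i)"
  have "N \<ge> 0" by (simp add: N_def normn_def ipn_def sum_nonneg)
  \<comment> \<open>The summand 1 keeps the denominator positive and yields \<open>t * N < e\<close>
    from \<open>N \<ge> 0\<close> alone.\<close>
  define t where "t = e / (2 * (N + 1))"
  have t: "t > 0" using \<open>N \<ge> 0\<close> e by (simp add: t_def)
  have "t * (2 * (N + 1)) = e" using \<open>N \<ge> 0\<close> by (simp add: t_def)
  then have "2 * (t * N) + 2 * t = e" by (simp add: algebra_simps)
  moreover have "0 \<le> t * N" using t \<open>N \<ge> 0\<close> by simp
  ultimately have tN: "t * N < e" using t by linarith
  define y where "y i = (1 + t) * x i + (- t) * z i" for i
  have "y = (\<lambda>j. \<Sum>s\<in>{x, z}. (if s = x then 1 + t else - t) * s j)"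
    using \<open>x \<noteq> z\<close> by (auto simp: y_def)
  moreover have "sum (\<lambda>s. if s = x then 1 + t else - t) {x, z} = 1"
    using \<open>x \<noteq> z\<close> by auto
  ultimately have "y \<in> aff_hull (wface f n m)"
    unfolding aff_hull_def using xF zF
    by (intro CollectI exI[of _ "{x, z}"] exI[of _ "\<lambda>s. if s = x then 1 + t else - t"] conjI) simp_all
  moreover have "normn n (\<lambda>i. y i - x i) = t * N"
  proof -
    have "ipn n (\<lambda>i. y i - x i) (\<lambda>i. y i - x i) = t\<^sup>2 * ipn n (\<lambda>i. x i - z i) (\<lambda>i. x i - z i)"
      unfolding ipn_def sum_distrib_left by (intro sum.cong) (auto simp: y_def algebra_simps power2_eq_square)
    then show ?thesis using t by (simp add: normn_def N_def real_sqrt_mult)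
  qed
  ultimately have "y \<in> wface f n m" using yF tN by simp
  then have "y i \<ge> 0" using wface_iff[OF w m(1), of y] i by auto
  moreover have "y i < 0" using \<open>x i = 0\<close> t w[OF i] by (simp add: y_def z_def)
  ultimately show False by simp
qed

section \<open>Explicit orthonormal bases of the two spans\<close>

lemma onb_extend:
  assumes b: "onb n V d b" and c: "c \<in> Rn n" "ipn n c c = 1" "\<And>v. v \<in> V \<Longrightarrow> ipn n v c = 0"
  shows "onb n {(\<lambda>i. v i + t * c i) | v t. v \<in> V} (Suc d) (b(d := c))"
proof -
  have V: "V = {(\<lambda>i. \<Sum>j<d. y j * b j i) | y. True}" using b by (simp add: onb_def)
  have "b j \<in> V" if "j < d" for j
  proof -
    have "b j = (\<lambda>i. \<Sum>j'<d. (if j' = j then 1 else 0) * b j' i)"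
      using that by (auto simp: if_distrib[of "\<lambda>x. x * _"] cong: if_cong)
    then show ?thesis unfolding V by (intro CollectI exI[of _ "\<lambda>j'. if j' = j then 1 else 0"]) simp
  qed
  then have bc: "ipn n (b j) c = 0" "ipn n c (b j) = 0" if "j < d" for j
    using that c(3)[of "b j"] by (simp_all add: ipn_def mult.commute)
  have "{(\<lambda>i. v i + t * c i) | v t. v \<in> V} = {(\<lambda>i. \<Sum>j<Suc d. y j * (b(d := c)) j i) | y. True}"
  proof (intro equalityI subsetI)
    fix u assume "u \<in> {(\<lambda>i. v i + t * c i) | v t. v \<in> V}"
    then obtain y t where "u = (\<lambda>i. (\<Sum>j<d. y j * b j i) + t * c i)" unfolding V by blast
    then have "u = (\<lambda>i. \<Sum>j<Suc d. (y(d := t)) j * (b(d := c)) j i)"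
      by (auto simp: fun_eq_iff intro!: sum.cong)
    then show "u \<in> {(\<lambda>i. \<Sum>j<Suc d. y j * (b(d := c)) j i) | y. True}" by blast
  next
    fix u assume "u \<in> {(\<lambda>i. \<Sum>j<Suc d. y j * (b(d := c)) j i) | y. True}"
    then obtain y where "u = (\<lambda>i. \<Sum>j<Suc d. y j * (b(d := c)) j i)" by blast
    then have "u = (\<lambda>i. (\<Sum>j<d. y j * b j i) + y d * c i)"
      by (auto simp: fun_eq_iff)
    moreover have "(\<lambda>i. \<Sum>j<d. y j * b j i) \<in> V" unfolding V by blast
    ultimately show "u \<in> {(\<lambda>i. v i + t * c i) | v t. v \<in> V}"
      by (intro CollectI exI[of _ "\<lambda>i. \<Sum>j<d. y j * b j i"] exI[of _ "y d"]) simp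
  qed
  then show ?thesis using b c(1,2) bc unfolding onb_def by (auto simp: less_Suc_eq)
qed

lemma onb_zero: "onb n {\<lambda>_. 0} 0 b"
  by (auto simp: onb_def)

text \<open>Induction on the dimension: with one more coordinate the hyperplane orthogonal to
  \<open>w\<close> is the old hyperplane plus one line. \<open>Suc l\<close> coordinates give
  dimension \<open>l\<close>.\<close>

lemma onb_hyperplane:
  assumes "\<And>i. i \<le> l \<Longrightarrow> w i > 0" "l < n"
  shows "\<exists>b. onb n {v \<in> Rn (Suc l). (\<Sum>i\<le>l. w i * v i) = 0} l b"
  using assms
proof (induction l)
  case 0
  have "v = (\<lambda>_. 0)" if "\<forall>i\<ge>Suc 0. v i = 0" "v 0 = (0::real)" for v
  proof
    show "v i = 0" for i using that by (cases i) auto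
  qed
  then have "{v \<in> Rn (Suc 0). (\<Sum>i\<le>0. w i * v i) = 0} = {\<lambda>_. 0}"
    using "0.prems"(1)[of 0] by (auto simp: Rn_def)
  then show ?case using onb_zero by auto
next
  case (Suc l)
  let ?V = "{v \<in> Rn (Suc l). (\<Sum>i\<le>l. w i * v i) = 0}"
  let ?V' = "{v \<in> Rn (Suc (Suc l)). (\<Sum>i\<le>Suc l. w i * v i) = 0}"
  from Suc obtain b where b: "onb n ?V l b" by auto
  define s where "s = (\<Sum>i\<le>l. (w i)\<^sup>2)"
  define N where "N = sqrt (s * (s + (w (Suc l))\<^sup>2))"
  have "s > 0" unfolding s_def by (intro sum_pos) (use Suc.prems(1) in \<open>auto simp: less_imp_neq[THEN not_sym]\<close>)
  have "w (Suc l) > 0" using Suc.prems(1) by simp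
  have N2: "N * N = s * (s + (w (Suc l))\<^sup>2)" and "N > 0"
    using \<open>s > 0\<close> by (auto simp: N_def intro!: mult_pos_pos add_pos_nonneg)
  \<comment> \<open>Proportional to \<open>w\<close> in the old coordinates, hence orthogonal to the
    old hyperplane; the last entry makes it orthogonal to the extended \<open>w\<close>, and
    \<open>N\<close> normalises it.\<close>
  define c where "c i = (if i \<le> l then w i * w (Suc l) / N else if i = Suc l then - s / N else 0)" for i
  have sumn: "(\<Sum>i<n. g i) = (\<Sum>i\<le>l. g i) + g (Suc l)" if "\<And>i. i > Suc l \<Longrightarrow> g i = 0" for g :: "nat \<Rightarrow> real"
  proof -
    have "(\<Sum>i<n. g i) = (\<Sum>i\<le>Suc l. g i)"
      using Suc.prems(2) that by (intro sum.mono_neutral_right) auto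
    then show ?thesis by simp
  qed
  have wc: "(\<Sum>i\<le>l. w i * c i) = s * w (Suc l) / N"
    by (auto simp: c_def s_def sum_distrib_right sum_divide_distrib power2_eq_square intro!: sum.cong)
  have "ipn n c c = (\<Sum>i\<le>l. c i * c i) + c (Suc l) * c (Suc l)"
    unfolding ipn_def by (rule sumn) (simp add: c_def)
  also have "(\<Sum>i\<le>l. c i * c i) = s * (w (Suc l))\<^sup>2 / (N * N)"
    unfolding s_def sum_distrib_right sum_divide_distrib
    by (intro sum.cong refl) (simp add: c_def power2_eq_square mult_ac)
  also have "s * (w (Suc l))\<^sup>2 / (N * N) + c (Suc l) * c (Suc l) = (s * (s + (w (Suc l))\<^sup>2)) / (N * N)"
    by (simp add: c_def add_divide_distrib algebra_simps)
  also have "\<dots> = 1" unfolding N2[symmetric] using \<open>N > 0\<close> by simp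
  finally have c1: "ipn n c c = 1" .
  have c0: "ipn n v c = 0" if "v \<in> ?V" for v
  proof -
    have "ipn n v c = (\<Sum>i\<le>l. v i * c i) + v (Suc l) * c (Suc l)"
      unfolding ipn_def by (rule sumn) (simp add: c_def)
    also have "(\<Sum>i\<le>l. v i * c i) = (\<Sum>i\<le>l. w i * v i) * (w (Suc l) / N)"
      unfolding sum_distrib_right by (auto simp: c_def intro!: sum.cong)
    finally show ?thesis using that by (simp add: Rn_def)
  qed
  have "c \<in> Rn n" using Suc.prems(2) by (auto simp: Rn_def c_def)
  from onb_extend[OF b this c1 c0]
  have "onb n {(\<lambda>i. v i + t * c i) | v t. v \<in> ?V} (Suc l) (b(l := c))" by simp
  also have "{(\<lambda>i. v i + t * c i) | v t. v \<in> ?V} = ?V'"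
  proof (intro equalityI subsetI)
    fix u assume "u \<in> {(\<lambda>i. v i + t * c i) | v t. v \<in> ?V}"
    then obtain v t where u: "u = (\<lambda>i. v i + t * c i)" and v: "v \<in> ?V" by blast
    have "(\<Sum>i\<le>l. w i * u i) = t * (\<Sum>i\<le>l. w i * c i)"
      using v by (simp add: u algebra_simps sum.distrib sum_distrib_left)
    moreover have "u (Suc l) = - t * s / N" using v by (simp add: u Rn_def c_def)
    ultimately have "(\<Sum>i\<le>Suc l. w i * u i) = 0" by (simp add: wc)
    moreover have "u \<in> Rn (Suc (Suc l))" using v by (auto simp: u Rn_def c_def)
    ultimately show "u \<in> ?V'" by simp
  next
    fix u assume u: "u \<in> ?V'"
    \<comment> \<open>The coefficient for which \<open>u - t * c\<close> has last coordinate
      zero.\<close>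
    define t where "t = - u (Suc l) * N / s"
    define v where "v i = u i - t * c i" for i
    have "v (Suc l) = 0" using \<open>s > 0\<close> \<open>N > 0\<close> by (simp add: v_def t_def c_def)
    then have "v \<in> Rn (Suc l)" using u
      by (auto simp: Rn_def v_def c_def)
    moreover have "(\<Sum>i\<le>l. w i * v i) = (\<Sum>i\<le>l. w i * u i) - t * (\<Sum>i\<le>l. w i * c i)"
      by (simp add: v_def algebra_simps sum_subtractf sum_distrib_left)
    then have "(\<Sum>i\<le>l. w i * v i) = 0" using u \<open>s > 0\<close> \<open>N > 0\<close> by (simp add: wc t_def) (simp add: mult.commute)
    moreover have "u = (\<lambda>i. v i + t * c i)" by (simp add: v_def)
    ultimately show "u \<in> {(\<lambda>i. v i + t * c i) | v t. v \<in> ?V}" by blast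
  qed
  finally show ?case by blast
qed

text \<open>This space, which for \<open>m = n\<close> is the span of the normal cone, is one line,
  spanned by the normalised restriction of \<open>w\<close> to the first \<open>l\<close>
  coordinates, plus the coordinate axes from \<open>l\<close> on. The induction adds these axes one
  at a time.\<close>

lemma onb_ray_extension:
  assumes w: "\<And>i. i < l \<Longrightarrow> w i > 0" and l: "l > 0" and m: "l \<le> m" "m \<le> n"
  shows "\<exists>d b. onb n {v \<in> Rn m. \<exists>t. \<forall>i<l. v i = t * w i} d b"
  using m
proof (induction m rule: dec_induct)
  case base
  define N where "N = sqrt (\<Sum>i<l. (w i)\<^sup>2)"
  have N2: "N * N = (\<Sum>i<l. (w i)\<^sup>2)" by (simp add: N_def sum_nonneg)
  have "(\<Sum>i<l. (w i)\<^sup>2) > 0"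
    by (intro sum_pos) (use w l in \<open>auto simp: less_imp_neq[THEN not_sym]\<close>)
  then have "N > 0" by (simp add: N_def)
  define c where "c i = (if i < l then w i / N else 0)" for i
  have "ipn n c c = (\<Sum>i<l. c i * c i)"
    unfolding ipn_def using base by (intro sum.mono_neutral_right) (auto simp: c_def)
  also have "\<dots> = (\<Sum>i<l. (w i)\<^sup>2) / (N * N)"
    unfolding sum_divide_distrib by (intro sum.cong) (auto simp: c_def power2_eq_square)
  finally have "ipn n c c = 1" using N2 \<open>(\<Sum>i<l. (w i)\<^sup>2) > 0\<close> by simp
  moreover have "c \<in> Rn n" using base by (auto simp: Rn_def c_def)
  ultimately have "onb n {(\<lambda>i. v i + t * c i) | v t. v \<in> {\<lambda>_. 0}} (Suc 0) ((\<lambda>_. undefined)(0 := c))"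
    by (intro onb_extend onb_zero) (auto simp: ipn_def)
  also have "{(\<lambda>i. v i + t * c i) | v t. v \<in> {\<lambda>_. 0}} = {v \<in> Rn l. \<exists>t. \<forall>i<l. v i = t * w i}"
  proof (intro equalityI subsetI)
    fix u assume "u \<in> {(\<lambda>i. v i + t * c i) | v t. v \<in> {\<lambda>_. 0}}"
    then obtain t where "u = (\<lambda>i. t * c i)" by auto
    then show "u \<in> {v \<in> Rn l. \<exists>t. \<forall>i<l. v i = t * w i}"
      by (auto simp: Rn_def c_def intro!: exI[of _ "t / N"])
  next
    fix u assume "u \<in> {v \<in> Rn l. \<exists>t. \<forall>i<l. v i = t * w i}"
    then obtain t where "\<forall>i<l. u i = t * w i" "\<forall>i\<ge>l. u i = 0" by (auto simp: Rn_def)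
    then have "u = (\<lambda>i. 0 + (t * N) * c i)"
      using \<open>N > 0\<close> by (auto simp: c_def fun_eq_iff not_less)
    then show "u \<in> {(\<lambda>i. v i + t * c i) | v t. v \<in> {\<lambda>_. 0}}"
      by (intro CollectI exI[of _ "\<lambda>_. 0"] exI[of _ "t * N"]) simp
  qed
  finally show ?case by blast
next
  case (step m)
  let ?V = "{v \<in> Rn m. \<exists>t. \<forall>i<l. v i = t * w i}"
  let ?V' = "{v \<in> Rn (Suc m). \<exists>t. \<forall>i<l. v i = t * w i}"
  from step obtain d b where b: "onb n ?V d b" by auto
  define c where "c i = (if i = m then 1 else (0::real))" for i
  have ic: "ipn n v c = v m" for v
    unfolding ipn_def c_def using step.prems by (simp add: if_distrib[of "\<lambda>x. _ * x"] cong: if_cong)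
  have "onb n {(\<lambda>i. v i + t * c i) | v t. v \<in> ?V} (Suc d) (b(d := c))"
    using step.prems by (intro onb_extend[OF b]) (unfold ic, auto simp: Rn_def c_def)
  also have "{(\<lambda>i. v i + t * c i) | v t. v \<in> ?V} = ?V'"
  proof (intro equalityI subsetI)
    fix u assume "u \<in> {(\<lambda>i. v i + t * c i) | v t. v \<in> ?V}"
    then show "u \<in> ?V'" using step.hyps by (auto simp: Rn_def c_def)
  next
    fix u assume u: "u \<in> ?V'"
    have "u = (\<lambda>i. (u(m := 0)) i + u m * c i)" by (auto simp: c_def)
    moreover have "u(m := 0) \<in> ?V" using u step.hyps by (auto simp: Rn_def)
    ultimately show "u \<in> {(\<lambda>i. v i + t * c i) | v t. v \<in> ?V}" by blast
  qed
  finally show ?case by blast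
qed

section \<open>Tangent, feasible and normal cones of the faces\<close>

lemma lin_span_wface:
  assumes w: "\<And>i. i < l \<Longrightarrow> wt f n i > 0" and l: "l > 0"
    and x: "x \<in> wface f n l"
  shows "lin_span {(\<lambda>i. g i - x i) | g. g \<in> wface f n l} = {v \<in> Rn l. (\<Sum>i<l. wt f n i * v i) = 0}"
proof (intro equalityI subsetI)
  note iff = wface_iff[OF w l]
  fix v assume "v \<in> lin_span {(\<lambda>i. g i - x i) | g. g \<in> wface f n l}"
  then obtain T c where T: "T \<subseteq> {(\<lambda>i. g i - x i) | g. g \<in> wface f n l}" and v: "v = (\<lambda>i. \<Sum>s\<in>T. c s * s i)"
    unfolding lin_span_def by blast
  have s: "\<forall>i\<ge>l. s i = 0" "(\<Sum>i<l. wt f n i * s i) = 0" if "s \<in> T" for s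
  proof -
    from T that obtain g where g: "s = (\<lambda>i. g i - x i)" "g \<in> wface f n l" by blast
    show "\<forall>i\<ge>l. s i = 0" using g x iff[of g] iff[of x] by simp
    show "(\<Sum>i<l. wt f n i * s i) = 0"
      using g x iff[of g] iff[of x] by (simp add: right_diff_distrib sum_subtractf)
  qed
  have "(\<Sum>i<l. wt f n i * v i) = (\<Sum>s\<in>T. c s * (\<Sum>i<l. wt f n i * s i))"
    unfolding v sum_distrib_left by (subst sum.swap) (simp add: mult_ac)
  then show "v \<in> {v \<in> Rn l. (\<Sum>i<l. wt f n i * v i) = 0}" using s by (auto simp: v Rn_def intro!: sum.neutral)
next
  fix v assume v: "v \<in> {v \<in> Rn l. (\<Sum>i<l. wt f n i * v i) = 0}"
  let ?e = "\<lambda>i j. if j = i then 1 / wt f n i else 0"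
  \<comment> \<open>A tangent vector combines the differences of the vertices and \<open>x\<close>
    with coefficients w_i v_i; the contribution of \<open>x\<close> vanishes because these sum to
    zero.\<close>
  have "v = (\<lambda>j. \<Sum>i<l. (wt f n i * v i) * (?e i j - x j))"
  proof
    fix j
    have "(\<Sum>i<l. (wt f n i * v i) * (?e i j - x j)) = (\<Sum>i<l. (wt f n i * v i) * ?e i j) - (\<Sum>i<l. wt f n i * v i) * x j"
      by (simp only: right_diff_distrib sum_subtractf sum_distrib_right)
    also have "(\<Sum>i<l. (wt f n i * v i) * ?e i j) = (\<Sum>i<l. if j = i then v i else 0)"
      by (intro sum.cong refl) (use w in \<open>auto simp: less_imp_neq[THEN not_sym]\<close>)
    also have "\<dots> = v j" using v by (auto simp: Rn_def)
    finally show "v j = (\<Sum>i<l. (wt f n i * v i) * (?e i j - x j))" using v by simp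
  qed
  moreover have "(\<lambda>j. \<Sum>i<l. (wt f n i * v i) * (?e i j - x j)) \<in> lin_span {(\<lambda>i. g i - x i) | g. g \<in> wface f n l}"
    by (rule lin_span_indexed[where s="\<lambda>i j. ?e i j - x j"]) (use wface_vertex[OF w] in auto)
  ultimately show "v \<in> lin_span {(\<lambda>i. g i - x i) | g. g \<in> wface f n l}" by simp
qed

text \<open>The first \<open>k\<close> coordinates of \<open>x\<close> are positive and the others
  vanish. A short move inside the hyperplane can therefore leave the larger face only through a
  coordinate from \<open>k\<close> to \<open>l - 1\<close> that becomes negative.\<close>

lemma feasible_cone_wface:
  assumes w: "\<And>i. i < l \<Longrightarrow> wt f n i > 0" and k: "0 < k" "k \<le> l"
    and x: "x \<in> wface f n k" "\<And>i. i < k \<Longrightarrow> x i > 0"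
    and v: "v \<in> Rn l" "(\<Sum>i<l. wt f n i * v i) = 0"
  shows "v \<in> {(\<lambda>i. t * (g i - x i)) | t g. g \<in> wface f n l \<and> t \<ge> 0} \<longleftrightarrow> (\<forall>i\<in>{k..<l}. v i \<ge> 0)"
proof
  have l: "l > 0" using k by simp
  have xk: "\<forall>i\<ge>k. x i = 0" "(\<Sum>i<k. wt f n i * x i) = 1"
    using wface_iff[of k f n x] x(1) w k by auto
  {
    assume "v \<in> {(\<lambda>i. t * (g i - x i)) | t g. g \<in> wface f n l \<and> t \<ge> 0}"
    then obtain t g where "v = (\<lambda>i. t * (g i - x i))" "g \<in> wface f n l" "t \<ge> 0" by blast
    then show "\<forall>i\<in>{k..<l}. v i \<ge> 0"
      using xk wface_iff[OF w l, of g] by auto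
  }
  assume v0: "\<forall>i\<in>{k..<l}. v i \<ge> 0"
  define e where "e = Min (x ` {..<k})"
  have e: "e > 0" unfolding e_def using k x(2) by (subst Min_gr_iff) auto
  define M where "M = (\<Sum>i<l. \<bar>v i\<bar>) + 1"
  have M: "M > 0" unfolding M_def by (intro add_nonneg_pos sum_nonneg) auto
  \<comment> \<open>Step length \<open>e / M\<close>: since \<open>M\<close> bounds every
    \<open>\<bar>v i\<bar>\<close>, no coordinate below \<open>k\<close> drops by more than
    \<open>e\<close>, the smallest of them in \<open>x\<close>.\<close>
  define g where "g i = x i + (e / M) * v i" for i
  have "g \<in> wface f n l"
  proof -
    have "(\<Sum>i<l. wt f n i * x i) = (\<Sum>i<k. wt f n i * x i)"
      using k xk(1) by (intro sum.mono_neutral_right) auto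
    then have "(\<Sum>i<l. wt f n i * g i) = 1 + (e / M) * (\<Sum>i<l. wt f n i * v i)"
      using xk(2) by (simp add: g_def distrib_left sum.distrib sum_distrib_left mult_ac)
    moreover have "g i \<ge> 0" if "i < l" for i
    proof (cases "i < k")
      case True
      have "\<bar>v i\<bar> \<le> (\<Sum>i<l. \<bar>v i\<bar>)" using that by (intro member_le_sum) auto
      then have "\<bar>v i\<bar> \<le> M" by (simp add: M_def)
      then have "e / M * \<bar>v i\<bar> \<le> e" using e M by (simp add: field_simps)
      moreover have "e \<le> x i" unfolding e_def using True by (intro Min_le) auto
      moreover have "e / M * v i \<ge> - (e / M * \<bar>v i\<bar>)"
        using e M by (metis abs_ge_minus_self abs_mult abs_of_pos divide_pos_pos minus_le_iff)
      moreover have "0 \<le> x' + b" if "a \<le> e'" "e' \<le> x'" "- a \<le> b" for a b e' x' :: real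
        using that by linarith
      ultimately show ?thesis unfolding g_def by blast
    next
      case False
      then show ?thesis using v0 that xk e M by (auto simp: g_def)
    qed
    ultimately show ?thesis using v xk k by (subst wface_iff[OF w l]) (auto simp: g_def Rn_def)
  qed
  moreover have "v = (\<lambda>i. (M / e) * (g i - x i))" using e M by (auto simp: g_def)
  ultimately show "v \<in> {(\<lambda>i. t * (g i - x i)) | t g. g \<in> wface f n l \<and> t \<ge> 0}"
    using e M by (intro CollectI exI[of _ "M / e"] exI[of _ g]) auto
qed

text \<open>A vector is normal at \<open>x\<close> iff the linear functional it defines attains its
  maximum over the polytope at \<open>x\<close>. Testing the vertices gives the bounds on the
  coordinates, complementary slackness the equalities on the face. Conversely the bounds imply
  \<open>ipn n v z \<le> t\<close> on the polytope, the duality of weighted l1 and sup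
  norms.\<close>

lemma normal_cone_wpoly:
  assumes w: "\<And>i. i < n \<Longrightarrow> wt f n i > 0" and l: "0 < l" "l \<le> n"
    and x: "x \<in> wface f n l" "\<And>i. i < l \<Longrightarrow> x i > 0"
  shows "normal_cone n (wpoly f n) x = {v \<in> Rn n. \<exists>t\<ge>0. (\<forall>i<l. v i = t * wt f n i)
     \<and> (\<forall>i\<in>{l..<n}. \<bar>v i\<bar> \<le> t * wt f n i)}" (is "_ = ?N")
proof (intro equalityI subsetI)
  have xl: "\<forall>i\<ge>l. x i = 0" "(\<Sum>i<l. wt f n i * x i) = 1"
    using wface_iff[of l f n x] x(1) w l by auto
  have vx: "ipn n v x = (\<Sum>i<l. v i * x i)" for v
    unfolding ipn_def using l xl(1) by (intro sum.mono_neutral_right) auto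
  have diff: "ipn n v (\<lambda>i. z i - x i) = ipn n v z - ipn n v x" for v z
    by (simp add: ipn_def right_diff_distrib sum_subtractf)
  {
    fix v assume "v \<in> normal_cone n (wpoly f n) x"
    then have v: "v \<in> Rn n" "\<And>z. z \<in> wpoly f n \<Longrightarrow> ipn n v z \<le> ipn n v x"
      by (auto simp: normal_cone_def diff)
    \<comment> \<open>The maximal value of the functional; it becomes the factor in front of the
      weights.\<close>
    define t where "t = ipn n v x"
    have sgn: "a * v i \<le> t * wt f n i" if "i < n" "\<bar>a\<bar> = 1" for i a
    proof -
      let ?z = "\<lambda>j. if j = i then a / wt f n i else 0"
      have "(\<Sum>j<n. wt f n j * \<bar>?z j\<bar>) = (\<Sum>j<n. if j = i then 1 else 0)"
        using that w[OF that(1)] by (intro sum.cong refl) (auto simp: abs_divide)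
      then have "?z \<in> wpoly f n" using that by (auto simp: wpoly_def Rn_def)
      then have "ipn n v ?z \<le> t" unfolding t_def by (rule v(2))
      moreover have "ipn n v ?z = v i * (a / wt f n i)"
        unfolding ipn_def using that by (simp add: if_distrib[of "\<lambda>x. _ * x"] cong: if_cong)
      ultimately show ?thesis using w[OF that(1)] by (simp add: field_simps)
    qed
    have b: "\<bar>v i\<bar> \<le> t * wt f n i" if "i < n" for i
      using sgn[OF that, of 1] sgn[OF that, of "-1"] by auto
    have "0 \<le> t * wt f n 0" using b[of 0] l by force
    then have "t \<ge> 0" using w[of 0] l by (simp add: zero_le_mult_iff)
    moreover have "v i = t * wt f n i" if "i < l" for i
    proof -
      \<comment> \<open>A sum of nonnegative slacks with positive weights \<open>x i\<close> is
        zero, so every slack is zero.\<close>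
      have "(\<Sum>i<l. (t * wt f n i - v i) * x i) = t * (\<Sum>i<l. wt f n i * x i) - ipn n v x"
        by (simp add: vx algebra_simps sum_subtractf sum_distrib_left)
      also have "\<dots> = 0" by (simp add: xl t_def)
      finally have "(\<Sum>i<l. (t * wt f n i - v i) * x i) = 0" .
      moreover have "(t * wt f n i - v i) * x i \<ge> 0" if "i < l" for i
        using b[of i] x(2)[OF that] that l by (intro mult_nonneg_nonneg) auto
      ultimately have "\<forall>i\<in>{..<l}. (t * wt f n i - v i) * x i = 0"
        by (subst (asm) sum_nonneg_eq_0_iff) auto
      then show ?thesis using x(2)[OF that] that by force
    qed
    ultimately show "v \<in> ?N" using v(1) b by auto
  }
  fix v assume "v \<in> ?N"
  then obtain t where v: "v \<in> Rn n" "t \<ge> 0" "\<forall>i<l. v i = t * wt f n i" "\<forall>i\<in>{l..<n}. \<bar>v i\<bar> \<le> t * wt f n i"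
    by blast
  have b: "\<bar>v i\<bar> \<le> t * wt f n i" if "i < n" for i
    using v that w[OF that] by (cases "i < l") auto
  have "ipn n v z \<le> ipn n v x" if "z \<in> wpoly f n" for z
  proof -
    have "ipn n v z \<le> (\<Sum>i<n. t * (wt f n i * \<bar>z i\<bar>))"
      unfolding ipn_def
    proof (rule sum_mono)
      fix i assume "i \<in> {..<n}"
      then have "\<bar>v i\<bar> * \<bar>z i\<bar> \<le> t * wt f n i * \<bar>z i\<bar>" using b by (intro mult_right_mono) auto
      then show "v i * z i \<le> t * (wt f n i * \<bar>z i\<bar>)"
        using abs_ge_self[of "v i * z i"] by (simp add: abs_mult mult.assoc)
    qed
    also have "\<dots> \<le> t * 1"
      unfolding sum_distrib_left[symmetric] using that v(2) by (intro mult_left_mono) (auto simp: wpoly_def)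
    also have "\<dots> = ipn n v x" using v(3) xl(2) by (simp add: vx mult.assoc sum_distrib_left[symmetric])
    finally show ?thesis .
  qed
  then show "v \<in> normal_cone n (wpoly f n) x" using v(1) by (auto simp: normal_cone_def diff)
qed

text \<open>Every vector on the right is a difference of two elements of the cone: adding a large
  multiple of \<open>w\<close> on the first \<open>l\<close> coordinates moves it into the cone, and
  that multiple lies in the cone itself.\<close>

lemma lin_span_normal_cone:
  assumes w: "\<And>i. i < n \<Longrightarrow> w i > 0" and l: "0 < l" "l \<le> n"
  shows "lin_span {v \<in> Rn n. \<exists>t\<ge>0. (\<forall>i<l. v i = t * w i) \<and> (\<forall>i\<in>{l..<n}. \<bar>v i\<bar> \<le> t * w i)}
    = {v \<in> Rn n. \<exists>t. \<forall>i<l. v i = t * w i}" (is "lin_span ?N = _")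
proof (intro equalityI subsetI)
  fix v assume "v \<in> lin_span ?N"
  then obtain T c where T: "T \<subseteq> ?N" and v: "v = (\<lambda>i. \<Sum>s\<in>T. c s * s i)"
    unfolding lin_span_def by blast
  from T have "\<forall>s\<in>T. \<exists>t. \<forall>i<l. s i = t * w i" by blast
  then obtain t where t: "\<And>s i. s \<in> T \<Longrightarrow> i < l \<Longrightarrow> s i = t s * w i" by metis
  have "v \<in> Rn n" using T by (auto simp: v Rn_def subset_iff intro!: sum.neutral)
  moreover have "\<forall>i<l. v i = (\<Sum>s\<in>T. c s * t s) * w i"
    using t by (simp add: v sum_distrib_right mult.assoc)
  ultimately show "v \<in> {v \<in> Rn n. \<exists>t. \<forall>i<l. v i = t * w i}" by blast
next
  fix v assume "v \<in> {v \<in> Rn n. \<exists>t. \<forall>i<l. v i = t * w i}"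
  then obtain t where v: "v \<in> Rn n" "\<forall>i<l. v i = t * w i" by blast
  \<comment> \<open>Large enough that \<open>t + M\<close> still dominates every quotient
    \<open>\<bar>v i\<bar> / w i\<close>; the summand \<open>\<bar>t\<bar>\<close> compensates a
    negative \<open>t\<close>.\<close>
  define M where "M = (\<Sum>i<n. \<bar>v i\<bar> / w i) + \<bar>t\<bar>"
  define u where "u i = (if i < l then M * w i else 0)" for i
  have nn: "(\<Sum>i<n. \<bar>v i\<bar> / w i) \<ge> 0" by (intro sum_nonneg) (use w in \<open>auto simp: less_imp_le\<close>)
  then have M: "M \<ge> 0" "t + M \<ge> 0" by (auto simp: M_def)
  have vM: "\<bar>v i\<bar> \<le> (t + M) * w i" if "i < n" for i
  proof -
    have "\<bar>v i\<bar> / w i \<le> (\<Sum>i<n. \<bar>v i\<bar> / w i)"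
      using that w by (intro member_le_sum) (auto simp: less_imp_le)
    then have "\<bar>v i\<bar> / w i \<le> t + M" by (simp add: M_def)
    then show ?thesis using w[OF that] by (simp add: pos_divide_le_eq)
  qed
  \<comment> \<open>Indexing the two vectors by \<open>bool\<close> covers the case
    \<open>v = 0\<close>, in which they coincide.\<close>
  define s where "s = (\<lambda>b i. if b then v i + u i else u i)"
  have "u \<in> ?N"
    using M(1) l w by (intro CollectI conjI exI[of _ M]) (auto simp: u_def Rn_def less_imp_le)
  moreover have "(\<lambda>i. v i + u i) \<in> ?N"
    using M(2) l v vM by (intro CollectI conjI exI[of _ "t + M"]) (auto simp: u_def Rn_def distrib_right)
  ultimately have "s b \<in> ?N" for b by (cases b) (auto simp: s_def)
  then have "(\<lambda>j. \<Sum>b\<in>UNIV. (if b then 1 else - 1) * s b j) \<in> lin_span ?N"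
    by (intro lin_span_indexed) auto
  also have "(\<lambda>j. \<Sum>b\<in>UNIV. (if b then 1 else - 1) * s b j) = v"
    by (auto simp: s_def UNIV_bool)
  finally show "v \<in> lin_span ?N" .
qed

section \<open>The internal angle\<close>

lemma nn_integral_normal_density:
  "\<sigma> > 0 \<Longrightarrow> (\<integral>\<^sup>+y. ennreal (normal_density \<mu> \<sigma> y) \<partial>lborel) = 1"
  by (simp add: nn_integral_eq_integral integrable_normal_density integral_normal_density)

lemma nn_integral_std_normal_quadratic:
  fixes a x w :: real
  assumes "a \<ge> 0"
  shows "(\<integral>\<^sup>+y. ennreal (std_normal_density y * exp (- a * (x + w * y)\<^sup>2)) \<partial>lborel)
    = ennreal (exp (- a / (1 + 2 * a * w\<^sup>2) * x\<^sup>2) / sqrt (1 + 2 * a * w\<^sup>2))"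
proof -
  define c where "c = 1 + 2 * a * w\<^sup>2"
  have c: "c > 0" using assms by (simp add: c_def add_pos_nonneg)
  \<comment> \<open>Completing the square in \<open>y\<close>: \<open>c\<close> is the inverse
    variance and \<open>\<mu>\<close> the mean of the remaining Gaussian factor.\<close>
  define \<mu> where "\<mu> = - 2 * a * w * x / c"
  have e: "- y\<^sup>2 / 2 + - a * (x + w * y)\<^sup>2 = - a / c * x\<^sup>2 + - (y - \<mu>)\<^sup>2 * c / 2" for y
  proof -
    have "c * \<mu> = - 2 * a * w * x" using c by (simp add: \<mu>_def)
    have "a / c * x\<^sup>2 + c * \<mu>\<^sup>2 / 2 = a * x\<^sup>2"
    proof -
      have "c * \<mu>\<^sup>2 = (c * \<mu>)\<^sup>2 / c" using c by (simp add: power2_eq_square)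
      also have "\<dots> = 4 * a\<^sup>2 * w\<^sup>2 * x\<^sup>2 / c"
        unfolding \<open>c * \<mu> = _\<close> by (simp add: power_mult_distrib)
      finally have "a / c * x\<^sup>2 + c * \<mu>\<^sup>2 / 2 = (a * x\<^sup>2 + 2 * a\<^sup>2 * w\<^sup>2 * x\<^sup>2) / c"
        by (simp add: add_divide_distrib)
      also have "a * x\<^sup>2 + 2 * a\<^sup>2 * w\<^sup>2 * x\<^sup>2 = a * x\<^sup>2 * c"
        by (simp add: c_def algebra_simps power2_eq_square)
      finally show ?thesis using c by simp
    qed
    moreover have "- (y - \<mu>)\<^sup>2 * c / 2 = - y\<^sup>2 / 2 - a * w\<^sup>2 * y\<^sup>2 + y * (c * \<mu>) - c * \<mu>\<^sup>2 / 2"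
      by (simp add: c_def power2_eq_square field_simps)
    moreover have "- a * (x + w * y)\<^sup>2 = - a * x\<^sup>2 - 2 * a * w * x * y - a * w\<^sup>2 * y\<^sup>2"
      by (simp add: power2_eq_square algebra_simps)
    ultimately show ?thesis unfolding \<open>c * \<mu> = _\<close> by (simp add: algebra_simps)
  qed
  have "std_normal_density y * exp (- a * (x + w * y)\<^sup>2)
      = exp (- a / c * x\<^sup>2) / sqrt c * normal_density \<mu> (1 / sqrt c) y" for y
  proof -
    have "std_normal_density y * exp (- a * (x + w * y)\<^sup>2)
       = 1 / sqrt (2 * pi) * exp (- y\<^sup>2 / 2 + - a * (x + w * y)\<^sup>2)"
      by (simp only: std_normal_density_def exp_add mult.assoc)
    also have "\<dots> = 1 / sqrt (2 * pi) * (exp (- a / c * x\<^sup>2) * exp (- (y - \<mu>)\<^sup>2 * c / 2))"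
      unfolding e exp_add ..
    also have "\<dots> = exp (- a / c * x\<^sup>2) / sqrt c * normal_density \<mu> (1 / sqrt c) y"
      using c by (simp add: normal_density_def real_sqrt_divide real_sqrt_mult power_divide)
    finally show ?thesis .
  qed
  note eq = this
  have "(\<integral>\<^sup>+y. ennreal (std_normal_density y * exp (- a * (x + w * y)\<^sup>2)) \<partial>lborel)
    = (\<integral>\<^sup>+y. ennreal (exp (- a / c * x\<^sup>2) / sqrt c) * ennreal (normal_density \<mu> (1 / sqrt c) y) \<partial>lborel)"
    using c by (intro nn_integral_cong, unfold eq, intro ennreal_mult) auto
  also have "\<dots> = ennreal (exp (- a / c * x\<^sup>2) / sqrt c)"
    using c by (subst nn_integral_cmult) (auto simp: nn_integral_normal_density)
  finally show ?thesis by (simp add: c_def)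
qed

text \<open>Integrating out coordinate \<open>j\<close> leaves an integrand of the same form with
  \<open>a\<close> replaced by \<open>a / (1 + 2 * a * (w j)^2)\<close>. Hence the induction runs
  over all \<open>a\<close>, and the normalising factors telescope.\<close>

lemma nn_integral_lebn_normal_quadratic:
  assumes "finite I" "a \<ge> 0"
  shows "(\<integral>\<^sup>+z. ennreal ((\<Prod>i\<in>I. std_normal_density (z i)) * exp (- a * (x + (\<Sum>i\<in>I. w i * z i))\<^sup>2)) \<partial>lebn I)
    = ennreal (exp (- a / (1 + 2 * a * (\<Sum>i\<in>I. (w i)\<^sup>2)) * x\<^sup>2) / sqrt (1 + 2 * a * (\<Sum>i\<in>I. (w i)\<^sup>2)))"
  using assms
proof (induction I arbitrary: a rule: finite_induct)
  case empty
  show ?case by (simp add: PiM_empty nn_integral_count_space_finite)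
next
  case (insert j I)
  let ?c = "1 + 2 * a * (w j)\<^sup>2"
  let ?W = "\<Sum>i\<in>I. (w i)\<^sup>2"
  have c: "?c > 0" using insert.prems by (simp add: add_pos_nonneg)
  have W: "(1 + 2 * (a / ?c) * ?W) = (1 + 2 * a * (\<Sum>i\<in>insert j I. (w i)\<^sup>2)) / ?c"
    using c insert.hyps by (simp add: field_simps)
  have W0: "1 + 2 * a * (\<Sum>i\<in>insert j I. (w i)\<^sup>2) > 0"
    using insert.prems by (intro add_pos_nonneg mult_nonneg_nonneg sum_nonneg) auto
  have "(\<integral>\<^sup>+z. ennreal ((\<Prod>i\<in>insert j I. std_normal_density (z i)) * exp (- a * (x + (\<Sum>i\<in>insert j I. w i * z i))\<^sup>2)) \<partial>lebn (insert j I))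
    = (\<integral>\<^sup>+z. (\<integral>\<^sup>+y. ennreal ((\<Prod>i\<in>insert j I. std_normal_density ((z(j := y)) i)) * exp (- a * (x + (\<Sum>i\<in>insert j I. w i * (z(j := y)) i))\<^sup>2)) \<partial>lborel) \<partial>lebn I)"
    by (rule lborel_product.product_nn_integral_insert[OF insert.hyps]) measurable
  also have "\<dots> = (\<integral>\<^sup>+z. ennreal (1 / sqrt ?c) * ennreal ((\<Prod>i\<in>I. std_normal_density (z i)) * exp (- (a / ?c) * (x + (\<Sum>i\<in>I. w i * z i))\<^sup>2)) \<partial>lebn I)"
  proof (rule nn_integral_cong)
    fix z assume "z \<in> space (lebn I)"
    let ?P = "\<Prod>i\<in>I. std_normal_density (z i)" and ?S = "\<Sum>i\<in>I. w i * z i"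
    have P: "?P \<ge> 0" by (intro prod_nonneg) simp
    have 1: "(\<Prod>i\<in>I. std_normal_density ((z(j := y)) i)) = ?P" "(\<Sum>i\<in>I. w i * (z(j := y)) i) = ?S" for y
      using insert.hyps by (auto intro!: prod.cong sum.cong)
    have "(\<integral>\<^sup>+y. ennreal ((\<Prod>i\<in>insert j I. std_normal_density ((z(j := y)) i)) * exp (- a * (x + (\<Sum>i\<in>insert j I. w i * (z(j := y)) i))\<^sup>2)) \<partial>lborel)
       = (\<integral>\<^sup>+y. ennreal ?P * ennreal (std_normal_density y * exp (- a * ((x + ?S) + w j * y)\<^sup>2)) \<partial>lborel)"
      unfolding prod.insert[OF insert.hyps] sum.insert[OF insert.hyps] 1
      using P by (intro nn_integral_cong) (simp add: ennreal_mult[symmetric] mult_ac add_ac)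
    also have "\<dots> = ennreal ?P * ennreal (exp (- a / ?c * (x + ?S)\<^sup>2) / sqrt ?c)"
      using nn_integral_std_normal_quadratic[OF insert.prems, of "x + ?S" "w j"]
      by (subst nn_integral_cmult) auto
    also have "\<dots> = ennreal (1 / sqrt ?c) * ennreal (?P * exp (- (a / ?c) * (x + ?S)\<^sup>2))"
      using c P by (simp add: ennreal_mult[symmetric])
    finally show "(\<integral>\<^sup>+y. ennreal ((\<Prod>i\<in>insert j I. std_normal_density ((z(j := y)) i)) * exp (- a * (x + (\<Sum>i\<in>insert j I. w i * (z(j := y)) i))\<^sup>2)) \<partial>lborel)
      = ennreal (1 / sqrt ?c) * ennreal (?P * exp (- (a / ?c) * (x + ?S)\<^sup>2))" .
  qed
  also have "\<dots> = ennreal (1 / sqrt ?c) * (\<integral>\<^sup>+z. ennreal ((\<Prod>i\<in>I. std_normal_density (z i)) * exp (- (a / ?c) * (x + (\<Sum>i\<in>I. w i * z i))\<^sup>2)) \<partial>lebn I)"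
    by (rule nn_integral_cmult) measurable
  also have "\<dots> = ennreal (1 / sqrt ?c) * ennreal (exp (- (a / ?c) / (1 + 2 * (a / ?c) * ?W) * x\<^sup>2) / sqrt (1 + 2 * (a / ?c) * ?W))"
    using insert.IH[of "a / ?c"] insert.prems c by simp
  also have "\<dots> = ennreal (exp (- a / (1 + 2 * a * (\<Sum>i\<in>insert j I. (w i)\<^sup>2)) * x\<^sup>2) / sqrt (1 + 2 * a * (\<Sum>i\<in>insert j I. (w i)\<^sup>2)))"
    unfolding W using c W0 by (simp add: ennreal_mult[symmetric] real_sqrt_divide)
  finally show ?case .
qed

text \<open>The angles enter through \<open>ln\<close>, so their positivity has to be established; a
  box of positive volume on which the integrand is positive suffices.\<close>

lemma nn_integral_lebn_pos:
  assumes I: "finite I" and G[measurable]: "G \<in> borel_measurable (lebn I)"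
    and ab: "\<And>i. i \<in> I \<Longrightarrow> a i < (b i :: real)"
    and pos: "\<And>z. z \<in> space (lebn I) \<Longrightarrow> (\<And>i. i \<in> I \<Longrightarrow> a i \<le> z i \<and> z i \<le> b i) \<Longrightarrow> G z > 0"
  shows "(\<integral>\<^sup>+z. G z \<partial>lebn I) > (0::ennreal)"
proof (rule ccontr)
  let ?B = "\<Pi>\<^sub>E i\<in>I. {a i..b i}"
  assume "\<not> ?thesis"
  then have "(\<integral>\<^sup>+z. G z \<partial>lebn I) = 0" by simp
  then have "AE z in lebn I. G z = 0" by (subst (asm) nn_integral_0_iff_AE) auto
  then have "AE z in lebn I. z \<notin> ?B"
  proof (rule AE_mp, intro AE_I2 impI notI)
    fix z assume "z \<in> space (lebn I)" "G z = 0" "z \<in> ?B"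
    then show False using pos[of z] by (auto simp: PiE_iff)
  qed
  moreover have "?B \<in> sets (lebn I)" using I by (intro sets_PiM_I_finite) auto
  ultimately have "emeasure (lebn I) ?B = 0" by (intro null_setsD1 AE_iff_null_sets[THEN iffD2])
  moreover have "emeasure (lebn I) ?B = (\<Prod>i\<in>I. ennreal (b i - a i))"
    using I ab by (subst lborel_product.emeasure_PiM) (auto intro!: prod.cong simp: less_imp_le)
  ultimately show False using I ab by (force simp: ennreal_eq_0_iff)
qed

section \<open>Moment generating functions and \<open>lam\<close>\<close>

lemma nn_integral_std_normal_exp:
  "(\<integral>\<^sup>+y. ennreal (std_normal_density y * exp (t * y)) \<partial>lborel) = ennreal (exp (t\<^sup>2 / 2))"
proof -
  have "std_normal_density y * exp (t * y) = exp (t\<^sup>2 / 2) * normal_density t 1 y" for y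
  proof -
    have "- y\<^sup>2 / 2 + t * y = t\<^sup>2 / 2 + - (y - t)\<^sup>2 / 2"
      by (simp add: power2_eq_square field_simps)
    then have "exp (- y\<^sup>2 / 2) * exp (t * y) = exp (t\<^sup>2 / 2) * exp (- (y - t)\<^sup>2 / 2)"
      by (simp only: exp_add[symmetric])
    then show ?thesis by (simp add: normal_density_def)
  qed
  then have "(\<integral>\<^sup>+y. ennreal (std_normal_density y * exp (t * y)) \<partial>lborel)
    = (\<integral>\<^sup>+y. ennreal (exp (t\<^sup>2 / 2)) * ennreal (normal_density t 1 y) \<partial>lborel)"
    by (simp add: ennreal_mult)
  also have "\<dots> = ennreal (exp (t\<^sup>2 / 2))"
    by (subst nn_integral_cmult) (auto simp: nn_integral_normal_density)
  finally show ?thesis .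
qed

lemma ennreal_Phi: "(\<integral>\<^sup>+y. ennreal (std_normal_density y) * indicator {..t} y \<partial>lborel) = ennreal (Phi t)"
proof -
  have "integrable lborel (\<lambda>y. indicator {..t} y * std_normal_density y)"
    using integrable_mult_indicator[of "{..t}" lborel std_normal_density] by simp
  then have "(\<integral>\<^sup>+y. ennreal (indicator {..t} y * std_normal_density y) \<partial>lborel) = ennreal (Phi t)"
    unfolding Phi_def set_lebesgue_integral_def by (subst nn_integral_eq_integral) auto
  also have "(\<integral>\<^sup>+y. ennreal (indicator {..t} y * std_normal_density y) \<partial>lborel)
     = (\<integral>\<^sup>+y. ennreal (std_normal_density y) * indicator {..t} y \<partial>lborel)"
    by (intro nn_integral_cong) (auto simp: indicator_def)
  finally show ?thesis .
qed

text \<open>Ensures that \<open>lam\<close> is a genuine logarithm, so that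
  \<open>exp (lam t)\<close> can be computed back.\<close>

lemma Phi_pos: "Phi t > 0"
proof -
  have "ennreal (Phi t) > 0"
  proof (rule ccontr)
    assume "\<not> ennreal (Phi t) > 0"
    then have "(\<integral>\<^sup>+y. ennreal (std_normal_density y) * indicator {..t} y \<partial>lborel) = 0"
      by (simp add: ennreal_Phi ennreal_eq_0_iff)
    then have "AE y in lborel. ennreal (std_normal_density y) * indicator {..t} y = 0"
      by (subst (asm) nn_integral_0_iff_AE) auto
    then have "AE y in lborel. y \<notin> {t - 1..t}"
    proof eventually_elim
      case (elim y)
      then show ?case using normal_density_pos[of 1 0 y] by (auto simp: indicator_def split: if_splits)
    qed
    then have "emeasure lborel {t - 1..t} = 0" by (intro null_setsD1 AE_iff_null_sets[THEN iffD2]) auto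
    then show False by simp
  qed
  then show ?thesis by simp
qed

text \<open>Identifies \<open>lam\<close> as the logarithm of the moment generating function of
  \<open>\<bar>g\<bar>\<close>, g standard normal. The density of \<open>\<bar>g\<bar>\<close> is
  twice the normal density on the half-line, whence the divisor 2.\<close>

lemma nn_integral_std_normal_exp_half_line:
  "(\<integral>\<^sup>+y. ennreal (std_normal_density y * exp (t * y)) * indicator {0..} y \<partial>lborel) = ennreal (exp (lam t) / 2)"
proof -
  have 1: "std_normal_density y * exp (t * y) = exp (t\<^sup>2 / 2) * std_normal_density (t - y)" for y
  proof -
    have "- y\<^sup>2 / 2 + t * y = t\<^sup>2 / 2 + - (t - y)\<^sup>2 / 2"
      by (simp add: power2_eq_square field_simps)
    then have "exp (- y\<^sup>2 / 2) * exp (t * y) = exp (t\<^sup>2 / 2) * exp (- (t - y)\<^sup>2 / 2)"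
      by (simp only: exp_add[symmetric])
    then show ?thesis by (simp add: normal_density_def)
  qed
  \<comment> \<open>After completing the square, the reflection of \<open>y\<close> to
    \<open>t - y\<close> maps the half-line from 0 onto the half-line up to \<open>t\<close>, whose
    mass is \<open>Phi t\<close>.\<close>
  have "(\<integral>\<^sup>+y. ennreal (std_normal_density y * exp (t * y)) * indicator {0..} y \<partial>lborel)
    = ennreal \<bar>-1\<bar> * (\<integral>\<^sup>+y. ennreal (std_normal_density (t + (-1) * y) * exp (t * (t + (-1) * y))) * indicator {0..} (t + (-1) * y) \<partial>lborel)"
    by (rule nn_integral_real_affine) auto
  also have "\<dots> = (\<integral>\<^sup>+y. ennreal (exp (t\<^sup>2 / 2)) * (ennreal (std_normal_density y) * indicator {..t} y) \<partial>lborel)"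
    unfolding 1 by (simp, intro nn_integral_cong) (auto simp: ennreal_mult indicator_def)
  also have "\<dots> = ennreal (exp (t\<^sup>2 / 2)) * ennreal (Phi t)"
    by (subst nn_integral_cmult) (auto simp: ennreal_Phi)
  also have "\<dots> = ennreal (exp (lam t) / 2)"
    using Phi_pos[of t] by (simp add: lam_def exp_add ennreal_mult[symmetric])
  finally show ?thesis .
qed

section \<open>Gaussian representation and bound of the internal angle\<close>

lemma std_normal_prod:
  fixes z :: "nat \<Rightarrow> real"
  assumes "finite I"
  shows "exp (- (\<Sum>i\<in>I. (z i)\<^sup>2) / 2) = sqrt (2 * pi) ^ card I * (\<Prod>i\<in>I. std_normal_density (z i))"
proof -
  have "sqrt (2 * pi) ^ card I * (\<Prod>i\<in>I. std_normal_density (z i)) = (\<Prod>i\<in>I. exp (- (z i)\<^sup>2 / 2))"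
    unfolding prod_constant[symmetric] prod.distrib[symmetric]
    by (intro prod.cong refl) (simp add: std_normal_density_def real_sqrt_mult)
  also have "\<dots> = exp (- (\<Sum>i\<in>I. (z i)\<^sup>2) / 2)"
    using assms by (simp add: exp_sum[symmetric] sum_negf sum_divide_distrib)
  finally show ?thesis ..
qed

text \<open>The hyperplane equation eliminates coordinate \<open>p\<close>, whose square adds U^2 /
  w_p^2 to the squared norm, U being the weighted sum over \<open>I\<close>. Since
  \<open>p < k\<close>, the coordinates in \<open>I\<close> still carry all sign conditions. The
  choice \<open>k - 1\<close> gives the weight f (k / n), a constant in the asymptotics. The second
  factor on the left is the integral of \<open>H\<close> over the whole space; the term
  \<open>0 +\<close> matches the shape of the quadratic Gaussian integral.\<close>

lemma int_angle_formula:
  assumes w: "\<And>i. i < n \<Longrightarrow> wt f n i > 0" and k: "0 < k" "k < l" "l \<le> n"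
  defines "p \<equiv> k - 1"
  defines "I \<equiv> {..<l} - {p}"
  defines "H \<equiv> \<lambda>z. (\<Prod>i\<in>I. std_normal_density (z i)) * exp (- (1 / (2 * (wt f n p)\<^sup>2)) * (0 + (\<Sum>i\<in>I. wt f n i * z i))\<^sup>2)"
  shows "ennreal (int_angle n (wface f n k) (wface f n l)) * ennreal (wt f n p / sqrt (\<Sum>i<l. (wt f n i)\<^sup>2))
    = (\<integral>\<^sup>+z. ennreal (H z) * indicator {z. \<forall>i\<in>{k..<l}. z i \<ge> 0} z \<partial>lebn I)"
proof -
  let ?w = "wt f n"
  define V where "V = {v \<in> Rn l. (\<Sum>i<l. ?w i * v i) = 0}"
  define x where "x = (SOME x. x \<in> relint n (wface f n k))"
  have wk: "?w i > 0" if "i < k" for i using that k w by simp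
  have wl: "?w i > 0" if "i < l" for i using that k w by simp
  have "\<exists>x. x \<in> relint n (wface f n k)"
    by (rule relint_wface_nonempty[OF wk]) (use k in auto)
  then have x: "x \<in> relint n (wface f n k)" unfolding x_def by (rule someI_ex)
  then have xk: "x \<in> wface f n k" by (simp add: relint_def)
  have xpos: "x i > 0" if "i < k" for i by (rule relint_wface_pos[OF wk _ _ x that]) (use k in auto)
  have xl: "x \<in> wface f n l"
  proof -
    have "(\<Sum>i<l. ?w i * x i) = (\<Sum>i<k. ?w i * x i)"
      using xk wface_iff[OF wk k(1), of x] k by (intro sum.mono_neutral_right) auto
    moreover have "x i \<ge> 0" for i using xk wface_iff[OF wk k(1), of x] by (cases "i < k") auto
    ultimately show ?thesis
      using xk wface_iff[OF wk k(1), of x] wface_iff[of l f n x] wl k by auto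
  qed
  define C where "C = {(\<lambda>i. t * (g i - x i)) | t g. g \<in> wface f n l \<and> t \<ge> 0}"
  have int: "int_angle n (wface f n k) (wface f n l) = ball_frac n C V"
    unfolding int_angle_def x_def[symmetric] Let_def C_def V_def
    using lin_span_wface[OF wl _ xl] k by simp
  have p: "p < k" "p < l" using k by (auto simp: p_def)
  have wp: "?w p > 0" using wk p by simp
  have I[simp]: "finite I" by (simp add: I_def)
  have lI: "{..<l} = insert p I" "p \<notin> I" using p by (auto simp: I_def)
  have kI: "{k..<l} \<subseteq> I" using p by (auto simp: I_def)
  have VD: "v p = - (\<Sum>i\<in>I. ?w i * v i) / ?w p" "\<forall>i\<ge>l. v i = 0" if "v \<in> V" for v
  proof -
    have "(\<Sum>i<l. ?w i * v i) = ?w p * v p + (\<Sum>i\<in>I. ?w i * v i)"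
      unfolding lI(1) using lI(2) by simp
    then show "v p = - (\<Sum>i\<in>I. ?w i * v i) / ?w p" using that wp by (simp add: V_def field_simps)
    show "\<forall>i\<ge>l. v i = 0" using that by (simp add: V_def Rn_def)
  qed
  have "ennreal (ball_frac n C V) * (\<integral>\<^sup>+z. ennreal (H z) \<partial>lebn I)
    = (\<integral>\<^sup>+z. ennreal (H z) * indicator {z. \<forall>i\<in>{k..<l}. z i \<ge> 0} z \<partial>lebn I)"
  proof (rule ball_frac_coordinates[where \<kappa>="sqrt (2 * pi) ^ card I"])
    have "{v \<in> Rn (Suc (l - 1)). (\<Sum>i\<le>l - 1. ?w i * v i) = 0} = V"
      unfolding V_def using k by (simp add: lessThan_Suc_atMost[symmetric])
    moreover have "\<exists>b. onb n {v \<in> Rn (Suc (l - 1)). (\<Sum>i\<le>l - 1. ?w i * v i) = 0} (l - 1) b"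
      by (rule onb_hyperplane) (use k w in auto)
    ultimately show "\<exists>d b. onb n V d b" by auto
  next
    fix z :: "nat \<Rightarrow> real"
    \<comment> \<open>The point of \<open>V\<close> above \<open>z\<close>: coordinate
      \<open>p\<close> is solved from the hyperplane equation.\<close>
    define v where "v i = (if i \<in> I then z i else if i = p then - (\<Sum>i\<in>I. ?w i * z i) / ?w p else 0)" for i
    have "(\<Sum>i<l. ?w i * v i) = ?w p * v p + (\<Sum>i\<in>I. ?w i * v i)"
      unfolding lI(1) using lI(2) by simp
    also have "(\<Sum>i\<in>I. ?w i * v i) = (\<Sum>i\<in>I. ?w i * z i)" by (intro sum.cong) (auto simp: v_def)
    finally have "(\<Sum>i<l. ?w i * v i) = 0" using lI(2) wp by (simp add: v_def)
    then have "v \<in> V" using p by (auto simp: V_def Rn_def v_def I_def)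
    moreover have "\<forall>i\<in>I. v i = z i" by (simp add: v_def)
    ultimately show "\<exists>v\<in>V. \<forall>i\<in>I. v i = z i" by blast
  next
    fix v assume "v \<in> V"
    then have "v \<in> C \<longleftrightarrow> (\<forall>i\<in>{k..<l}. v i \<ge> 0)"
      unfolding C_def V_def using feasible_cone_wface[OF wl k(1) _ xk xpos] k by simp
    then show "v \<in> C \<longleftrightarrow> (\<forall>i\<in>{k..<l}. restrict v I i \<ge> 0)" using kI by (auto simp: subset_iff)
  next
    fix c :: real and z :: "nat \<Rightarrow> real" assume "c > 0" "\<forall>i\<in>{k..<l}. z i \<ge> 0"
    then show "\<forall>i\<in>{k..<l}. (\<lambda>i\<in>I. c * z i) i \<ge> 0" using kI by (auto simp: subset_iff)
  next
    have "(\<lambda>z. z i) \<in> borel_measurable (lebn I)" if "i \<in> {k..<l}" for i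
      using kI that measurable_component_singleton[where M="\<lambda>_. lborel" and I=I] by auto
    then show "Measurable.pred (lebn I) (\<lambda>z. \<forall>i\<in>{k..<l}. z i \<ge> 0)" by measurable
  next
    show "H \<in> borel_measurable (lebn I)" unfolding H_def by measurable
  next
    fix v assume v: "v \<in> V"
    have "(\<Sum>i<n. (v i)\<^sup>2) = (\<Sum>i<l. (v i)\<^sup>2)"
      using VD(2)[OF v] k by (intro sum.mono_neutral_right) auto
    also have "\<dots> = (\<Sum>i\<in>I. (v i)\<^sup>2) + (v p)\<^sup>2"
      unfolding lI(1) using lI(2) by simp
    also have "(v p)\<^sup>2 = (\<Sum>i\<in>I. ?w i * v i)\<^sup>2 / (?w p)\<^sup>2"
      using VD(1)[OF v] by (simp add: power_divide)
    finally have "exp (- (\<Sum>i<n. (v i)\<^sup>2) / 2)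
       = exp (- (\<Sum>i\<in>I. (v i)\<^sup>2) / 2) * exp (- (1 / (2 * (?w p)\<^sup>2)) * (0 + (\<Sum>i\<in>I. ?w i * v i))\<^sup>2)"
      by (simp add: exp_add[symmetric] add_divide_distrib)
    then show "exp (- (\<Sum>i<n. (v i)\<^sup>2) / 2) = sqrt (2 * pi) ^ card I * H (restrict v I)"
      unfolding std_normal_prod[OF I] H_def by (simp add: mult.assoc)
  qed auto
  also have "(\<integral>\<^sup>+z. ennreal (H z) \<partial>lebn I) = ennreal (1 / sqrt (1 + 2 * (1 / (2 * (?w p)\<^sup>2)) * (\<Sum>i\<in>I. (?w i)\<^sup>2)))"
    unfolding H_def by (subst nn_integral_lebn_normal_quadratic) auto
  also have "1 + 2 * (1 / (2 * (?w p)\<^sup>2)) * (\<Sum>i\<in>I. (?w i)\<^sup>2) = (\<Sum>i<l. (?w i)\<^sup>2) / (?w p)\<^sup>2"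
    unfolding lI(1) using lI(2) wp by (simp add: add_divide_distrib)
  also have "1 / sqrt ((\<Sum>i<l. (?w i)\<^sup>2) / (?w p)\<^sup>2) = ?w p / sqrt (\<Sum>i<l. (?w i)\<^sup>2)"
    using wp by (simp add: real_sqrt_divide)
  finally show ?thesis unfolding int .
qed

lemma int_angle_pos:
  assumes w: "\<And>i. i < n \<Longrightarrow> wt f n i > 0" and k: "0 < k" "k < l" "l \<le> n"
  shows "int_angle n (wface f n k) (wface f n l) > 0"
proof -
  let ?I = "{..<l} - {k - 1}"
  let ?H = "\<lambda>z. (\<Prod>i\<in>?I. std_normal_density (z i)) * exp (- (1 / (2 * (wt f n (k - 1))\<^sup>2)) * (0 + (\<Sum>i\<in>?I. wt f n i * z i))\<^sup>2)"
  have kI: "{k..<l} \<subseteq> ?I" using k by auto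
  have "(\<integral>\<^sup>+z. ennreal (?H z) * indicator {z. \<forall>i\<in>{k..<l}. z i \<ge> 0} z \<partial>lebn ?I) > 0"
  \<comment> \<open>On the unit box all sign conditions hold and the integrand is positive.\<close>
  proof (rule nn_integral_lebn_pos[where a="\<lambda>_. 0" and b="\<lambda>_. 1"])
    have "(\<lambda>z. z i) \<in> borel_measurable (lebn ?I)" if "i \<in> {k..<l}" for i
    proof -
      have "i \<in> ?I" using that kI by blast
      from measurable_component_singleton[OF this, where M="\<lambda>_. lborel"] show ?thesis by simp
    qed
    then have "Measurable.pred (lebn ?I) (\<lambda>z. \<forall>i\<in>{k..<l}. z i \<ge> 0)" by measurable
    then show "(\<lambda>z. ennreal (?H z) * indicator {z. \<forall>i\<in>{k..<l}. z i \<ge> 0} z) \<in> borel_measurable (lebn ?I)"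
      by measurable
  next
    fix z :: "nat \<Rightarrow> real" assume "\<And>i. i \<in> ?I \<Longrightarrow> 0 \<le> z i \<and> z i \<le> 1"
    then have "\<forall>i\<in>{k..<l}. z i \<ge> 0" using kI by blast
    moreover have "?H z > 0" by (intro mult_pos_pos prod_pos normal_density_pos ballI) auto
    ultimately show "ennreal (?H z) * indicator {z. \<forall>i\<in>{k..<l}. z i \<ge> 0} z > 0" by (simp add: indicator_def)
  qed auto
  then have "ennreal (int_angle n (wface f n k) (wface f n l)) \<noteq> 0"
    using int_angle_formula[OF w k] by (auto simp: not_less)
  then show ?thesis by (simp add: ennreal_eq_0_iff)
qed

text \<open>Chernoff bound with a free real parameter \<open>s\<close>. The eliminated coordinate
  yields exp (s^2 w_p^2 / 2) through the quadratic inequality, every other index below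
  \<open>k\<close> the same expression in its own weight as a Gaussian moment generating function,
  so together they form the full sum over \<open>i < k\<close>. Each index from \<open>k\<close> on
  yields \<open>exp (lam (s * w_i)) / 2\<close>.\<close>

lemma int_angle_le:
  assumes w: "\<And>i. i < n \<Longrightarrow> wt f n i > 0" and k: "0 < k" "k < l" "l \<le> n"
  shows "int_angle n (wface f n k) (wface f n l)
    \<le> exp (s\<^sup>2 / 2 * (\<Sum>i<k. (wt f n i)\<^sup>2) + (\<Sum>i\<in>{k..<l}. lam (s * wt f n i))) / 2 ^ (l - k)
      * (sqrt (\<Sum>i<l. (wt f n i)\<^sup>2) / wt f n (k - 1))" (is "?\<beta> \<le> ?E * _")
proof -
  let ?w = "wt f n"
  define p where "p = k - 1"
  define I where "I = {..<l} - {p}"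
  define A where "A = {..<k} - {p}"
  define H where "H z = (\<Prod>i\<in>I. std_normal_density (z i)) * exp (- (1 / (2 * (?w p)\<^sup>2)) * (0 + (\<Sum>i\<in>I. ?w i * z i))\<^sup>2)" for z
  have p: "p < k" "p < l" using k by (auto simp: p_def)
  have wp: "?w p > 0" using w p k by simp
  have [simp]: "finite I" "finite A" by (auto simp: I_def A_def)
  have IA: "I = A \<union> {k..<l}" "A \<inter> {k..<l} = {}" using p k by (auto simp: I_def A_def)
  have kp: "{..<k} = insert p A" "p \<notin> A" using p by (auto simp: A_def)
  \<comment> \<open>One-dimensional factors of the majorant; the sign condition sits only on the
    indices from \<open>k\<close> on.\<close>
  define h where "h i y = ennreal (std_normal_density y * exp (s * ?w i * y)) * (if i < k then 1 else indicator {0..} y)" for i y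
  have hm: "h i \<in> borel_measurable lborel" for i unfolding h_def by measurable
  have bound: "ennreal (H z) * indicator {z. \<forall>i\<in>{k..<l}. z i \<ge> 0} z
      \<le> ennreal (exp (s\<^sup>2 * (?w p)\<^sup>2 / 2)) * (\<Prod>i\<in>I. h i (z i))" for z
  proof (cases "\<forall>i\<in>{k..<l}. z i \<ge> 0")
    case True
    let ?U = "\<Sum>i\<in>I. ?w i * z i"
    have "- (1 / (2 * (?w p)\<^sup>2)) * (0 + ?U)\<^sup>2 \<le> s\<^sup>2 * (?w p)\<^sup>2 / 2 + s * ?U"
    proof -
      \<comment> \<open>The summands are scaled so that the cross term is \<open>s * ?U\<close>,
        linear in the coordinates and hence a product after exponentiation.\<close>
      have "0 \<le> (?U / ?w p + s * ?w p)\<^sup>2 / 2" by simp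
      also have "\<dots> = (1 / (2 * (?w p)\<^sup>2)) * ?U\<^sup>2 + s * ?U + s\<^sup>2 * (?w p)\<^sup>2 / 2"
        using wp by (simp add: power2_eq_square field_simps)
      finally show ?thesis by simp
    qed
    then have "H z \<le> (\<Prod>i\<in>I. std_normal_density (z i)) * (exp (s\<^sup>2 * (?w p)\<^sup>2 / 2) * exp (s * ?U))"
      unfolding H_def exp_add[symmetric] by (intro mult_left_mono prod_nonneg) auto
    also have "exp (s * ?U) = (\<Prod>i\<in>I. exp (s * ?w i * z i))"
      by (simp add: exp_sum[symmetric] sum_distrib_left mult.assoc)
    also have "(\<Prod>i\<in>I. std_normal_density (z i)) * (exp (s\<^sup>2 * (?w p)\<^sup>2 / 2) * \<dots>)
       = exp (s\<^sup>2 * (?w p)\<^sup>2 / 2) * (\<Prod>i\<in>I. std_normal_density (z i) * exp (s * ?w i * z i))"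
      by (simp add: prod.distrib)
    finally have "ennreal (H z) \<le> ennreal (exp (s\<^sup>2 * (?w p)\<^sup>2 / 2)) * ennreal (\<Prod>i\<in>I. std_normal_density (z i) * exp (s * ?w i * z i))"
      by (subst ennreal_mult[symmetric]) (auto intro!: prod_nonneg ennreal_leI)
    also have "ennreal (\<Prod>i\<in>I. std_normal_density (z i) * exp (s * ?w i * z i)) = (\<Prod>i\<in>I. h i (z i))"
      using True by (subst prod_ennreal[symmetric]) (auto simp: h_def IA A_def indicator_def intro!: prod.cong)
    finally show ?thesis using True by simp
  qed simp
  have hi: "(\<integral>\<^sup>+y. h i y \<partial>lborel) = ennreal (if i < k then exp (s\<^sup>2 * (?w i)\<^sup>2 / 2) else exp (lam (s * ?w i)) / 2)" for i
    unfolding h_def using nn_integral_std_normal_exp[of "s * ?w i"] nn_integral_std_normal_exp_half_line[of "s * ?w i"]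
    by (simp add: power_mult_distrib)
  have "ennreal ?\<beta> * ennreal (?w p / sqrt (\<Sum>i<l. (?w i)\<^sup>2))
    = (\<integral>\<^sup>+z. ennreal (H z) * indicator {z. \<forall>i\<in>{k..<l}. z i \<ge> 0} z \<partial>lebn I)"
    using int_angle_formula[OF w k] unfolding H_def I_def p_def .
  also have "\<dots> \<le> (\<integral>\<^sup>+z. ennreal (exp (s\<^sup>2 * (?w p)\<^sup>2 / 2)) * (\<Prod>i\<in>I. h i (z i)) \<partial>lebn I)"
    by (intro nn_integral_mono bound)
  also have "\<dots> = ennreal (exp (s\<^sup>2 * (?w p)\<^sup>2 / 2)) * (\<Prod>i\<in>I. \<integral>\<^sup>+y. h i y \<partial>lborel)"
  proof (subst nn_integral_cmult)
    show "(\<lambda>z. \<Prod>i\<in>I. h i (z i)) \<in> borel_measurable (lebn I)"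
      using hm by measurable
  qed (subst lborel_product.product_nn_integral_prod, auto simp: hm[simplified])
  also have "(\<Prod>i\<in>I. \<integral>\<^sup>+y. h i y \<partial>lborel) = ennreal (\<Prod>i\<in>I. if i < k then exp (s\<^sup>2 * (?w i)\<^sup>2 / 2) else exp (lam (s * ?w i)) / 2)"
    unfolding hi by (subst prod_ennreal) auto
  also have "(\<Prod>i\<in>I. if i < k then exp (s\<^sup>2 * (?w i)\<^sup>2 / 2) else exp (lam (s * ?w i)) / 2)
     = (\<Prod>i\<in>A. exp (s\<^sup>2 * (?w i)\<^sup>2 / 2)) * (\<Prod>i\<in>{k..<l}. exp (lam (s * ?w i)) / 2)"
    unfolding IA(1) by (subst prod.union_disjoint) (use IA in \<open>auto simp: A_def intro!: arg_cong2[where f="(*)"] prod.cong\<close>)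
  also have "\<dots> = exp (\<Sum>i\<in>A. s\<^sup>2 * (?w i)\<^sup>2 / 2) * (exp (\<Sum>i\<in>{k..<l}. lam (s * ?w i)) / 2 ^ (l - k))"
    by (simp add: exp_sum prod_dividef)
  also have "ennreal (exp (s\<^sup>2 * (?w p)\<^sup>2 / 2)) * ennreal \<dots> = ennreal ?E"
  proof (subst ennreal_mult[symmetric])
    have "s\<^sup>2 / 2 * (\<Sum>i<k. (?w i)\<^sup>2) = s\<^sup>2 * (?w p)\<^sup>2 / 2 + (\<Sum>i\<in>A. s\<^sup>2 * (?w i)\<^sup>2 / 2)"
      unfolding kp(1) using kp(2) by (simp add: sum_distrib_left distrib_left)
    then show "ennreal (exp (s\<^sup>2 * (?w p)\<^sup>2 / 2) * (exp (\<Sum>i\<in>A. s\<^sup>2 * (?w i)\<^sup>2 / 2) * (exp (\<Sum>i\<in>{k..<l}. lam (s * ?w i)) / 2 ^ (l - k)))) = ennreal ?E"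
      by (simp only: exp_add mult.assoc times_divide_eq_right)
  qed auto
  finally have *: "ennreal ?\<beta> * ennreal (?w p / sqrt (\<Sum>i<l. (?w i)\<^sup>2)) \<le> ennreal ?E" .
  have "(\<Sum>i<l. (?w i)\<^sup>2) > 0"
    by (intro sum_pos) (use w k in \<open>auto simp: less_imp_neq[THEN not_sym]\<close>)
  then have S: "sqrt (\<Sum>i<l. (?w i)\<^sup>2) > 0" by simp
  have "?\<beta> * (?w p / sqrt (\<Sum>i<l. (?w i)\<^sup>2)) \<le> ?E"
    using * int_angle_pos[OF w k] wp S by (simp add: ennreal_mult[symmetric] less_imp_le)
  then show ?thesis using wp S by (simp add: p_def field_simps)
qed

section \<open>The external angle\<close>

text \<open>The substitution \<open>y = sqrt 2 * t\<close> turns the normal density into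
  \<open>exp (- t^2) / sqrt pi\<close>, and the two halves of the interval are mirror
  images.\<close>

lemma nn_integral_std_normal_symmetric_interval:
  assumes "a \<ge> 0"
  shows "(\<integral>\<^sup>+y. ennreal (std_normal_density y) * indicator {-a..a} y \<partial>lborel) = ennreal (erf (a / sqrt 2))"
proof -
  define x where "x = a / sqrt 2"
  have x: "x \<ge> 0" using assms by (simp add: x_def)
  have a: "a = sqrt 2 * x" by (simp add: x_def)
  let ?g = "\<lambda>t. ennreal (exp (- t\<^sup>2) / sqrt pi)"
  have sn: "sqrt 2 * std_normal_density (sqrt 2 * t) = exp (- t\<^sup>2) / sqrt pi" for t
    by (simp add: std_normal_density_def real_sqrt_mult power_mult_distrib)
  have "set_integrable lborel {0..x} (\<lambda>t. exp (- t\<^sup>2))"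
    by (intro borel_integrable_atLeastAtMost' continuous_intros)
  then have int: "integrable lborel (\<lambda>t. indicator {0..x} t * exp (- t\<^sup>2))"
    by (simp add: set_integrable_def)
  have "(\<integral>\<^sup>+y. ennreal (std_normal_density y) * indicator {-a..a} y \<partial>lborel)
     = ennreal \<bar>sqrt 2\<bar> * (\<integral>\<^sup>+t. ennreal (std_normal_density (0 + sqrt 2 * t)) * indicator {-a..a} (0 + sqrt 2 * t) \<partial>lborel)"
    by (rule nn_integral_real_affine) auto
  also have "\<dots> = (\<integral>\<^sup>+t. ennreal (sqrt 2) * (ennreal (std_normal_density (sqrt 2 * t)) * indicator {-a..a} (sqrt 2 * t)) \<partial>lborel)"
    by (subst nn_integral_cmult) auto
  also have "\<dots> = (\<integral>\<^sup>+t. ?g t * indicator {0..x} t + ?g t * indicator {-x..<0} t \<partial>lborel)"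
  proof (rule nn_integral_cong)
    fix t :: real
    have "ennreal (sqrt 2) * ennreal (std_normal_density (sqrt 2 * t)) = ?g t"
      unfolding sn[symmetric] by (intro ennreal_mult[symmetric]) auto
    moreover have "sqrt 2 * t \<in> {-a..a} \<longleftrightarrow> t \<in> {-x..x}"
    proof -
      have "- (sqrt 2 * x) = sqrt 2 * (- x)" by simp
      then have "- (sqrt 2 * x) \<le> sqrt 2 * t \<longleftrightarrow> - x \<le> t"
        by (metis mult_le_cancel_left_pos real_sqrt_gt_0_iff zero_less_numeral)
      then show ?thesis by (simp add: a)
    qed
    ultimately show "ennreal (sqrt 2) * (ennreal (std_normal_density (sqrt 2 * t)) * indicator {-a..a} (sqrt 2 * t))
      = ?g t * indicator {0..x} t + ?g t * indicator {-x..<0} t"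
      unfolding mult.assoc[symmetric] using x by (auto simp: indicator_def)
  qed
  also have "\<dots> = (\<integral>\<^sup>+t. ?g t * indicator {0..x} t \<partial>lborel) + (\<integral>\<^sup>+t. ?g t * indicator {-x..<0} t \<partial>lborel)"
    by (rule nn_integral_add) auto
  also have "(\<integral>\<^sup>+t. ?g t * indicator {-x..<0} t \<partial>lborel) = ennreal \<bar>-1\<bar> * (\<integral>\<^sup>+t. ?g (0 + -1 * t) * indicator {-x..<0} (0 + -1 * t) \<partial>lborel)"
    by (rule nn_integral_real_affine) auto
  also have "\<dots> = (\<integral>\<^sup>+t. ?g t * indicator {0..x} t \<partial>lborel)"
  proof -
    \<comment> \<open>Reflecting \<open>{-x..<0}\<close> gives \<open>{0<..x}\<close>, which differs
      from \<open>{0..x}\<close> only by a null set.\<close>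
    have "AE t::real in lborel. t \<noteq> 0" by (rule AE_lborel_singleton)
    then have "(\<integral>\<^sup>+t. ?g (0 + -1 * t) * indicator {-x..<0} (0 + -1 * t) \<partial>lborel) = (\<integral>\<^sup>+t. ?g t * indicator {0..x} t \<partial>lborel)"
      by (intro nn_integral_cong_AE, eventually_elim) (auto simp: indicator_def)
    then show ?thesis by simp
  qed
  also have "(\<integral>\<^sup>+t. ?g t * indicator {0..x} t \<partial>lborel) = (\<integral>\<^sup>+t. ennreal (1 / sqrt pi * (indicator {0..x} t * exp (- t\<^sup>2))) \<partial>lborel)"
    by (intro nn_integral_cong) (auto simp: indicator_def)
  also have "\<dots> = ennreal (1 / sqrt pi * (LBINT t:{0..x}. exp (- t\<^sup>2)))"
    using int by (subst nn_integral_eq_integral) (auto simp: set_lebesgue_integral_def)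
  also have "(LBINT t:{0..x}. exp (- t\<^sup>2)) = (LBINT t=0..x. exp (- t\<^sup>2))"
    using interval_integral_Icc[OF x, of "\<lambda>t. exp (- t\<^sup>2)"] by (simp add: zero_ereal_def)
  also have "ennreal (1 / sqrt pi * (LBINT t=0..x. exp (- t\<^sup>2))) + ennreal (1 / sqrt pi * (LBINT t=0..x. exp (- t\<^sup>2)))
     = ennreal (erf x)"
  proof -
    have "(LBINT t=0..x. exp (- t\<^sup>2)) \<ge> 0"
    proof -
      have "(LBINT t:{0..x}. exp (- t\<^sup>2)) \<ge> 0"
        unfolding set_lebesgue_integral_def by (intro integral_nonneg_AE) auto
      then show ?thesis using interval_integral_Icc[OF x, of "\<lambda>t. exp (- t\<^sup>2)"] by (simp add: zero_ereal_def)
    qed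
    then show ?thesis unfolding erf_def by (subst ennreal_plus[symmetric]) (auto simp: field_simps)
  qed
  finally show ?thesis by (simp add: x_def)
qed

section \<open>Elementary estimates for \<open>erf\<close>\<close>

lemma erf_integral:
  assumes x: "x \<ge> 0"
  shows "erf x = 2 / sqrt pi * integral {0..x} (\<lambda>t. exp (- t\<^sup>2))"
proof -
  have "set_integrable lborel {0..x} (\<lambda>t. exp (- t\<^sup>2))"
    by (intro borel_integrable_atLeastAtMost' continuous_intros)
  from interval_integral_eq_integral[OF x this] show ?thesis
    by (simp add: erf_def zero_ereal_def)
qed

lemma erf_mono:
  assumes "0 \<le> x" "x \<le> y"
  shows "erf x \<le> erf y"
proof -
  have "integral {0..x} (\<lambda>t. exp (- t\<^sup>2)) \<le> integral {0..y} (\<lambda>t::real. exp (- t\<^sup>2))"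
    using assms by (intro integral_subset_le integrable_continuous_real continuous_intros) auto
  then show ?thesis using assms by (simp add: erf_integral divide_right_mono)
qed

lemma erf_pos:
  assumes "x > 0"
  shows "erf x > 0"
proof -
  have "0 < integral {0..x} (\<lambda>_::real. exp (- x\<^sup>2))" using assms by simp
  also have "\<dots> \<le> integral {0..x} (\<lambda>t. exp (- t\<^sup>2))"
    using assms by (intro integral_le integrable_continuous_real continuous_intros)
      (auto intro: power_mono)
  finally show ?thesis using assms by (simp add: erf_integral)
qed

text \<open>The integrand is at most 1. This is the estimate that makes the external integrand small
  near 0.\<close>

lemma erf_le_linear:
  assumes "x \<ge> 0"
  shows "erf x \<le> 2 / sqrt pi * x"
proof -
  have "integral {0..x} (\<lambda>t. exp (- t\<^sup>2)) \<le> integral {0..x} (\<lambda>_::real. 1)"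
    by (intro integral_le integrable_continuous_real continuous_intros) auto
  then show ?thesis using assms by (simp add: erf_integral divide_right_mono)
qed

text \<open>\<open>erf x\<close> is the probability of an interval under the standard normal
  law.\<close>

lemma erf_le_1:
  assumes "x \<ge> 0"
  shows "erf x \<le> 1"
proof -
  have "ennreal (erf (sqrt 2 * x / sqrt 2)) = (\<integral>\<^sup>+y. ennreal (std_normal_density y) * indicator {- (sqrt 2 * x)..sqrt 2 * x} y \<partial>lborel)"
    using assms by (subst nn_integral_std_normal_symmetric_interval) auto
  also have "\<dots> \<le> (\<integral>\<^sup>+y. ennreal (std_normal_density y) \<partial>lborel)"
    by (intro nn_integral_mono) (auto simp: indicator_def)
  finally show ?thesis by (simp add: nn_integral_normal_density)
qed

lemma continuous_on_erf: "continuous_on {0..B} erf"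
proof -
  have "continuous_on {0..B} (\<lambda>x. 2 / sqrt pi * integral {0..x} (\<lambda>t. exp (- t\<^sup>2)))"
    by (intro continuous_on_mult_left indefinite_integral_continuous_1 integrable_continuous_real continuous_intros)
  then show ?thesis
    by (rule continuous_on_eq) (simp add: erf_integral)
qed

lemma erf_nonneg: "x \<ge> 0 \<Longrightarrow> erf x \<ge> 0"
  using erf_pos[of x] by (cases "x = 0") (auto simp: erf_integral)

text \<open>Truncation at 0 extends the monotonicity of \<open>erf\<close> on nonnegative arguments
  to the whole line, which gives measurability. The integrands below are rewritten into this form
  for that purpose.\<close>

lemma borel_measurable_erf_max: "(\<lambda>u. erf (max 0 u)) \<in> borel_measurable borel"
  by (intro borel_measurable_mono monoI erf_mono) auto

text \<open>A vector of the span is given by the ray parameter t = z_p / w_p, with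
  \<open>p = l - 1\<close> representing the first \<open>l\<close> coordinates, and by the
  coordinates in \<open>J\<close>. Its squared norm is t^2 S plus the squares over \<open>J\<close>.
  For fixed t the cone condition splits into independent events \<bar>z_i\<bar> \<le> t w_i of
  probability erf (t w_i / sqrt 2); substituting t = sqrt 2 * x gives the stated form.\<close>

lemma ext_angle_formula:
  assumes w: "\<And>i. i < n \<Longrightarrow> wt f n i > 0" and l: "0 < l" "l \<le> n"
  shows "ennreal (ext_angle n (wface f n l) (wpoly f n)) * ennreal (sqrt pi / sqrt (\<Sum>i<l. (wt f n i)\<^sup>2))
    = (\<integral>\<^sup>+x. ennreal (exp (- x\<^sup>2 * (\<Sum>i<l. (wt f n i)\<^sup>2)) * (\<Prod>i\<in>{l..<n}. erf (x * wt f n i)))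
         * indicator {0..} x \<partial>lborel)"
proof -
  let ?w = "wt f n"
  define S where "S = (\<Sum>i<l. (?w i)\<^sup>2)"
  define p where "p = l - 1"
  define J where "J = {l..<n}"
  define V where "V = {v \<in> Rn n. \<exists>t. \<forall>i<l. v i = t * ?w i}"
  define N where "N = {v \<in> Rn n. \<exists>t\<ge>0. (\<forall>i<l. v i = t * ?w i) \<and> (\<forall>i\<in>{l..<n}. \<bar>v i\<bar> \<le> t * ?w i)}"
  define H where "H z = (\<Prod>i\<in>J. std_normal_density (z i)) * exp (- (z p)\<^sup>2 * S / (2 * (?w p)\<^sup>2))" for z :: "nat \<Rightarrow> real"
  define Q where "Q z \<longleftrightarrow> z p \<ge> 0 \<and> (\<forall>i\<in>J. \<bar>z i\<bar> \<le> z p / ?w p * ?w i)" for z :: "nat \<Rightarrow> real"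
  define x where "x = (SOME x. x \<in> relint n (wface f n l))"
  have wl: "?w i > 0" if "i < l" for i using that l w by simp
  have "\<exists>x. x \<in> relint n (wface f n l)"
    by (rule relint_wface_nonempty[OF wl]) (use l in auto)
  then have x: "x \<in> relint n (wface f n l)" unfolding x_def by (rule someI_ex)
  then have xl: "x \<in> wface f n l" by (simp add: relint_def)
  have xpos: "x i > 0" if "i < l" for i by (rule relint_wface_pos[OF wl _ _ x that]) (use l in auto)
  have "normal_cone n (wpoly f n) x = N"
    unfolding N_def by (rule normal_cone_wpoly[OF w l xl xpos])
  moreover have "lin_span N = V" unfolding N_def V_def by (rule lin_span_normal_cone[OF w l])
  ultimately have ext: "ext_angle n (wface f n l) (wpoly f n) = ball_frac n N V"
    unfolding ext_angle_def x_def[symmetric] by simp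
  have p: "p < l" "p < n" "p \<notin> J" using l by (auto simp: p_def J_def)
  have wp: "?w p > 0" using wl p by simp
  have S: "S > 0" unfolding S_def
    by (intro sum_pos) (use wl l in \<open>auto simp: less_imp_neq[THEN not_sym]\<close>)
  have J[simp]: "finite J" by (simp add: J_def)
  let ?I = "insert p J"
  have vp: "v i = v p / ?w p * ?w i" if "v \<in> V" "i < l" for v i
  proof -
    from that obtain t where "\<forall>i<l. v i = t * ?w i" by (auto simp: V_def)
    then show ?thesis using that(2) p wp by simp
  qed
  have comp: "(\<lambda>z. z i) \<in> borel_measurable (lebn ?I)" if "i \<in> ?I" for i
    using measurable_component_singleton[OF that, where M="\<lambda>_. lborel"] by simp
  have comp': "(\<lambda>z. z p) \<in> borel_measurable (lebn ?I)" by (rule comp) simp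
  have Qm[measurable]: "Measurable.pred (lebn ?I) Q"
  proof -
    have "Measurable.pred (lebn ?I) (\<lambda>z. \<bar>z i\<bar> \<le> z p / ?w p * ?w i)" if "i \<in> J" for i
    proof -
      have "(\<lambda>z. z i) \<in> borel_measurable (lebn ?I)" by (rule comp) (use that in simp)
      then have "{z \<in> space (lebn ?I). \<bar>z i\<bar> \<le> z p / ?w p * ?w i} \<in> sets (lebn ?I)"
        by (intro borel_measurable_le borel_measurable_abs borel_measurable_times borel_measurable_divide
            borel_measurable_const comp')
      then show ?thesis by (simp only: pred_def)
    qed
    then have [measurable]: "Measurable.pred (lebn ?I) (\<lambda>z. \<forall>i\<in>J. \<bar>z i\<bar> \<le> z p / ?w p * ?w i)"
      by (intro pred_intros_finite J)
    have "Measurable.pred (lebn ?I) (\<lambda>z. 0 \<le> z p)"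
      unfolding pred_def by (intro borel_measurable_le borel_measurable_const comp')
    then show ?thesis unfolding Q_def by measurable
  qed
  have Hm[measurable]: "H \<in> borel_measurable (lebn ?I)"
  proof -
    have "(\<lambda>z. \<Prod>i\<in>J. std_normal_density (z i)) \<in> borel_measurable (lebn ?I)"
      by (intro borel_measurable_prod measurable_compose[OF comp]) auto
    then show ?thesis unfolding H_def using comp' by measurable
  qed
  have "ennreal (ball_frac n N V) * (\<integral>\<^sup>+z. ennreal (H z) \<partial>lebn ?I)
    = (\<integral>\<^sup>+z. ennreal (H z) * indicator {z. Q z} z \<partial>lebn ?I)"
  proof (rule ball_frac_coordinates[where \<kappa>="sqrt (2 * pi) ^ card J"])
    show "\<exists>d b. onb n V d b"
      unfolding V_def by (rule onb_ray_extension) (use w l in auto)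
  next
    fix z :: "nat \<Rightarrow> real"
    define v where "v i = (if i < l then z p / ?w p * ?w i else if i < n then z i else 0)" for i
    have "v \<in> V" unfolding V_def using l by (auto simp: Rn_def v_def intro!: exI[of _ "z p / ?w p"])
    moreover have "\<forall>i\<in>?I. v i = z i" using p wp by (auto simp: v_def J_def)
    ultimately show "\<exists>v\<in>V. \<forall>i\<in>?I. v i = z i" by blast
  next
    fix v assume v: "v \<in> V"
    have "(\<exists>t\<ge>0. (\<forall>i<l. v i = t * ?w i) \<and> (\<forall>i\<in>J. \<bar>v i\<bar> \<le> t * ?w i)) \<longleftrightarrow> Q v"
    proof
      assume "\<exists>t\<ge>0. (\<forall>i<l. v i = t * ?w i) \<and> (\<forall>i\<in>J. \<bar>v i\<bar> \<le> t * ?w i)"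
      then obtain t where t: "t \<ge> 0" "\<forall>i<l. v i = t * ?w i" "\<forall>i\<in>J. \<bar>v i\<bar> \<le> t * ?w i" by blast
      moreover have "v p / ?w p = t" using t(2) p wp by simp
      ultimately show "Q v" using wp p by (simp add: Q_def)
    next
      assume "Q v"
      then show "\<exists>t\<ge>0. (\<forall>i<l. v i = t * ?w i) \<and> (\<forall>i\<in>J. \<bar>v i\<bar> \<le> t * ?w i)"
        using vp[OF v] wp by (intro exI[of _ "v p / ?w p"]) (auto simp: Q_def)
    qed
    moreover have "Q (restrict v ?I) \<longleftrightarrow> Q v" by (simp add: Q_def)
    ultimately show "v \<in> N \<longleftrightarrow> Q (restrict v ?I)" using v by (simp add: N_def V_def J_def)
  next
    fix c :: real and z :: "nat \<Rightarrow> real" assume c: "c > 0" and z: "Q z"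
    show "Q (\<lambda>i\<in>?I. c * z i)"
      unfolding Q_def
    proof (intro conjI ballI)
      show "0 \<le> (\<lambda>i\<in>?I. c * z i) p" using c z by (simp add: Q_def)
      fix i assume i: "i \<in> J"
      then have "c * \<bar>z i\<bar> \<le> c * (z p / ?w p * ?w i)"
        using c z by (intro mult_left_mono) (auto simp: Q_def)
      then show "\<bar>(\<lambda>i\<in>?I. c * z i) i\<bar> \<le> (\<lambda>i\<in>?I. c * z i) p / ?w p * ?w i"
        using i c by (simp add: abs_mult)
    qed
  next
    fix v assume v: "v \<in> V"
    have "{..<n} = {..<l} \<union> J" "{..<l} \<inter> J = {}" using l by (auto simp: J_def)
    then have "(\<Sum>i<n. (v i)\<^sup>2) = (\<Sum>i<l. (v i)\<^sup>2) + (\<Sum>i\<in>J. (v i)\<^sup>2)"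
      by (simp add: sum.union_disjoint)
    also have "(\<Sum>i<l. (v i)\<^sup>2) = (\<Sum>i<l. (v p / ?w p)\<^sup>2 * (?w i)\<^sup>2)"
      unfolding power_mult_distrib[symmetric] using vp[OF v] by (intro sum.cong refl arg_cong[where f="\<lambda>x. x\<^sup>2"]) auto
    also have "\<dots> = (v p / ?w p)\<^sup>2 * S" by (simp only: S_def sum_distrib_left)
    also have "\<dots> = (v p)\<^sup>2 * S / (?w p)\<^sup>2" by (simp add: power_divide)
    finally have "exp (- (\<Sum>i<n. (v i)\<^sup>2) / 2) = exp (- (\<Sum>i\<in>J. (v i)\<^sup>2) / 2) * exp (- (v p)\<^sup>2 * S / (2 * (?w p)\<^sup>2))"
      by (simp add: exp_add[symmetric] add_divide_distrib)
    then show "exp (- (\<Sum>i<n. (v i)\<^sup>2) / 2) = sqrt (2 * pi) ^ card J * H (restrict v ?I)"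
      unfolding std_normal_prod[OF J] H_def by (simp add: mult.assoc)
  qed (use Qm Hm in auto)
  also have "(\<integral>\<^sup>+z. ennreal (H z) \<partial>lebn ?I) = ennreal (sqrt (2 * pi) * (?w p / sqrt S))"
  proof -
    \<comment> \<open>The weight factorises: in coordinate \<open>p\<close> it is an unnormalised
      Gaussian of standard deviation \<open>?w p / sqrt S\<close>, in \<open>J\<close> a probability
      density.\<close>
    have "(\<integral>\<^sup>+z. ennreal (H z) \<partial>lebn ?I) = (\<integral>\<^sup>+z. (\<Prod>i\<in>?I. ennreal (if i = p then exp (- (z i)\<^sup>2 / (2 * (?w p / sqrt S)\<^sup>2)) else std_normal_density (z i))) \<partial>lebn ?I)"
    proof (rule nn_integral_cong)
      fix z :: "nat \<Rightarrow> real"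
      have "(\<Prod>i\<in>?I. if i = p then exp (- (z i)\<^sup>2 / (2 * (?w p / sqrt S)\<^sup>2)) else std_normal_density (z i)) = H z"
        using p S by (auto simp: H_def power_divide mult.commute intro!: arg_cong2[where f="(*)"] prod.cong)
      then show "ennreal (H z) = (\<Prod>i\<in>?I. ennreal (if i = p then exp (- (z i)\<^sup>2 / (2 * (?w p / sqrt S)\<^sup>2)) else std_normal_density (z i)))"
        by (subst prod_ennreal) auto
    qed
    also have "\<dots> = (\<Prod>i\<in>?I. \<integral>\<^sup>+y. ennreal (if i = p then exp (- y\<^sup>2 / (2 * (?w p / sqrt S)\<^sup>2)) else std_normal_density y) \<partial>lborel)"
      by (rule lborel_product.product_nn_integral_prod) (auto intro!: measurable_If)
    also have "\<dots> = (\<integral>\<^sup>+y. ennreal (exp (- y\<^sup>2 / (2 * (?w p / sqrt S)\<^sup>2))) \<partial>lborel) * (\<Prod>i\<in>J. 1)"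
    proof -
      have "(\<integral>\<^sup>+y. ennreal (if i = p then exp (- y\<^sup>2 / (2 * (?w p / sqrt S)\<^sup>2)) else std_normal_density y) \<partial>lborel) = 1"
        if "i \<in> J" for i
      proof -
        have "i \<noteq> p" using that p(3) by auto
        then show ?thesis using nn_integral_normal_density[of 1 0] by simp
      qed
      then show ?thesis using p by simp
    qed
    finally show ?thesis using nn_integral_exp_gaussian[of "?w p / sqrt S"] wp S by simp
  qed
  \<comment> \<open>Coordinate \<open>p\<close> is integrated last, since it determines the
    intervals of the coordinates in \<open>J\<close>.\<close>
  also have "(\<integral>\<^sup>+z. ennreal (H z) * indicator {z. Q z} z \<partial>lebn ?I)
    = (\<integral>\<^sup>+y. (\<integral>\<^sup>+z. ennreal (H (z(p := y))) * indicator {z. Q z} (z(p := y)) \<partial>lebn J) \<partial>lborel)"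
    by (rule lborel_product.product_nn_integral_insert_rev[OF J p(3)]) measurable
  also have "\<dots> = (\<integral>\<^sup>+y. ennreal (exp (- y\<^sup>2 * S / (2 * (?w p)\<^sup>2)) * (\<Prod>i\<in>J. erf (y / (sqrt 2 * ?w p) * ?w i))) * indicator {0..} y \<partial>lborel)"
  proof (rule nn_integral_cong)
    fix y :: real
    show "(\<integral>\<^sup>+z. ennreal (H (z(p := y))) * indicator {z. Q z} (z(p := y)) \<partial>lebn J)
       = ennreal (exp (- y\<^sup>2 * S / (2 * (?w p)\<^sup>2)) * (\<Prod>i\<in>J. erf (y / (sqrt 2 * ?w p) * ?w i))) * indicator {0..} y"
    proof (cases "y \<ge> 0")
      case False
      then have "indicator {z. Q z} (z(p := y)) = (0::ennreal)" for z by (simp add: Q_def)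
      then show ?thesis using False by simp
    next
      case True
      let ?a = "\<lambda>i. y / ?w p * ?w i"
      have a: "?a i \<ge> 0" "?a i / sqrt 2 = y / (sqrt 2 * ?w p) * ?w i" if "i \<in> J" for i
        using that True wp w[of i] by (auto simp: J_def less_imp_le)
      have e0: "erf (?a i / sqrt 2) \<ge> 0" if "i \<in> J" for i
        by (intro erf_nonneg divide_nonneg_nonneg a(1) that) simp
      have "ennreal (H (z(p := y))) * indicator {z. Q z} (z(p := y))
        = ennreal (exp (- y\<^sup>2 * S / (2 * (?w p)\<^sup>2))) * (\<Prod>i\<in>J. ennreal (std_normal_density (z i)) * indicator {- ?a i..?a i} (z i))" for z
      proof -
        have *: "(z(p := y)) i = z i" if "i \<in> J" for i using that p(3) by auto
        have "H (z(p := y)) = exp (- y\<^sup>2 * S / (2 * (?w p)\<^sup>2)) * (\<Prod>i\<in>J. std_normal_density (z i))"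
          using * by (simp add: H_def mult.commute)
        then have "ennreal (H (z(p := y))) = ennreal (exp (- y\<^sup>2 * S / (2 * (?w p)\<^sup>2))) * (\<Prod>i\<in>J. ennreal (std_normal_density (z i)))"
          by (simp add: ennreal_mult prod_nonneg prod_ennreal)
        moreover have "indicator {z. Q z} (z(p := y)) = (\<Prod>i\<in>J. indicator {- ?a i..?a i} (z i) :: ennreal)"
        proof -
          have Qi: "Q (z(p := y)) \<longleftrightarrow> (\<forall>i\<in>J. z i \<in> {- ?a i..?a i})"
            unfolding Q_def using True * by (auto simp: abs_le_iff)
          show ?thesis
          proof (cases "\<forall>i\<in>J. z i \<in> {- ?a i..?a i}")
            case True
            then have "(\<Prod>i\<in>J. indicator {- ?a i..?a i} (z i) :: ennreal) = 1" by (intro prod.neutral) auto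
            then show ?thesis using True Qi by simp
          next
            case False
            then obtain i where "i \<in> J" "z i \<notin> {- ?a i..?a i}" by blast
            then have "(\<Prod>i\<in>J. indicator {- ?a i..?a i} (z i) :: ennreal) = 0" by (intro prod_zero) (auto intro!: bexI[of _ i])
            then show ?thesis using False Qi by simp
          qed
        qed
        ultimately show ?thesis by (simp only: prod.distrib mult.assoc)
      qed
      then have "(\<integral>\<^sup>+z. ennreal (H (z(p := y))) * indicator {z. Q z} (z(p := y)) \<partial>lebn J)
        = (\<integral>\<^sup>+z. ennreal (exp (- y\<^sup>2 * S / (2 * (?w p)\<^sup>2))) * (\<Prod>i\<in>J. ennreal (std_normal_density (z i)) * indicator {- ?a i..?a i} (z i)) \<partial>lebn J)"
        by simp
      also have "\<dots> = ennreal (exp (- y\<^sup>2 * S / (2 * (?w p)\<^sup>2))) * (\<integral>\<^sup>+z. (\<Prod>i\<in>J. ennreal (std_normal_density (z i)) * indicator {- ?a i..?a i} (z i)) \<partial>lebn J)"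
      proof (rule nn_integral_cmult)
        define h where "h i x = ennreal (std_normal_density x) * indicator {- ?a i..?a i} x" for i x
        have hm: "h i \<in> borel_measurable lborel" for i unfolding h_def by measurable
        have "(\<lambda>z. \<Prod>i\<in>J. h i (z i)) \<in> borel_measurable (lebn J)" using hm by measurable
        then show "(\<lambda>z. \<Prod>i\<in>J. ennreal (std_normal_density (z i)) * indicator {- ?a i..?a i} (z i)) \<in> borel_measurable (lebn J)"
          by (simp add: h_def)
      qed
      also have "(\<integral>\<^sup>+z. (\<Prod>i\<in>J. ennreal (std_normal_density (z i)) * indicator {- ?a i..?a i} (z i)) \<partial>lebn J)
        = (\<Prod>i\<in>J. \<integral>\<^sup>+x. ennreal (std_normal_density x) * indicator {- ?a i..?a i} x \<partial>lborel)"
        by (rule lborel_product.product_nn_integral_prod) auto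
      also have "\<dots> = (\<Prod>i\<in>J. ennreal (erf (?a i / sqrt 2)))"
        using a(1) by (intro prod.cong refl nn_integral_std_normal_symmetric_interval)
      also have "\<dots> = ennreal (\<Prod>i\<in>J. erf (?a i / sqrt 2))"
        by (intro prod_ennreal e0)
      also have "(\<Prod>i\<in>J. erf (?a i / sqrt 2)) = (\<Prod>i\<in>J. erf (y / (sqrt 2 * ?w p) * ?w i))"
        by (intro prod.cong refl arg_cong[where f=erf] a(2))
      also have "ennreal (exp (- y\<^sup>2 * S / (2 * (?w p)\<^sup>2))) * ennreal \<dots> = ennreal (exp (- y\<^sup>2 * S / (2 * (?w p)\<^sup>2)) * \<dots>)"
        by (rule ennreal_mult'[symmetric]) simp
      moreover have "indicator {0..} y = (1::ennreal)" using True by simp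
      ultimately show ?thesis by (simp only: mult_1_right)
    qed
  qed
  \<comment> \<open>Substitution \<open>y = sqrt 2 * ?w p * x\<close>.\<close>
  also have "\<dots> = ennreal \<bar>sqrt 2 * ?w p\<bar> * (\<integral>\<^sup>+x. ennreal (exp (- (0 + sqrt 2 * ?w p * x)\<^sup>2 * S / (2 * (?w p)\<^sup>2)) * (\<Prod>i\<in>J. erf ((0 + sqrt 2 * ?w p * x) / (sqrt 2 * ?w p) * ?w i))) * indicator {0..} (0 + sqrt 2 * ?w p * x) \<partial>lborel)"
  proof (rule nn_integral_real_affine)
    have [measurable]: "(\<lambda>y. erf (max 0 (y / (sqrt 2 * ?w p) * ?w i))) \<in> borel_measurable borel" for i
      by (rule measurable_compose[OF _ borel_measurable_erf_max]) simp
    have "(\<lambda>y. ennreal (exp (- y\<^sup>2 * S / (2 * (?w p)\<^sup>2)) * (\<Prod>i\<in>J. erf (max 0 (y / (sqrt 2 * ?w p) * ?w i)))) * indicator {0..} y) \<in> borel_measurable borel"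
      by measurable
    moreover have "ennreal (exp (- y\<^sup>2 * S / (2 * (?w p)\<^sup>2)) * (\<Prod>i\<in>J. erf (max 0 (y / (sqrt 2 * ?w p) * ?w i)))) * indicator {0..} y
      = ennreal (exp (- y\<^sup>2 * S / (2 * (?w p)\<^sup>2)) * (\<Prod>i\<in>J. erf (y / (sqrt 2 * ?w p) * ?w i))) * indicator {0..} y" for y
    proof (cases "y \<ge> 0")
      case True
      have "max 0 (y / (sqrt 2 * ?w p) * ?w i) = y / (sqrt 2 * ?w p) * ?w i" if "i \<in> J" for i
        using that True wp w[of i] by (auto simp: J_def less_imp_le max_def)
      then show ?thesis by (simp cong: prod.cong)
    qed simp
    ultimately show "(\<lambda>y. ennreal (exp (- y\<^sup>2 * S / (2 * (?w p)\<^sup>2)) * (\<Prod>i\<in>J. erf (y / (sqrt 2 * ?w p) * ?w i))) * indicator {0..} y) \<in> borel_measurable borel"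
      by simp
  qed (use wp in simp)
  also have "\<dots> = ennreal (sqrt 2 * ?w p) * (\<integral>\<^sup>+x. ennreal (exp (- x\<^sup>2 * S) * (\<Prod>i\<in>J. erf (x * ?w i))) * indicator {0..} x \<partial>lborel)" (is "_ = _ * ?R")
  proof -
    have "- (0 + sqrt 2 * ?w p * x)\<^sup>2 * S / (2 * (?w p)\<^sup>2) = - x\<^sup>2 * S" for x
      using wp by (simp add: power_mult_distrib)
    moreover have "(0 + sqrt 2 * ?w p * x) / (sqrt 2 * ?w p) = x" for x using wp by simp
    moreover have "indicator {0..} (0 + sqrt 2 * ?w p * x) = (indicator {0..} x :: ennreal)" for x
      using wp by (auto simp: indicator_def zero_le_mult_iff mult_le_0_iff)
    ultimately show ?thesis using wp by (simp only: abs_of_pos mult_pos_pos real_sqrt_gt_0_iff zero_less_numeral)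
  qed
  \<comment> \<open>Both sides are brought to carry the finite positive factor
    \<open>sqrt 2 * ?w p\<close>, which is then cancelled.\<close>
  finally have "ennreal (sqrt 2 * ?w p) * (ennreal (ball_frac n N V) * ennreal (sqrt pi / sqrt S)) = ennreal (sqrt 2 * ?w p) * ?R"
  proof -
    have "sqrt (2 * pi) * (?w p / sqrt S) = sqrt 2 * ?w p * (sqrt pi / sqrt S)"
      by (simp add: real_sqrt_mult)
    moreover have "ennreal (sqrt 2 * ?w p * (sqrt pi / sqrt S)) = ennreal (sqrt 2 * ?w p) * ennreal (sqrt pi / sqrt S)"
      by (rule ennreal_mult) (use wp S in auto)
    ultimately have "ennreal (sqrt (2 * pi) * (?w p / sqrt S)) = ennreal (sqrt 2 * ?w p) * ennreal (sqrt pi / sqrt S)"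
      by (simp only:)
    moreover assume "ennreal (ball_frac n N V) * ennreal (sqrt (2 * pi) * (?w p / sqrt S)) = ennreal (sqrt 2 * ?w p) * ?R"
    ultimately show ?thesis by (simp only: mult_ac)
  qed
  then show ?thesis
    unfolding ext S_def[symmetric] J_def[symmetric]
    by (subst (asm) ennreal_mult_cancel_left) (use wp in \<open>auto simp: not_le ennreal_eq_0_iff mult_le_0_iff\<close>)
qed

lemma ext_angle_pos:
  assumes w: "\<And>i. i < n \<Longrightarrow> wt f n i > 0" and l: "0 < l" "l \<le> n"
  shows "ext_angle n (wface f n l) (wpoly f n) > 0"
proof (rule ccontr)
  let ?g = "\<lambda>x. exp (- x\<^sup>2 * (\<Sum>i<l. (wt f n i)\<^sup>2)) * (\<Prod>i\<in>{l..<n}. erf (max 0 (x * wt f n i)))"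
  have [measurable]: "(\<lambda>x. erf (max 0 (x * wt f n i))) \<in> borel_measurable borel" for i
    by (rule measurable_compose[OF _ borel_measurable_erf_max]) simp
  have max: "max 0 (x * wt f n i) = x * wt f n i" if "x \<ge> 0" "i \<in> {l..<n}" for x i
    using that w[of i] by (auto simp: less_imp_le max_def)
  assume "\<not> ?thesis"
  then have "ennreal (ext_angle n (wface f n l) (wpoly f n)) = 0" by (simp add: ennreal_eq_0_iff)
  then have "(\<integral>\<^sup>+x. ennreal (exp (- x\<^sup>2 * (\<Sum>i<l. (wt f n i)\<^sup>2)) * (\<Prod>i\<in>{l..<n}. erf (x * wt f n i)))
         * indicator {0..} x \<partial>lborel) = 0"
    using ext_angle_formula[OF w l] by simp
  also have "(\<integral>\<^sup>+x. ennreal (exp (- x\<^sup>2 * (\<Sum>i<l. (wt f n i)\<^sup>2)) * (\<Prod>i\<in>{l..<n}. erf (x * wt f n i)))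
         * indicator {0..} x \<partial>lborel) = (\<integral>\<^sup>+x. ennreal (?g x) * indicator {0..} x \<partial>lborel)"
  proof (rule nn_integral_cong)
    fix x :: real
    have "(\<Prod>i\<in>{l..<n}. erf (x * wt f n i)) = (\<Prod>i\<in>{l..<n}. erf (max 0 (x * wt f n i)))" if "x \<ge> 0"
      using max[OF that] by (intro prod.cong) auto
    then show "ennreal (exp (- x\<^sup>2 * (\<Sum>i<l. (wt f n i)\<^sup>2)) * (\<Prod>i\<in>{l..<n}. erf (x * wt f n i))) * indicator {0..} x
      = ennreal (?g x) * indicator {0..} x"
      by (cases "x \<ge> 0") auto
  qed
  finally have "AE x in lborel. ennreal (?g x) * indicator {0..} x = 0"
    by (subst (asm) nn_integral_0_iff_AE) measurable
  \<comment> \<open>Away from 0 every \<open>erf\<close> factor is positive, so the integrand could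
    not vanish almost everywhere on \<open>{1..2}\<close>.\<close>
  then have "AE x in lborel. x \<notin> {1..2::real}"
  proof eventually_elim
    case (elim x)
    show ?case
    proof
      assume x: "x \<in> {1..2}"
      then have i1: "indicator {0..} x = (1::ennreal)" by simp
      have "?g x > 0"
        using x w by (intro mult_pos_pos prod_pos ballI) (auto simp: max intro!: erf_pos)
      moreover have "ennreal (?g x) = 0" using elim unfolding i1 by (simp only: mult_1_right)
      ultimately show False by (metis ennreal_eq_0_iff not_less)
    qed
  qed
  then have "emeasure lborel {1..2::real} = 0" by (intro null_setsD1 AE_iff_null_sets[THEN iffD2]) auto
  then show False by simp
qed

text \<open>A Gaussian majorant reduces the one-dimensional integral to
  \<open>sqrt pi / sqrt c\<close>. Extending it from the half-line to the whole line costs a factor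
  2, invisible on the exponential scale.\<close>

lemma ext_angle_le:
  assumes w: "\<And>i. i < n \<Longrightarrow> wt f n i > 0" and l: "0 < l" "l \<le> n" and c: "c > 0"
    and bound: "\<And>x. x > 0 \<Longrightarrow>
      exp (- x\<^sup>2 * (\<Sum>i<l. (wt f n i)\<^sup>2)) * (\<Prod>i\<in>{l..<n}. erf (x * wt f n i)) \<le> A * exp (- c * x\<^sup>2)"
  shows "ext_angle n (wface f n l) (wpoly f n) \<le> A * sqrt (\<Sum>i<l. (wt f n i)\<^sup>2) / sqrt c"
proof -
  let ?S = "\<Sum>i<l. (wt f n i)\<^sup>2" and ?\<gamma> = "ext_angle n (wface f n l) (wpoly f n)"
  have S: "?S > 0"
    by (intro sum_pos) (use w l in \<open>auto simp: less_imp_neq[THEN not_sym]\<close>)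
  \<comment> \<open>The left side of the hypothesis is positive at \<open>x = 1\<close>, which
    forces \<open>A > 0\<close>.\<close>
  have "0 < exp (- 1\<^sup>2 * ?S) * (\<Prod>i\<in>{l..<n}. erf (1 * wt f n i))"
    using w by (intro mult_pos_pos prod_pos ballI) (auto intro!: erf_pos)
  also have "\<dots> \<le> A * exp (- c * 1\<^sup>2)" by (rule bound) simp
  finally have A: "A > 0" by (simp add: zero_less_mult_iff)
  have "ennreal ?\<gamma> * ennreal (sqrt pi / sqrt ?S)
    = (\<integral>\<^sup>+x. ennreal (exp (- x\<^sup>2 * ?S) * (\<Prod>i\<in>{l..<n}. erf (x * wt f n i))) * indicator {0..} x \<partial>lborel)"
    by (rule ext_angle_formula[OF w l])
  also have "\<dots> \<le> (\<integral>\<^sup>+x. ennreal A * ennreal (exp (- x\<^sup>2 / (2 * (1 / sqrt (2 * c))\<^sup>2))) \<partial>lborel)"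
  proof (rule nn_integral_mono_AE)
    have "AE x::real in lborel. x \<noteq> 0" by (rule AE_lborel_singleton)
    then show "AE x in lborel. ennreal (exp (- x\<^sup>2 * ?S) * (\<Prod>i\<in>{l..<n}. erf (x * wt f n i))) * indicator {0..} x
      \<le> ennreal A * ennreal (exp (- x\<^sup>2 / (2 * (1 / sqrt (2 * c))\<^sup>2)))"
    proof eventually_elim
      case (elim x)
      have "exp (- x\<^sup>2 / (2 * (1 / sqrt (2 * c))\<^sup>2)) = exp (- c * x\<^sup>2)"
        using c by (simp add: power_divide mult.commute)
      then show ?case
        using elim bound[of x] A by (cases "x > 0") (auto simp: ennreal_mult[symmetric] intro!: ennreal_leI)
    qed
  qed
  also have "\<dots> = ennreal A * ennreal (sqrt (2 * pi) * (1 / sqrt (2 * c)))"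
    using c nn_integral_exp_gaussian[of "1 / sqrt (2 * c)"] by (subst nn_integral_cmult) auto
  also have "\<dots> = ennreal (A * (sqrt pi / sqrt c))"
  proof -
    have "sqrt (2 * pi) * (1 / sqrt (2 * c)) = sqrt pi / sqrt c" by (simp add: real_sqrt_mult)
    then show ?thesis using A c by (simp only: ennreal_mult[symmetric] less_imp_le divide_nonneg_nonneg
        real_sqrt_ge_zero pi_ge_zero)
  qed
  finally have "?\<gamma> * (sqrt pi / sqrt ?S) \<le> A * (sqrt pi / sqrt c)"
    using ext_angle_pos[OF w l] S A c by (simp add: ennreal_mult[symmetric] less_imp_le)
  moreover have "?\<gamma> * (sqrt pi / sqrt ?S) * (sqrt ?S / sqrt pi) = ?\<gamma>" using S by simp
  moreover have "A * (sqrt pi / sqrt c) * (sqrt ?S / sqrt pi) = A * sqrt ?S / sqrt c" using S by simp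
  ultimately show ?thesis
    using S mult_right_mono[of "?\<gamma> * (sqrt pi / sqrt ?S)" "A * (sqrt pi / sqrt c)" "sqrt ?S / sqrt pi"]
    by (simp only: divide_nonneg_nonneg real_sqrt_ge_zero less_imp_le pi_ge_zero)
qed

section \<open>Asymptotics\<close>

text \<open>On each cell of length 1 / n an increasing function lies between its end values;
  induction on the right end adds up the cells.\<close>

lemma sum_left_le_integral:
  fixes g :: "real \<Rightarrow> real"
  assumes n: "n > 0" and kl: "k \<le> l"
    and cont: "continuous_on {real k / real n..real l / real n} g"
    and mono: "mono_on {real k / real n..real l / real n} g"
  shows "(\<Sum>i\<in>{k..<l}. g (real i / real n)) \<le> real n * integral {real k / real n..real l / real n} g"
    and "real n * integral {real k / real n..real l / real n} g \<le> (\<Sum>i\<in>{k..<l}. g (real (Suc i) / real n))"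
proof -
  let ?I = "\<lambda>l. integral {real k / real n..real l / real n} g"
  have "(\<Sum>i\<in>{k..<m}. g (real i / real n)) \<le> real n * ?I m \<and> real n * ?I m \<le> (\<Sum>i\<in>{k..<m}. g (real (Suc i) / real n))"
    if "k \<le> m" "m \<le> l" for m
    using that
  proof (induction m rule: dec_induct)
    case base
    then show ?case by simp
  next
    case (step m)
    let ?a = "real m / real n" and ?b = "real (Suc m) / real n"
    have le: "real k / real n \<le> ?a" "?a \<le> ?b" "?b \<le> real l / real n"
      using step n by (auto simp: divide_right_mono)
    have int: "g integrable_on {real k / real n..?b}"
      by (intro integrable_continuous_real continuous_on_subset[OF cont]) (use le in auto)
    have int': "g integrable_on {?a..?b}"
      by (rule integrable_on_subinterval[OF int]) (use le in auto)
    have comb: "?I (Suc m) = ?I m + integral {?a..?b} g"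
      using Henstock_Kurzweil_Integration.integral_combine[OF le(1,2) int] by simp
    have len: "real n * (?b - ?a) = 1" using n by (simp add: diff_divide_distrib[symmetric])
    have ga: "g ?a \<le> g u" "g u \<le> g ?b" if "u \<in> {?a..?b}" for u
      using that le by (auto intro!: mono_onD[OF mono])
    have "integral {?a..?b} (\<lambda>_. g ?a) \<le> integral {?a..?b} g"
      by (intro integral_le int' ga) auto
    then have "(?b - ?a) * g ?a \<le> integral {?a..?b} g" using le by simp
    then have "real n * ((?b - ?a) * g ?a) \<le> real n * integral {?a..?b} g" by (intro mult_left_mono) auto
    then have 1: "g ?a \<le> real n * integral {?a..?b} g" using len by (simp only: mult.assoc[symmetric] mult_1_left)
    have "integral {?a..?b} g \<le> integral {?a..?b} (\<lambda>_. g ?b)"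
      by (intro integral_le int' ga) auto
    then have "integral {?a..?b} g \<le> (?b - ?a) * g ?b" using le by simp
    then have "real n * integral {?a..?b} g \<le> real n * ((?b - ?a) * g ?b)" by (intro mult_left_mono) auto
    then have 2: "real n * integral {?a..?b} g \<le> g ?b" using len by (simp only: mult.assoc[symmetric] mult_1_left)
    show ?case using step 1 2 unfolding comb by (simp add: distrib_left)
  qed
  then show "(\<Sum>i\<in>{k..<l}. g (real i / real n)) \<le> real n * ?I l"
    "real n * ?I l \<le> (\<Sum>i\<in>{k..<l}. g (real (Suc i) / real n))"
    using kl by auto
qed

text \<open>Right and left sums differ by a telescoping sum, so the error depends only on the values
  at the two end points and not on the number of cells.\<close>

lemma sum_right_le_integral:
  fixes g :: "real \<Rightarrow> real"
  assumes n: "n > 0" and kl: "k \<le> l"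
    and cont: "continuous_on {real k / real n..real l / real n} g"
    and mono: "mono_on {real k / real n..real l / real n} g"
  shows "(\<Sum>i\<in>{k..<l}. g (real (Suc i) / real n))
    \<le> real n * integral {real k / real n..real l / real n} g + g (real l / real n) - g (real k / real n)"
proof -
  have "(\<Sum>i\<in>{k..<l}. g (real (Suc i) / real n)) - (\<Sum>i\<in>{k..<l}. g (real i / real n)) = g (real l / real n) - g (real k / real n)"
    using sum_Suc_diff'[OF kl, of "\<lambda>i. g (real i / real n)"] by (simp add: sum_subtractf)
  then show ?thesis using sum_left_le_integral(1)[OF assms] by linarith
qed

text \<open>For a decreasing function the right sum already lies below the integral, without a
  boundary term.\<close>

lemma sum_right_le_integral_antimono:
  fixes g :: "real \<Rightarrow> real"
  assumes n: "n > 0" and kl: "k \<le> l"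
    and cont: "continuous_on {real k / real n..real l / real n} g"
    and mono: "antimono_on {real k / real n..real l / real n} g"
  shows "(\<Sum>i\<in>{k..<l}. g (real (Suc i) / real n)) \<le> real n * integral {real k / real n..real l / real n} g"
proof -
  have "real n * integral {real k / real n..real l / real n} (\<lambda>x. - g x) \<le> (\<Sum>i\<in>{k..<l}. - g (real (Suc i) / real n))"
    by (rule sum_left_le_integral(2)[OF n kl])
      (use cont mono in \<open>auto intro!: continuous_intros simp: monotone_on_def\<close>)
  then show ?thesis by (simp add: sum_negf)
qed

section \<open>The logarithmic moment generating function and its minimisation\<close>

lemma lam_mono:
  assumes "s \<le> t"
  shows "lam s \<le> lam t"
proof -
  have "ennreal (exp (lam s) / 2) \<le> ennreal (exp (lam t) / 2)"
    unfolding nn_integral_std_normal_exp_half_line[symmetric]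
  proof (rule nn_integral_mono)
    fix y :: real
    show "ennreal (std_normal_density y * exp (s * y)) * indicator {0..} y
        \<le> ennreal (std_normal_density y * exp (t * y)) * indicator {0..} y"
    \<comment> \<open>Monotonicity in the exponent holds because only nonnegative \<open>y\<close>
      contribute.\<close>
    proof (cases "y \<ge> 0")
      case True
      then have "s * y \<le> t * y" using assms by (intro mult_right_mono)
      then show ?thesis using True by (auto intro!: ennreal_leI mult_left_mono)
    qed simp
  qed
  then show ?thesis by simp
qed

text \<open>With weights normalised to mass one, Hoelder's inequality reduces to convexity of exp.\<close>

lemma convex_on_lam: "convex_on UNIV lam"
proof (rule convex_onI)
  fix t x y :: real assume t: "t > 0" "t < 1"
  let ?F = "\<lambda>s. \<integral>\<^sup>+g. ennreal (std_normal_density g * exp (s * g)) * indicator {0..} g \<partial>lborel"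
  let ?z = "(1 - t) * x + t * y" and ?L = "(1 - t) * lam x + t * lam y"
  \<comment> \<open>\<open>a\<close> and \<open>b\<close> absorb the normalisations
    \<open>exp (- lam x)\<close> and \<open>exp (- lam y)\<close> and the common factor
    \<open>exp ?L\<close>, so that the majorant integrates to exactly
    \<open>exp ?L / 2\<close>.\<close>
  define a where "a = exp ?L * (1 - t) * exp (- lam x)"
  define b where "b = exp ?L * t * exp (- lam y)"
  have ab: "a \<ge> 0" "b \<ge> 0" using t by (auto simp: a_def b_def)
  have "?F ?z \<le> (\<integral>\<^sup>+g. ennreal a * (ennreal (std_normal_density g * exp (x * g)) * indicator {0..} g)
     + ennreal b * (ennreal (std_normal_density g * exp (y * g)) * indicator {0..} g) \<partial>lborel)"
  proof (rule nn_integral_mono)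
    fix g :: real
    have "exp ((1 - t) *\<^sub>R (x * g - lam x) + t *\<^sub>R (y * g - lam y)) \<le> (1 - t) * exp (x * g - lam x) + t * exp (y * g - lam y)"
      using t by (intro convex_onD[OF exp_convex]) auto
    then have "exp ?L * exp ((1 - t) * (x * g - lam x) + t * (y * g - lam y))
      \<le> exp ?L * ((1 - t) * exp (x * g - lam x) + t * exp (y * g - lam y))"
      by (intro mult_left_mono) auto
    also have "exp ?L * exp ((1 - t) * (x * g - lam x) + t * (y * g - lam y)) = exp (?z * g)"
      unfolding exp_add[symmetric] by (simp add: algebra_simps)
    also have "exp ?L * ((1 - t) * exp (x * g - lam x) + t * exp (y * g - lam y)) = a * exp (x * g) + b * exp (y * g)"
      by (simp add: a_def b_def exp_diff exp_minus field_simps)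
    finally have "std_normal_density g * exp (?z * g) \<le> std_normal_density g * (a * exp (x * g) + b * exp (y * g))"
      by (intro mult_left_mono) auto
    also have "\<dots> = a * (std_normal_density g * exp (x * g)) + b * (std_normal_density g * exp (y * g))"
      by (simp add: algebra_simps)
    finally have "ennreal (std_normal_density g * exp (?z * g)) \<le> ennreal a * ennreal (std_normal_density g * exp (x * g)) + ennreal b * ennreal (std_normal_density g * exp (y * g))"
      using ab by (simp add: ennreal_mult[symmetric] ennreal_plus[symmetric] ennreal_leI del: ennreal_plus)
    then show "ennreal (std_normal_density g * exp (?z * g)) * indicator {0..} g
      \<le> ennreal a * (ennreal (std_normal_density g * exp (x * g)) * indicator {0..} g)
       + ennreal b * (ennreal (std_normal_density g * exp (y * g)) * indicator {0..} g)"
      by (cases "g \<ge> 0") auto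
  qed
  also have "\<dots> = ennreal a * ?F x + ennreal b * ?F y"
    by (subst nn_integral_add) (auto simp: nn_integral_cmult)
  also have "\<dots> = ennreal (a * (exp (lam x) / 2) + b * (exp (lam y) / 2))"
    unfolding nn_integral_std_normal_exp_half_line using ab by (simp add: ennreal_mult[symmetric] ennreal_plus[symmetric] del: ennreal_plus)
  also have "a * (exp (lam x) / 2) + b * (exp (lam y) / 2) = exp ?L / 2"
    by (simp add: a_def b_def exp_minus field_simps)
  finally have "exp (lam ?z) \<le> exp ?L"
    unfolding nn_integral_std_normal_exp_half_line by simp
  then show "lam ((1 - t) *\<^sub>R x + t *\<^sub>R y) \<le> ?L" by simp
qed simp

lemma continuous_on_lam: "continuous_on A lam"
  using convex_on_continuous[OF open_UNIV convex_on_lam] continuous_on_subset by blast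

text \<open>First-order optimality at a minimiser, without differentiability: the supporting line of
  \<open>J\<close> at \<open>s\<close> has slope \<open>- c * s\<close>.\<close>

lemma quadratic_plus_convex_minimiser:
  fixes J :: "real \<Rightarrow> real"
  assumes c: "c > 0" and J: "convex_on UNIV J" "mono J"
  shows "\<exists>s\<le>0. \<forall>x. J x - J s \<ge> - c * s * (x - s)"
proof -
  define h where "h s = c * s\<^sup>2 / 2 + J s" for s
  define D where "D = J 1 - J 0"
  have D: "D \<ge> 0" using J(2) by (simp add: D_def mono_def)
  \<comment> \<open>For \<open>x < 0\<close> convexity gives \<open>J x \<ge> J 0 + x * D\<close>,
    so the quadratic term wins once \<open>- x \<ge> 2 * D / c\<close>; for \<open>x > 0\<close>
    monotonicity gives \<open>h x \<ge> h 0\<close>. A minimiser over \<open>{-M..0}\<close> is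
    therefore global.\<close>
  define M where "M = 2 * D / c"
  have M: "M \<ge> 0" using D c by (simp add: M_def)
  have "continuous_on UNIV J" by (rule convex_on_continuous[OF open_UNIV J(1)])
  then have "continuous_on {-M..0} h" unfolding h_def
    by (intro continuous_intros) (auto intro: continuous_on_subset)
  then obtain s where s: "s \<in> {-M..0}" "\<And>x. x \<in> {-M..0} \<Longrightarrow> h s \<le> h x"
    using continuous_attains_inf[of "{-M..0}" h] M by auto
  have min: "h s \<le> h x" for x
  proof -
    consider "x \<in> {-M..0}" | "x > 0" | "x < - M" by force
    then show ?thesis
    proof cases
      case 1
      then show ?thesis by (rule s)
    next
      case 2
      have "h s \<le> h 0" using s M by simp
      also have "h 0 \<le> h x" using 2 c J(2) by (simp add: h_def mono_def add_increasing)
      finally show ?thesis .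
    next
      case 3
      then have x: "x < 0" using M by simp
      have "J 0 \<le> (1 - (- x) / (1 - x)) * J x + (- x) / (1 - x) * J 1"
      proof -
        \<comment> \<open>The weight of 1 when 0 is written as a convex combination of
          \<open>x\<close> and 1.\<close>
        define u where "u = (- x) / (1 - x)"
        have u: "0 \<le> u" "u \<le> 1" using x by (auto simp: u_def divide_simps)
        have "(1 - u) *\<^sub>R x + u *\<^sub>R 1 = 0"
          using x by (simp add: u_def field_simps)
        then show ?thesis using convex_onD[OF J(1) u, of x 1] unfolding u_def by simp
      qed
      also have "1 - (- x) / (1 - x) = 1 / (1 - x)" using x by (simp add: field_simps)
      also have "1 / (1 - x) * J x + (- x) / (1 - x) * J 1 = (J x - x * J 1) / (1 - x)"
        by (simp add: diff_divide_distrib)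
      finally have "J x \<ge> J 0 + x * D" using x by (simp add: D_def field_simps)
      moreover have "c * x\<^sup>2 / 2 + x * D \<ge> 0"
      proof -
        have "c * (- x) \<ge> 2 * D" using 3 c by (simp add: M_def field_simps)
        then have "(c * (- x)) * (- x) \<ge> 2 * D * (- x)" using x by (intro mult_right_mono) auto
        then show ?thesis by (simp add: power2_eq_square algebra_simps)
      qed
      moreover have "h s \<le> h 0" using s M by simp
      ultimately show ?thesis by (simp add: h_def)
    qed
  qed
  have "J x - J s \<ge> - c * s * (x - s)" for x
  proof (rule ccontr)
    define d where "d = x - s"
    define A where "A = - (J x - J s + c * s * d)"
    define B where "B = c * d\<^sup>2 / 2"
    assume "\<not> ?thesis"
    then have A: "A > 0" by (simp add: A_def d_def)
    have B: "B \<ge> 0" using c by (simp add: B_def)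
    \<comment> \<open>Moving from \<open>s\<close> towards \<open>x\<close> by a fraction
      \<open>t\<close> would lower \<open>h\<close> by \<open>t * A\<close> to first order at a
      second-order cost \<open>B * t^2\<close>; minimality forbids a net gain.\<close>
    have key: "A \<le> B * t" if t: "0 < t" "t < 1" for t
    proof -
      have e: "(1 - t) *\<^sub>R s + t *\<^sub>R x = s + t * d" by (simp add: d_def algebra_simps)
      have "J (s + t * d) \<le> (1 - t) * J s + t * J x"
        using convex_onD[OF J(1), of t s x] t unfolding e by simp
      moreover have "h s \<le> h (s + t * d)" by (rule min)
      ultimately have "t * (J x - J s) \<ge> - (c * (2 * s * (t * d) + (t * d)\<^sup>2) / 2)"
        by (simp add: h_def power2_eq_square algebra_simps add_divide_distrib)
      then have "t * A \<le> t * (B * t)"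
        by (simp add: A_def B_def power2_eq_square algebra_simps add_divide_distrib)
      then show ?thesis using t by simp
    qed
    \<comment> \<open>Small enough that \<open>B * t < A\<close>, and below 1.\<close>
    define t where "t = min (1 / 2) (A / (2 * (B + 1)))"
    have "t > 0" "t < 1" using A B by (auto simp: t_def)
    from key[OF this] have "A \<le> B * t" .
    also have "\<dots> \<le> B * (A / (2 * (B + 1)))" using B by (intro mult_left_mono) (auto simp: t_def)
    also have "\<dots> < A" using A B by (simp add: field_simps add_nonneg_pos)
    finally show False by simp
  qed
  then show ?thesis using s(1) by auto
qed

section \<open>Passage to the limit\<close>

lemma LBINT_eq_integral:
  fixes g :: "real \<Rightarrow> real"
  assumes "a \<le> b" "continuous_on {a..b} g"
  shows "(LBINT u=a..b. g u) = integral {a..b} g"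
  using assms by (intro interval_integral_eq_integral borel_integrable_atLeastAtMost')

text \<open>In both angles the only unbounded error is a factor \<open>sqrt n\<close>, coming from
  the square root of a sum of squared weights.\<close>

lemma eventually_log_over_n_less:
  fixes K \<epsilon> :: real
  assumes "\<epsilon> > 0"
  shows "\<exists>n0. \<forall>n>n0. (K + ln (real n) / 2) / real n < \<epsilon>"
proof -
  have "((\<lambda>n::nat. (K + ln (real n) / 2) / real n) \<longlongrightarrow> 0) at_top" by real_asymp
  then have "eventually (\<lambda>n. (K + ln (real n) / 2) / real n < \<epsilon>) at_top"
    using assms by (rule order_tendstoD)
  then obtain N where "\<forall>n\<ge>N. (K + ln (real n) / 2) / real n < \<epsilon>"
    unfolding eventually_at_top_linorder by blast
  then show ?thesis by (intro exI[of _ N]) auto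
qed

locale weight_function =
  fixes f :: "real \<Rightarrow> real"
  assumes cont: "continuous_on {0..1} f"
    and mono: "mono_on {0..1} f"
    and nonneg: "\<forall>u\<in>{0..1}. f u \<ge> 0"
    and pos: "\<forall>u\<in>{0<..1}. f u > 0"
begin

lemma wt_pos: "i < n \<Longrightarrow> wt f n i > 0"
  using pos by (auto simp: wt_def)

lemma f_le: "0 \<le> x \<Longrightarrow> x \<le> y \<Longrightarrow> y \<le> 1 \<Longrightarrow> f x \<le> f y"
  using mono by (auto simp: mono_on_def)

lemma wt_le: "i < n \<Longrightarrow> wt f n i \<le> f 1"
  by (auto simp: wt_def intro!: f_le)

lemma cont_sub: "0 \<le> a \<Longrightarrow> b \<le> 1 \<Longrightarrow> continuous_on {a..b} f"
  using continuous_on_subset[OF cont] by auto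

lemma mono_square: "0 \<le> a \<Longrightarrow> b \<le> 1 \<Longrightarrow> mono_on {a..b} (\<lambda>u. (f u)\<^sup>2)"
  using nonneg by (intro mono_onI power_mono f_le) auto

lemma integral_square_pos:
  assumes "0 < a" "a \<le> 1"
  shows "integral {0..a} (\<lambda>u. (f u)\<^sup>2) > 0"
proof -
  have c: "continuous_on {0..a} (\<lambda>u. (f u)\<^sup>2)" using assms by (intro continuous_intros cont_sub) auto
  \<comment> \<open>\<open>f\<close> may vanish at 0, so the lower bound is taken from the upper
    half of the interval.\<close>
  have "f (a / 2) > 0" using assms pos by auto
  then have "0 < (a - a / 2) * (f (a / 2))\<^sup>2" using assms by simp
  also have "\<dots> = integral {a / 2..a} (\<lambda>_. (f (a / 2))\<^sup>2)" using assms by simp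
  also have "\<dots> \<le> integral {a / 2..a} (\<lambda>u. (f u)\<^sup>2)"
    using assms nonneg
    by (intro integral_le integrable_continuous_real continuous_on_const continuous_on_subset[OF c] power_mono f_le) auto
  also have "\<dots> \<le> integral {0..a} (\<lambda>u. (f u)\<^sup>2)"
    using assms by (intro integral_subset_le integrable_continuous_real c continuous_on_subset[OF c]) auto
  finally show ?thesis .
qed

lemma sum_square_le:
  assumes "l \<le> n"
  shows "(\<Sum>i<l. (wt f n i)\<^sup>2) \<le> real n * (f 1)\<^sup>2"
proof -
  have "(\<Sum>i<l. (wt f n i)\<^sup>2) \<le> (\<Sum>i<l. (f 1)\<^sup>2)"
    using assms wt_pos wt_le by (intro sum_mono power_mono) (auto simp: less_imp_le)
  also have "\<dots> \<le> real n * (f 1)\<^sup>2" using assms by (simp add: mult_right_mono)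
  finally show ?thesis .
qed

text \<open>The Chernoff parameter is fixed once, independently of n, as a minimiser of
  \<open>c1 * s^2 / 2 + J s\<close>, where \<open>J\<close> is c_0 times the function \<lambda>_0.
  The powers of 1/2 account for the term with \<open>ln 2\<close>. It remains to bound the resulting
  exponent \<open>h\<close> by \<open>psi_int\<close>, for which evaluating \<eta> at a single point
  suffices.\<close>

lemma int_angle_exponent:
  assumes d: "0 < \<delta>" "\<delta> < \<tau>" "\<tau> < 1" and eps: "\<epsilon> > 0"
  shows "\<exists>n0::nat. \<forall>n>n0. \<forall>k l::nat. real k = \<delta> * real n \<and> real l = \<tau> * real n \<longrightarrow>
    ereal (ln (int_angle n (wface f n k) (wface f n l)) / real n) < psi_int f \<delta> \<tau> + ereal \<epsilon>"
proof -
  define c0 where "c0 = integral {\<delta>..\<tau>} f"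
  define c1 where "c1 = integral {0..\<delta>} (\<lambda>u. (f u)\<^sup>2)"
  define J where "J s = integral {\<delta>..\<tau>} (\<lambda>u. lam (s * f u))" for s
  have f\<delta>: "f \<delta> > 0" using pos d by simp
  have f1: "f 1 > 0" using pos by simp
  have fc: "continuous_on {\<delta>..\<tau>} f" using d by (intro cont_sub) auto
  have f2c: "continuous_on {0..\<delta>} (\<lambda>u. (f u)\<^sup>2)" using d by (intro continuous_intros cont_sub) auto
  have f0: "f u \<ge> 0" if "u \<in> {\<delta>..\<tau>}" for u using nonneg that d by auto
  have "0 < (\<tau> - \<delta>) * f \<delta>" using d f\<delta> by simp
  also have "\<dots> = integral {\<delta>..\<tau>} (\<lambda>_. f \<delta>)" using d by simp
  also have "\<dots> \<le> c0" unfolding c0_def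
    using d by (intro integral_le integrable_continuous_real fc continuous_intros f_le) auto
  finally have c0: "c0 > 0" .
  have c1: "c1 > 0" unfolding c1_def using d by (intro integral_square_pos) auto
  have lc: "continuous_on {\<delta>..\<tau>} (\<lambda>u. lam (s * f u))" for s
    by (rule continuous_on_compose2[OF continuous_on_lam[of UNIV]]) (auto intro!: continuous_intros fc)
  then have li: "(\<lambda>u. lam (s * f u)) integrable_on {\<delta>..\<tau>}" for s by (rule integrable_continuous_real)
  have Jmono: "mono J"
    unfolding J_def by (intro monoI integral_le li lam_mono mult_right_mono f0)
  have Jconv: "convex_on UNIV J"
  proof (rule convex_onI)
    fix t x y :: real assume t: "t > 0" "t < 1"
    have "J ((1 - t) *\<^sub>R x + t *\<^sub>R y) \<le> integral {\<delta>..\<tau>} (\<lambda>u. (1 - t) * lam (x * f u) + t * lam (y * f u))"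
      unfolding J_def
    proof (intro integral_le li integrable_add integrable_on_mult_right)
      fix u
      have "((1 - t) *\<^sub>R x + t *\<^sub>R y) * f u = (1 - t) *\<^sub>R (x * f u) + t *\<^sub>R (y * f u)"
        by (simp add: algebra_simps)
      then show "lam (((1 - t) *\<^sub>R x + t *\<^sub>R y) * f u) \<le> (1 - t) * lam (x * f u) + t * lam (y * f u)"
        using convex_onD[OF convex_on_lam, of t "x * f u" "y * f u"] t by simp
    qed
    also have "\<dots> = (1 - t) * J x + t * J y"
      unfolding J_def by (simp add: integral_add integrable_on_mult_right li)
    finally show "J ((1 - t) *\<^sub>R x + t *\<^sub>R y) \<le> (1 - t) * J x + t * J y" .
  qed simp
  obtain s where s: "s \<le> 0" "\<And>x. J x - J s \<ge> - c1 * s * (x - s)"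
    using quadratic_plus_convex_minimiser[OF c1 Jconv Jmono] by blast
  define h where "h = - (\<tau> - \<delta>) * ln 2 + (c1 * s\<^sup>2 / 2 + J s)"
  have psi: "ereal h \<le> psi_int f \<delta> \<tau>"
  proof -
    define star where "star y = (SUP x. ereal (x * y - 1 / c0 * J x))" for y
    define \<eta> where "\<eta> y = ereal (c0\<^sup>2 / (2 * c1) * y\<^sup>2) + ereal c0 * star y" for y
    have I: "(LBINT u=\<delta>..\<tau>. f u) = c0" "(LBINT u=0..\<delta>. (f u)\<^sup>2) = c1"
      "(LBINT u=\<delta>..\<tau>. lam (x * f u)) = J x" for x
      using d LBINT_eq_integral[OF _ fc] LBINT_eq_integral[OF _ f2c] LBINT_eq_integral[OF _ lc]
      by (auto simp: c0_def c1_def J_def zero_ereal_def)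
    have psi: "psi_int f \<delta> \<tau> = ereal (- (\<tau> - \<delta>) * ln 2) - (INF y. \<eta> y)"
      unfolding psi_int_def Let_def I \<eta>_def star_def ..
    \<comment> \<open>The slope at \<open>s\<close> of a supporting line of \<open>J / c0\<close>;
      for this \<open>y\<close> the supremum in the conjugate is attained at
      \<open>s\<close>.\<close>
    define y where "y = - c1 * s / c0"
    have "star y \<le> ereal (s * y - 1 / c0 * J s)"
      unfolding star_def
    proof (rule SUP_least)
      fix x
      have "(J x - J s) / c0 \<ge> - c1 * s * (x - s) / c0"
        by (intro divide_right_mono s(2) less_imp_le[OF c0])
      then show "ereal (x * y - 1 / c0 * J x) \<le> ereal (s * y - 1 / c0 * J s)"
        by (simp add: y_def diff_divide_distrib algebra_simps)
    qed
    then have "\<eta> y \<le> ereal (c0\<^sup>2 / (2 * c1) * y\<^sup>2) + ereal c0 * ereal (s * y - 1 / c0 * J s)"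
      unfolding \<eta>_def using c0 by (intro add_left_mono ereal_mult_left_mono) auto
    \<comment> \<open>The quadratic part equals \<open>c1 * s^2 / 2\<close> and the conjugate part
      \<open>- c1 * s^2 - J s\<close>; the sum is minus the minimum.\<close>
    also have "\<dots> = ereal (- (c1 * s\<^sup>2 / 2 + J s))"
    proof -
      have "c0\<^sup>2 / (2 * c1) * y\<^sup>2 = c1 * s\<^sup>2 / 2"
        using c0 c1 by (simp add: y_def power2_eq_square)
      moreover have "c0 * (s * y - 1 / c0 * J s) = - c1 * s\<^sup>2 - J s"
        using c0 by (simp add: y_def right_diff_distrib power2_eq_square)
      ultimately show ?thesis by simp
    qed
    finally have "(INF y. \<eta> y) \<le> ereal (- (c1 * s\<^sup>2 / 2 + J s))"
      by (intro INF_lower2[of y]) auto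
    then have "ereal (- (\<tau> - \<delta>) * ln 2) - ereal (- (c1 * s\<^sup>2 / 2 + J s)) \<le> psi_int f \<delta> \<tau>"
      unfolding psi by (intro ereal_minus_mono) auto
    moreover have "ereal (- (\<tau> - \<delta>) * ln 2) - ereal (- (c1 * s\<^sup>2 / 2 + J s)) = ereal h"
      by (simp add: h_def)
    ultimately show ?thesis by (simp only:)
  qed
  \<comment> \<open>Boundary term of the squared weights plus the constant part of the
    prefactor.\<close>
  define K where "K = s\<^sup>2 / 2 * (f \<delta>)\<^sup>2 + ln (f 1 / f \<delta>)"
  obtain n0 where n0: "\<forall>n>n0. (K + ln (real n) / 2) / real n < \<epsilon>"
    using eventually_log_over_n_less[OF eps] by blast
  have "ereal (ln (int_angle n (wface f n k) (wface f n l)) / real n) < psi_int f \<delta> \<tau> + ereal \<epsilon>"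
    if n: "n > n0" and kl: "real k = \<delta> * real n" "real l = \<tau> * real n" for n k l
  proof -
    let ?w = "wt f n" and ?\<beta> = "int_angle n (wface f n k) (wface f n l)"
    have n1: "real n > 0" using n by simp
    have "real k > 0" "real k < real l" "real l < real n" using kl d n1 by simp_all
    then have k: "0 < k" "k < l" "l \<le> n" by auto
    have div: "real k / real n = \<delta>" "real l / real n = \<tau>" using kl n1 by simp_all
    \<comment> \<open>Indices are shifted by one, so coordinate \<open>k - 1\<close> has weight
      \<open>f (k / n)\<close>, which is \<open>f \<delta>\<close> for every admissible n.\<close>
    have wk: "?w (k - 1) = f \<delta>" using k(1) div(1) by (simp add: wt_def)
    define S where "S = (\<Sum>i<l. (?w i)\<^sup>2)"
    have S: "S > 0" unfolding S_def
      by (intro sum_pos) (use wt_pos k in \<open>auto simp: less_imp_neq[THEN not_sym]\<close>)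
    have "sqrt S \<le> sqrt (real n * (f 1)\<^sup>2)" unfolding S_def using k by (intro real_sqrt_le_mono sum_square_le)
    then have sS: "sqrt S \<le> sqrt (real n) * f 1" using f1 by (simp add: real_sqrt_mult)
    have A: "(\<Sum>i<k. (?w i)\<^sup>2) \<le> real n * c1 + (f \<delta>)\<^sup>2"
    proof -
      have "(\<Sum>i\<in>{0..<k}. (f (real (Suc i) / real n))\<^sup>2)
        \<le> real n * integral {real 0 / real n..real k / real n} (\<lambda>u. (f u)\<^sup>2) + (f (real k / real n))\<^sup>2 - (f (real 0 / real n))\<^sup>2"
        using n k d unfolding div
        by (intro sum_right_le_integral[of n 0 k "\<lambda>u. (f u)\<^sup>2", unfolded div] continuous_intros cont_sub mono_square) auto
      then have "(\<Sum>i<k. (?w i)\<^sup>2) \<le> real n * c1 + (f \<delta>)\<^sup>2 - (f 0)\<^sup>2"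
        unfolding div by (simp add: wt_def c1_def atLeast0LessThan)
      then show ?thesis using zero_le_power2[of "f 0"] by linarith
    qed
    \<comment> \<open>\<open>s \<le> 0\<close> makes the summand decreasing in \<open>u\<close>, so
      the sum is bounded by the integral without a boundary term.\<close>
    have B: "(\<Sum>i\<in>{k..<l}. lam (s * ?w i)) \<le> real n * J s"
    proof -
      have "antimono_on {\<delta>..\<tau>} (\<lambda>u. lam (s * f u))"
        using s(1) d by (auto simp: monotone_on_def intro!: lam_mono mult_left_mono_neg f_le)
      then show ?thesis
        using sum_right_le_integral_antimono[of n k l "\<lambda>u. lam (s * f u)"] lc[of s] n k
        unfolding div by (simp add: wt_def J_def)
    qed
    have \<beta>: "?\<beta> > 0" by (rule int_angle_pos[OF wt_pos k])
    let ?E = "s\<^sup>2 / 2 * (\<Sum>i<k. (?w i)\<^sup>2) + (\<Sum>i\<in>{k..<l}. lam (s * ?w i))"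
    have "?\<beta> \<le> exp ?E / 2 ^ (l - k) * (sqrt S / f \<delta>)"
      using int_angle_le[OF wt_pos k, of s] unfolding wk S_def .
    then have "ln ?\<beta> \<le> ln (exp ?E / 2 ^ (l - k) * (sqrt S / f \<delta>))"
      using \<beta> by (intro ln_mono) auto
    also have "\<dots> = ?E - real (l - k) * ln 2 + ln (sqrt S / f \<delta>)"
      using S f\<delta> by (simp add: ln_mult ln_div ln_realpow)
    also have "real (l - k) * ln 2 = real n * ((\<tau> - \<delta>) * ln 2)"
      using k kl by (simp add: of_nat_diff algebra_simps)
    also have "ln (sqrt S / f \<delta>) \<le> ln (sqrt (real n) * f 1 / f \<delta>)"
      using S f\<delta> sS by (intro ln_mono divide_right_mono) auto
    also have "ln (sqrt (real n) * f 1 / f \<delta>) = ln (real n) / 2 + ln (f 1 / f \<delta>)"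
      using n1 f1 f\<delta> by (simp add: ln_mult ln_div ln_sqrt)
    also have "?E \<le> s\<^sup>2 / 2 * (real n * c1 + (f \<delta>)\<^sup>2) + real n * J s"
      by (intro add_mono mult_left_mono A B) auto
    also have "s\<^sup>2 / 2 * (real n * c1 + (f \<delta>)\<^sup>2) + real n * J s - real n * ((\<tau> - \<delta>) * ln 2) + (ln (real n) / 2 + ln (f 1 / f \<delta>))
      = real n * h + (K + ln (real n) / 2)"
      by (simp add: h_def K_def algebra_simps)
    finally have "ln ?\<beta> / real n \<le> (real n * h + (K + ln (real n) / 2)) / real n"
      using n1 by (intro divide_right_mono) auto
    also have "\<dots> = h + (K + ln (real n) / 2) / real n" using n1 by (simp add: add_divide_distrib)
    also have "\<dots> < h + \<epsilon>" using n0 n by simp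
    finally have "ereal (ln ?\<beta> / real n) < ereal h + ereal \<epsilon>" by simp
    also have "\<dots> \<le> psi_int f \<delta> \<tau> + ereal \<epsilon>" by (intro add_right_mono psi)
    finally show ?thesis .
  qed
  then show ?thesis by blast
qed

text \<open>Up to a constant, the exponent \<open>x^2 * S - T x\<close> is at least
  \<open>n * m\<close> uniformly in \<open>x > 0\<close>, which is \<open>D\<close>. An averaging
  argument, \<open>D'\<close>, then saves a Gaussian factor that makes the integral over
  \<open>x\<close> converge.\<close>

lemma ext_angle_exponent:
  assumes t: "0 < \<tau>" "\<tau> < 1" and eps: "\<epsilon> > 0"
  shows "\<exists>n1::nat. \<forall>n>n1. \<forall>l::nat. real l = \<tau> * real n \<longrightarrow>
    ln (ext_angle n (wface f n l) (wpoly f n)) / real n < psi_ext f \<tau> + \<epsilon>"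
proof -
  define c2 where "c2 = integral {0..\<tau>} (\<lambda>u. (f u)\<^sup>2)"
  define Z where "Z x = integral {\<tau>..1} (\<lambda>u. ln (erf (x * f u)))" for x
  define \<zeta> where "\<zeta> x = c2 * x\<^sup>2 - Z x" for x
  define m where "m = (INF x\<in>{0<..}. \<zeta> x)"
  have f\<tau>: "f \<tau> > 0" and f1: "f 1 > 0" using pos t by simp_all
  have f0: "f u > 0" if "u \<in> {\<tau>..1}" for u using pos that t by auto
  have fc: "continuous_on {\<tau>..1} f" using t by (intro cont_sub) auto
  have c2: "c2 > 0" unfolding c2_def using t by (intro integral_square_pos) auto
  have lc: "continuous_on {\<tau>..1} (\<lambda>u. ln (erf (x * f u)))" if x: "x > 0" for x
  proof -
    have "continuous_on {\<tau>..1} (\<lambda>u. erf (x * f u))"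
    proof (rule continuous_on_compose2[OF continuous_on_erf[of "x * f 1"]])
      show "(\<lambda>u. x * f u) ` {\<tau>..1} \<subseteq> {0..x * f 1}"
        using x t f0 f_le by (auto simp: less_imp_le)
    qed (intro continuous_intros fc)
    then show ?thesis
      using x f0 by (intro continuous_on_ln) (auto dest!: erf_pos[OF mult_pos_pos[OF x f0]])
  qed
  have lm: "mono_on {\<tau>..1} (\<lambda>u. ln (erf (x * f u)))" if x: "x > 0" for x
  proof (rule mono_onI)
    fix u v assume uv: "u \<in> {\<tau>..1}" "v \<in> {\<tau>..1}" "u \<le> v"
    have "erf (x * f u) \<le> erf (x * f v)"
      using x uv t f0[OF uv(1)] by (intro erf_mono mult_left_mono f_le) auto
    then show "ln (erf (x * f u)) \<le> ln (erf (x * f v))"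
      using x f0[OF uv(1)] by (intro ln_mono erf_pos) auto
  qed
  have ln_erf: "ln (erf y) \<le> 0" if "y > 0" for y
    using erf_le_1[of y] erf_pos[OF that] that by simp
  have Z0: "Z x \<le> 0" if x: "x > 0" for x
  proof -
    have "Z x \<le> integral {\<tau>..1} (\<lambda>_. 0)" unfolding Z_def
      using x f0 by (intro integral_le integrable_continuous_real lc continuous_intros ln_erf) auto
    then show ?thesis by simp
  qed
  have \<zeta>0: "\<zeta> x \<ge> 0" if "x > 0" for x
  proof -
    have "0 \<le> c2 * x\<^sup>2" using c2 by simp
    then show ?thesis using Z0[OF that] by (simp add: \<zeta>_def)
  qed
  \<comment> \<open>Nonnegativity of \<open>\<zeta>\<close> supplies the lower bound that the
    real-valued infimum requires.\<close>
  have m_le: "m \<le> \<zeta> x" if "x > 0" for x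
    unfolding m_def using \<zeta>0 that by (intro cINF_lower bdd_belowI2[where m=0]) auto
  have m0: "m \<ge> 0" unfolding m_def using \<zeta>0 by (intro cINF_greatest) auto
  have psi: "psi_ext f \<tau> = - m"
  proof -
    have I: "(LBINT u=0..\<tau>. (f u)\<^sup>2) = c2"
    proof -
      have "continuous_on {0..\<tau>} (\<lambda>u. (f u)\<^sup>2)" using t by (intro continuous_intros cont_sub) auto
      from LBINT_eq_integral[OF _ this] show ?thesis using t by (simp add: c2_def zero_ereal_def)
    qed
    have "(LBINT u=\<tau>..1. ln (erf (x * f u))) = Z x" if "x > 0" for x
      using t LBINT_eq_integral[OF _ lc[OF that]] by (simp add: Z_def one_ereal_def)
    then have "(INF x\<in>{0<..}. c2 * x\<^sup>2 - (LBINT u=\<tau>..1. ln (erf (x * f u)))) = m"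
      unfolding m_def \<zeta>_def by (intro INF_cong) auto
    then show ?thesis unfolding psi_ext_def Let_def I by simp
  qed
  \<comment> \<open>Chosen so that \<open>(1 - \<tau>) * n\<close> factors of size at most
    \<open>q\<close> already give \<open>exp (- n * m)\<close>.\<close>
  define q where "q = exp (- m / (1 - \<tau>))"
  \<comment> \<open>The linear bound on \<open>erf\<close> gives
    \<open>erf (x0 * f 1) \<le> q\<close>, so below \<open>x0\<close> every factor is at most
    \<open>q\<close>.\<close>
  define x0 where "x0 = q * sqrt pi / (2 * f 1)"
  have x0: "x0 > 0" using f1 by (simp add: x0_def q_def)
  have x0_erf: "ln (erf (x0 * f 1)) \<le> - m / (1 - \<tau>)"
  proof -
    have "erf (x0 * f 1) \<le> 2 / sqrt pi * (x0 * f 1)" using x0 f1 by (intro erf_le_linear) auto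
    also have "\<dots> = q" using f1 by (simp add: x0_def)
    finally have "ln (erf (x0 * f 1)) \<le> ln q" using x0 f1 by (intro ln_mono erf_pos) auto
    then show ?thesis by (simp add: q_def)
  qed
  \<comment> \<open>Bounds the boundary term of the Riemann sum uniformly for
    \<open>x \<ge> x0\<close>, where \<open>erf (x * f \<tau>)\<close> is at least
    \<open>erf (x0 * f \<tau>)\<close>.\<close>
  define K where "K = - ln (erf (x0 * f \<tau>))"
  have K: "K \<ge> 0" unfolding K_def using ln_erf[of "x0 * f \<tau>"] x0 f\<tau> by simp
  \<comment> \<open>The summand \<open>m\<close> pays for the share of the exponent given away in
    \<open>D'\<close>.\<close>
  define K' where "K' = m + K + ln (f 1 / sqrt c2)"
  obtain n0 where n0: "\<forall>n>n0. (K' + ln (real n) / 2) / real n < \<epsilon>"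
    using eventually_log_over_n_less[OF eps] by blast
  have "ln (ext_angle n (wface f n l) (wpoly f n)) / real n < psi_ext f \<tau> + \<epsilon>"
    if n: "n > n0" and l': "real l = \<tau> * real n" for n l
  proof -
    let ?w = "wt f n" and ?\<gamma> = "ext_angle n (wface f n l) (wpoly f n)"
    have n1: "real n \<ge> 1" using n by simp
    have "real l > 0" "real l < real n" using l' t n1 by simp_all
    then have l: "0 < l" "l \<le> n" by auto
    have div: "real l / real n = \<tau>" "real n / real n = 1" using l' n1 by simp_all
    define S where "S = (\<Sum>i<l. (?w i)\<^sup>2)"
    have Sc: "real n * c2 \<le> S"
    proof -
      have "real n * integral {real 0 / real n..real l / real n} (\<lambda>u. (f u)\<^sup>2) \<le> (\<Sum>i\<in>{0..<l}. (f (real (Suc i) / real n))\<^sup>2)"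
        using n l t unfolding div
        by (intro sum_left_le_integral(2)[of n 0 l "\<lambda>u. (f u)\<^sup>2", unfolded div] continuous_intros cont_sub mono_square) auto
      then show ?thesis unfolding div by (simp add: wt_def c2_def S_def atLeast0LessThan)
    qed
    have S: "S > 0" using Sc c2 n1 by (smt (verit) mult_pos_pos)
    define T where "T x = (\<Sum>i\<in>{l..<n}. ln (erf (x * ?w i)))" for x
    have T: "T x \<le> real n * Z x + K" if x: "x \<ge> x0" for x
    proof -
      have "T x \<le> real n * Z x + ln (erf (x * f 1)) - ln (erf (x * f \<tau>))"
        using sum_right_le_integral[of n l n "\<lambda>u. ln (erf (x * f u))"] lc[of x] lm[of x] x x0 n l
        unfolding div by (simp add: T_def Z_def wt_def)
      moreover have "ln (erf (x * f 1)) \<le> 0" using x x0 f1 by (intro ln_erf) auto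
      moreover have "ln (erf (x0 * f \<tau>)) \<le> ln (erf (x * f \<tau>))"
        using x x0 f\<tau> by (intro ln_mono erf_mono erf_pos mult_right_mono) auto
      ultimately show ?thesis by (simp add: K_def)
    qed
    have T': "T x \<le> - (real n * m)" if x: "0 < x" "x \<le> x0" for x
    proof -
      have "T x \<le> (\<Sum>i\<in>{l..<n}. - m / (1 - \<tau>))"
        unfolding T_def
      proof (rule sum_mono)
        fix i assume "i \<in> {l..<n}"
        then have w: "0 < ?w i" "?w i \<le> f 1" using wt_pos wt_le by auto
        then have "erf (x * ?w i) \<le> erf (x0 * f 1)" using x by (intro erf_mono mult_mono) auto
        then have "ln (erf (x * ?w i)) \<le> ln (erf (x0 * f 1))" using x w by (intro ln_mono erf_pos) auto
        then show "ln (erf (x * ?w i)) \<le> - m / (1 - \<tau>)" using x0_erf by simp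
      qed
      also have "\<dots> = (real n - real l) * (- m / (1 - \<tau>))" using l by (simp add: of_nat_diff)
      also have "\<dots> = - (real n * m)" using t unfolding l' by (simp add: field_simps)
      finally show ?thesis .
    qed
    have T0: "T x \<le> 0" if "x > 0" for x
      unfolding T_def using that wt_pos by (intro sum_nonpos ln_erf) auto
    have D: "real n * m - K \<le> x\<^sup>2 * S - T x" if x: "x > 0" for x
    proof (cases "x \<ge> x0")
      case True
      have "real n * m \<le> real n * \<zeta> x" using n1 by (intro mult_left_mono m_le x) auto
      also have "\<dots> = x\<^sup>2 * (real n * c2) - real n * Z x" by (simp add: \<zeta>_def algebra_simps)
      also have "\<dots> \<le> x\<^sup>2 * S - real n * Z x" using Sc by (intro diff_right_mono mult_left_mono) auto
      finally show ?thesis using T[OF True] by simp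
    next
      case False
      have "x\<^sup>2 * S \<ge> 0" using S by simp
      then show ?thesis using T'[of x] False x K by simp
    qed
    \<comment> \<open>Average of two lower bounds with weights (n - 1) / n and 1 / n: the bound
      \<open>D\<close>, and \<open>n * c2 * x^2\<close>, obtained by estimating all
      \<open>erf\<close> factors by 1.\<close>
    have D': "(real n - 1) * m - K + c2 * x\<^sup>2 \<le> x\<^sup>2 * S - T x" if x: "x > 0" for x
    proof -
      have "x\<^sup>2 * (real n * c2) \<le> x\<^sup>2 * S" using Sc by (intro mult_left_mono) auto
      then have 1: "real n * (c2 * x\<^sup>2) \<le> x\<^sup>2 * S - T x" using T0[OF x] by (simp add: algebra_simps)
      have "real n * ((real n - 1) * m - K + c2 * x\<^sup>2) = (real n - 1) * (real n * m - K) + real n * (c2 * x\<^sup>2) - K"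
        by (simp add: algebra_simps)
      also have "\<dots> \<le> (real n - 1) * (x\<^sup>2 * S - T x) + (x\<^sup>2 * S - T x) - 0"
        using n1 by (intro diff_mono add_mono mult_left_mono D[OF x] 1 K) auto
      also have "\<dots> = real n * (x\<^sup>2 * S - T x)" by (simp add: algebra_simps)
      finally show ?thesis using n1 by simp
    qed
    have \<gamma>: "?\<gamma> > 0" by (rule ext_angle_pos[OF wt_pos l])
    have "?\<gamma> \<le> exp (- ((real n - 1) * m - K)) * sqrt S / sqrt c2"
      unfolding S_def
    proof (rule ext_angle_le[OF wt_pos l c2])
      fix x :: real assume x: "x > 0"
      have "(\<Prod>i\<in>{l..<n}. erf (x * ?w i)) = exp (T x)"
        unfolding T_def by (subst exp_sum) (use x wt_pos in \<open>auto intro!: prod.cong simp: erf_pos\<close>)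
      then have "exp (- x\<^sup>2 * S) * (\<Prod>i\<in>{l..<n}. erf (x * ?w i)) = exp (- (x\<^sup>2 * S - T x))"
        by (simp add: exp_add[symmetric])
      also have "\<dots> \<le> exp (- ((real n - 1) * m - K + c2 * x\<^sup>2))" using D'[OF x] by simp
      also have "\<dots> = exp (- ((real n - 1) * m - K)) * exp (- c2 * x\<^sup>2)"
        by (simp add: exp_add[symmetric])
      finally show "exp (- x\<^sup>2 * (\<Sum>i<l. (?w i)\<^sup>2)) * (\<Prod>i\<in>{l..<n}. erf (x * ?w i))
        \<le> exp (- ((real n - 1) * m - K)) * exp (- c2 * x\<^sup>2)" by (simp add: S_def)
    qed
    also have "\<dots> \<le> exp (- ((real n - 1) * m - K)) * (sqrt (real n) * f 1) / sqrt c2"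
    proof (intro divide_right_mono mult_left_mono)
      have "sqrt S \<le> sqrt (real n * (f 1)\<^sup>2)" unfolding S_def using l by (intro real_sqrt_le_mono sum_square_le)
      then show "sqrt S \<le> sqrt (real n) * f 1" using f1 by (simp add: real_sqrt_mult)
    qed (use c2 in auto)
    finally have "ln ?\<gamma> \<le> ln (exp (- ((real n - 1) * m - K)) * (sqrt (real n) * f 1) / sqrt c2)"
      using \<gamma> by (intro ln_mono) auto
    also have "\<dots> = real n * (- m) + (K' + ln (real n) / 2)"
      using n1 f1 c2 by (simp add: ln_mult ln_div ln_sqrt K'_def algebra_simps)
    finally have "ln ?\<gamma> / real n \<le> (real n * (- m) + (K' + ln (real n) / 2)) / real n"
      using n1 by (intro divide_right_mono) auto
    also have "\<dots> = - m + (K' + ln (real n) / 2) / real n" using n1 by (simp add: field_simps)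
    also have "\<dots> < - m + \<epsilon>" using n0 n by simp
    finally show ?thesis by (simp add: psi)
  qed
  then show ?thesis by blast
qed

end

theorem theorem2:
  fixes f :: "real \<Rightarrow> real" and \<delta> \<tau> :: real
  assumes "continuous_on {0..1} f"
    and "mono_on {0..1} f"
    and "\<forall>u\<in>{0..1}. f u \<ge> 0"
    and "\<forall>u\<in>{0<..1}. f u > 0"
    and "0 < \<delta>" and "\<delta> < \<tau>" and "\<tau> < 1"
  shows "\<forall>\<epsilon>>0.
      (\<exists>n0::nat. \<forall>n>n0. \<forall>k l::nat. real k = \<delta> * real n \<and> real l = \<tau> * real n \<longrightarrow>
          ereal (ln (int_angle n (wface f n k) (wface f n l)) / real n) < psi_int f \<delta> \<tau> + ereal \<epsilon>)
    \<and> (\<exists>n1::nat. \<forall>n>n1. \<forall>l::nat. real l = \<tau> * real n \<longrightarrow>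
          ln (ext_angle n (wface f n l) (wpoly f n)) / real n < psi_ext f \<tau> + \<epsilon>)"
proof -
  interpret weight_function f by unfold_locales (use assms in auto)
  show ?thesis using assms int_angle_exponent[of \<delta> \<tau>] ext_angle_exponent[of \<tau>] by auto
qed

end
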